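(* Every poset $\mathscr P$ of type $\mathbb D$ is of finite representation type; that is, the category $\mathrm{mod}_{sp}(\Bbbk\mathscr P)$ of finitely generated socle-projective $\Bbbk\mathscr P$-modules has only finitely many pairwise nonisomorphic indecomposable objects.
   Context: $\Bbbk$ is an algebraically closed field. All posets are finite. A full subposet $\mathscr P'\subseteq\mathscr P$ is a peak-subposet if $\max\mathscr P'\subseteq\max\mathscr P$; "$\mathscr P$ contains $R$ as a peak-subposet" means that some peak-subposet of $\mathscr P$ is isomorphic to $R$. The Hasse quiver has an arrow $x\to y$ when $y$ covers $x$; $\mathscr P$ is connected if its Hasse quiver is. For an acyclic quiver $Q$, $\mathscr P_Q$ is the vertex set of $Q$ with $x\preceq y$ iff there is a path from $x$ to $y$. A finite connected poset is of type $\mathbb A$ if it contains none of the following as a peak-subposet: $\mathcal R_1=\{a,b,c\prec\star\}$ with $a,b,c$ pairwise incomparable; $\mathcal R_2=\{a\prec b,\ b\prec\star_1,\ b\prec\star_2\}$ with $\star_1,\star_2$ incomparable; $\mathcal R_3=\{a\prec\star_1,\star_2,\star_3\}$ with the $\star_i$ pairwise incomparable; $\mathcal R_{4,m}$ ($m\ge0$) with elements $\star_1,\dots,\star_{m+2},c_1,\dots,c_{m+2}$ and strict relations exactly $c_i\prec\star_i$ ($1\le i\le m+2$), $c_i\prec\star_{i-1}$ ($2\le i\le m+2$), $c_1\prec\star_{m+2}$. Put $D_i=\mathcal R_i$ for $i=1,2,3$. Let $S$ be a Dynkin quiver of type $\mathbb A$; the two ends of its underlying path are its extreme vertices. For a sink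 $z$, $\mathrm{Supp}\,I(z)$ is the set of vertices having a path to $z$. A (possibly empty) set $F$ of new arrows for $S$ is an alien set if: (a) for each $\alpha\in F$ there is a sink $z$ of $S$ with $s(\alpha),t(\alpha)\in\mathrm{Supp}\,I(z)$; (b) for each $\alpha\in F$, $t(\alpha)$ is not a source of $S$ unless it is an extreme vertex; (c) each $\alpha\in F$ is the unique path from $s(\alpha)$ to $t(\alpha)$ in $S^F$, the quiver obtained from $S$ by adding the arrows of $F$; (d) $S^F$ is acyclic. A Dynkin quiver $Q$ of type $\mathbb D_n$ ($n\ge4$) has vertices labelled so that its edges are $i-(i+1)$ for $1\le i\le n-3$, $(n-2)-(n-1)$ and $(n-2)-n$. Its $\mathbb A$-subquivers are the full subquivers on $\{1,\dots,n-1\}$ and $\{1,\dots,n-2,n\}$. $Q$ is admissible if $\mathscr P_Q$ contains $D_1$, $D_2$ or $D_3$ as a peak-subposet (the maximal elements of $\mathscr P_Q$ are the sinks of $Q$). A finite connected poset $\mathscr P$ that is not of type $\mathbb A$ is of type $\mathbb D$ if $\mathscr P=\mathscr P_{Q^F}$, where $Q$ is an admissible quiver, $F$ is a set of new arrows whose restriction to each $\mathbb A$-subquiver $S$ of $Q$ is an alien set for $S$ (possibly empty), and $Q^F$ is $Q$ with the arrows $F$ added. $\Bbbk\mathscr P$ is the incidence algebra (path algebra of the Hasse quiver modulo commutativity relations). A $\Bbbk\mathscr P$-module is a collection $M=(M_x,{}_yh_x)$ of finite-dimensional spaces $M_x$ ($x\in\mathscr P$) and linear maps ${}_yh_x:M_x\to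 M_y$ for $x\preceq y$ with ${}_xh_x=\mathrm{id}$ and ${}_wh_y\,{}_yh_x={}_wh_x$. $\mathrm{mod}_{sp}(\Bbbk\mathscr P)$ is the full subcategory of modules whose socle is projective; equivalently $\bigcap_{z\in\max\mathscr P,\,z\succ x}\ker{}_zh_x=0$ for all $x\in\mathscr P\setminus\max\mathscr P$. *)

theory Defs
  imports "HOL-Computational_Algebra.Polynomial"
begin

section \<open>Finite posets\<close>

text \<open>A poset is represented by its reflexive order relation \<^term>\<open>r\<close>, where
  \<^term>\<open>(x, y) \<in> r\<close> means \<open>x \<preceq> y\<close>. Its set of elements is \<^term>\<open>Field r\<close>,
  and its full subposets are the relations \<^term>\<open>Restr r A\<close> with \<^term>\<open>A \<subseteq> Field r\<close>.\<close>

definition finite_poset :: "'a rel \<Rightarrow> bool" where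
  "finite_poset r \<longleftrightarrow> finite (Field r) \<and> Partial_order r"

definition max_elems :: "'a rel \<Rightarrow> 'a set" where
  "max_elems r = {x \<in> Field r. \<forall>y. (x, y) \<in> r \<longrightarrow> y = x}"

definition hasse_arrows :: "'a rel \<Rightarrow> 'a rel" where
  "hasse_arrows r =
     {(x, y) \<in> r. x \<noteq> y \<and> \<not> (\<exists>z. z \<noteq> x \<and> z \<noteq> y \<and> (x, z) \<in> r \<and> (z, y) \<in> r)}"

definition connected_poset :: "'a rel \<Rightarrow> bool" where
  "connected_poset r \<longleftrightarrow> Field r \<noteq> {} \<and>
     (\<forall>x\<in>Field r. \<forall>y\<in>Field r. (x, y) \<in> (hasse_arrows r \<union> (hasse_arrows r)\<inverse>)\<^sup>*)"

definition poset_isomorphic :: "'a rel \<Rightarrow> 'b rel \<Rightarrow> bool" where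
  "poset_isomorphic r s \<longleftrightarrow>
     (\<exists>f. bij_betw f (Field r) (Field s) \<and>
          (\<forall>x\<in>Field r. \<forall>y\<in>Field r. (x, y) \<in> r \<longleftrightarrow> (f x, f y) \<in> s))"

definition contains_peak_subposet :: "'a rel \<Rightarrow> 'b rel \<Rightarrow> bool" where
  "contains_peak_subposet r s \<longleftrightarrow>
     (\<exists>A \<subseteq> Field r. max_elems (Restr r A) \<subseteq> max_elems r \<and> poset_isomorphic (Restr r A) s)"

definition R1 :: "nat rel" where
  "R1 = Id_on {0, 1, 2, 3} \<union> {(0, 3), (1, 3), (2, 3)}"

definition R2 :: "nat rel" where
  "R2 = Id_on {0, 1, 2, 3} \<union> {(0, 1), (1, 2), (1, 3), (0, 2), (0, 3)}"

definition R3 :: "nat rel" where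
  "R3 = Id_on {0, 1, 2, 3} \<union> {(0, 1), (0, 2), (0, 3)}"

text \<open>In \<open>R4 m\<close> the element \<^term>\<open>Inl i\<close> is \<open>\<star>\<^sub>i\<close> and \<^term>\<open>Inr i\<close> is \<open>c\<^sub>i\<close>.\<close>

definition R4 :: "nat \<Rightarrow> (nat + nat) rel" where
  "R4 m = Id_on (Inl ` {1..m + 2} \<union> Inr ` {1..m + 2})
     \<union> {(Inr i, Inl i) | i. i \<in> {1..m + 2}}
     \<union> {(Inr i, Inl (i - 1)) | i. i \<in> {2..m + 2}}
     \<union> {(Inr 1, Inl (m + 2))}"

definition type_A :: "'a rel \<Rightarrow> bool" where
  "type_A r \<longleftrightarrow> finite_poset r \<and> connected_poset r \<and>
     \<not> contains_peak_subposet r R1 \<and> \<not> contains_peak_subposet r R2 \<and>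
     \<not> contains_peak_subposet r R3 \<and> (\<forall>m. \<not> contains_peak_subposet r (R4 m))"


section \<open>Quivers\<close>

text \<open>A quiver is given by a vertex set \<^term>\<open>V\<close> and a set \<^term>\<open>E\<close> of arrows \<open>(s, t)\<close>.
  Parallel arrows need not be represented: Dynkin quivers have none, and an arrow that is
  the unique path between its ends has no arrow parallel to it.\<close>

definition quiver_poset :: "'v set \<Rightarrow> 'v rel \<Rightarrow> 'v rel" where
  "quiver_poset V E = {(x, y). x \<in> V \<and> y \<in> V \<and> (x, y) \<in> E\<^sup>*}"

definition quiver_sinks :: "'v set \<Rightarrow> 'v rel \<Rightarrow> 'v set" where
  "quiver_sinks V E = {x \<in> V. \<forall>y. (x, y) \<notin> E}"

definition quiver_sources :: "'v set \<Rightarrow> 'v rel \<Rightarrow> 'v set" where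
  "quiver_sources V E = {x \<in> V. \<forall>y. (y, x) \<notin> E}"

definition Supp_I :: "'v set \<Rightarrow> 'v rel \<Rightarrow> 'v \<Rightarrow> 'v set" where
  "Supp_I V E z = {x \<in> V. (x, z) \<in> E\<^sup>*}"

text \<open>Paths are lists of vertices; the one-element list is the trivial path.\<close>

definition quiver_path :: "'v rel \<Rightarrow> 'v \<Rightarrow> 'v list \<Rightarrow> 'v \<Rightarrow> bool" where
  "quiver_path E x p y \<longleftrightarrow>
     p \<noteq> [] \<and> hd p = x \<and> last p = y \<and> successively (\<lambda>u v. (u, v) \<in> E) p"

definition orientation_of :: "'v rel \<Rightarrow> 'v set set \<Rightarrow> bool" where
  "orientation_of E G \<longleftrightarrow> asym E \<and> (\<lambda>(x, y). {x, y}) ` E = G"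

text \<open>The list \<^term>\<open>vs\<close> enumerates the vertices along the underlying path, so the extreme
  vertices are \<^term>\<open>hd vs\<close> and \<^term>\<open>last vs\<close>.\<close>

definition dynkin_A :: "'v list \<Rightarrow> 'v rel \<Rightarrow> bool" where
  "dynkin_A vs E \<longleftrightarrow> vs \<noteq> [] \<and> distinct vs \<and>
     orientation_of E {{vs ! i, vs ! Suc i} | i. Suc i < length vs}"

definition alien_set :: "'v list \<Rightarrow> 'v rel \<Rightarrow> 'v rel \<Rightarrow> bool" where
  "alien_set vs E F \<longleftrightarrow> dynkin_A vs E \<and>
     F \<subseteq> set vs \<times> set vs \<and> F \<inter> E = {} \<and>
     (\<forall>(s, t)\<in>F. \<exists>z\<in>quiver_sinks (set vs) E. s \<in> Supp_I (set vs) E z \<and> t \<in> Supp_I (set vs) E z) \<and>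
     (\<forall>(s, t)\<in>F. t \<in> quiver_sources (set vs) E \<longrightarrow> t = hd vs \<or> t = last vs) \<and>
     (\<forall>(s, t)\<in>F. \<forall>p. quiver_path (E \<union> F) s p t \<longleftrightarrow> p = [s, t]) \<and>
     acyclic (E \<union> F)"

definition dynkin_D :: "nat \<Rightarrow> nat rel \<Rightarrow> bool" where
  "dynkin_D n E \<longleftrightarrow> 4 \<le> n \<and>
     orientation_of E
       ({{i, i + 1} | i. i \<in> {1..n - 3}} \<union> {{n - 2, n - 1}, {n - 2, n}})"

definition admissible_D :: "nat \<Rightarrow> nat rel \<Rightarrow> bool" where
  "admissible_D n E \<longleftrightarrow> dynkin_D n E \<and>
     (contains_peak_subposet (quiver_poset {1..n} E) R1 \<or>
      contains_peak_subposet (quiver_poset {1..n} E) R2 \<or>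
      contains_peak_subposet (quiver_poset {1..n} E) R3)"

abbreviation branch1 :: "nat \<Rightarrow> nat list" where
  "branch1 n \<equiv> [1..<n]"

abbreviation branch2 :: "nat \<Rightarrow> nat list" where
  "branch2 n \<equiv> [1..<n - 1] @ [n]"

text \<open>The clause \<^prop>\<open>acyclic (E \<union> F)\<close> is what makes \<^term>\<open>quiver_poset {1..n} (E \<union> F)\<close>
  the poset of the quiver; it does not follow formally from acyclicity on the two branches.\<close>

definition type_D :: "'a rel \<Rightarrow> bool" where
  "type_D r \<longleftrightarrow> finite_poset r \<and> connected_poset r \<and> \<not> type_A r \<and>
     (\<exists>n E F. admissible_D n E \<and> F \<subseteq> {1..n} \<times> {1..n} \<and> F \<inter> E = {} \<and>
        (\<forall>vs\<in>{branch1 n, branch2 n}. alien_set vs (Restr E (set vs)) (Restr F (set vs))) \<and>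
        acyclic (E \<union> F) \<and>
        poset_isomorphic r (quiver_poset {1..n} (E \<union> F)))"

text \<open>The full subquivers on the two branches are Dynkin quivers of type \<open>\<bbbA>\<close>, so the first
  conjunct of \<^const>\<open>alien_set\<close> is no restriction in \<^const>\<open>type_D\<close>.\<close>

lemma orientation_of_Restr:
  assumes "orientation_of E G" and "H = {e \<in> G. e \<subseteq> A}"
  shows "orientation_of (Restr E A) H"
  using assms by (auto simp: orientation_of_def asym_on_def)

lemma dynkin_A_branch1:
  assumes "dynkin_D n E"
  shows "dynkin_A (branch1 n) (Restr E (set (branch1 n)))"
proof -
  from assms have n: "4 \<le> n" by (simp add: dynkin_D_def)
  have "{{branch1 n ! i, branch1 n ! Suc i} | i. Suc i < length (branch1 n)} = {{i, i + 1} | i. i \<in> {1..n - 2}}"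
    (is "?L = ?M")
  proof (intro equalityI subsetI)
    fix e assume "e \<in> ?L"
    then obtain i where "Suc i < n - 1" "e = {Suc i, Suc (Suc i)}" by auto
    then show "e \<in> ?M" by (auto intro!: exI[of _ "Suc i"])
  next
    fix e assume "e \<in> ?M"
    then obtain i where "1 \<le> i" "i \<le> n - 2" "e = {i, i + 1}" by auto
    with n show "e \<in> ?L" by (auto intro!: exI[of _ "i - 1"])
  qed
  also have "\<dots> = {e \<in> {{i, i + 1} | i. i \<in> {1..n - 3}} \<union> {{n - 2, n - 1}, {n - 2, n}}. e \<subseteq> set (branch1 n)}"
    (is "_ = ?R")
  proof (intro equalityI subsetI)
    fix e assume "e \<in> ?M"
    then obtain i where i: "1 \<le> i" "i \<le> n - 2" "e = {i, i + 1}" by auto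
    show "e \<in> ?R"
    proof (cases "i = n - 2")
      case True
      with n have "i + 1 = n - 1" by simp
      with True i n show ?thesis by auto
    next
      case False
      with i n show ?thesis by auto
    qed
  next
    fix e assume e: "e \<in> ?R"
    then consider i where "1 \<le> i" "i \<le> n - 3" "e = {i, i + 1}" | "e = {n - 2, n - 1}" | "e = {n - 2, n}"
      by auto
    then show "e \<in> ?M"
    proof cases
      case 1
      then show ?thesis by auto
    next
      case 2
      with n have "e = {n - 2, (n - 2) + 1}" by (simp add: numeral_eq_Suc Suc_diff_Suc)
      with n show ?thesis by (intro CollectI exI[of _ "n - 2"]) auto
    next
      case 3
      with e show ?thesis by auto
    qed
  qed
  finally have edges: "{{branch1 n ! i, branch1 n ! Suc i} | i. Suc i < length (branch1 n)} = \<dots>" .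
  have "orientation_of E ({{i, i + 1} | i. i \<in> {1..n - 3}} \<union> {{n - 2, n - 1}, {n - 2, n}})"
    using assms by (simp add: dynkin_D_def)
  from orientation_of_Restr[OF this edges] n show ?thesis
    unfolding dynkin_A_def by auto
qed

lemma dynkin_A_branch2:
  assumes "dynkin_D n E"
  shows "dynkin_A (branch2 n) (Restr E (set (branch2 n)))"
proof -
  from assms have n: "4 \<le> n" by (simp add: dynkin_D_def)
  have "{{branch2 n ! i, branch2 n ! Suc i} | i. Suc i < length (branch2 n)} =
      {{i, i + 1} | i. i \<in> {1..n - 3}} \<union> {{n - 2, n}}"
    (is "?L = ?M")
  proof (intro equalityI subsetI)
    fix e assume "e \<in> ?L"
    then obtain i where e: "e = {branch2 n ! i, branch2 n ! Suc i}" and "Suc i < length (branch2 n)"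
      by blast
    with n have i: "Suc i < n - 1" "e = {branch2 n ! i, branch2 n ! Suc i}" by simp_all
    show "e \<in> ?M"
    proof (cases "i = n - 3")
      case True
      with i n have "e = {n - 2, n}"
        by (auto simp: nth_append numeral_eq_Suc Suc_diff_Suc)
      then show ?thesis by simp
    next
      case False
      with i n have "e = {Suc i, Suc (Suc i)}" "Suc i \<le> n - 3" by (auto simp: nth_append)
      then show ?thesis by (auto intro!: exI[of _ "Suc i"])
    qed
  next
    fix e assume "e \<in> ?M"
    then consider i where "1 \<le> i" "i \<le> n - 3" "e = {i, i + 1}" | "e = {n - 2, n}" by auto
    then show "e \<in> ?L"
    proof cases
      case 1
      with n show ?thesis by (intro CollectI exI[of _ "i - 1"]) (auto simp: nth_append)
    next
      case 2
      with n show ?thesis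
        by (intro CollectI exI[of _ "n - 3"]) (auto simp: nth_append numeral_eq_Suc Suc_diff_Suc)
    qed
  qed
  also have "\<dots> = {e \<in> {{i, i + 1} | i. i \<in> {1..n - 3}} \<union> {{n - 2, n - 1}, {n - 2, n}}. e \<subseteq> set (branch2 n)}"
    using n by auto
  finally have edges: "{{branch2 n ! i, branch2 n ! Suc i} | i. Suc i < length (branch2 n)} = \<dots>" .
  have "orientation_of E ({{i, i + 1} | i. i \<in> {1..n - 3}} \<union> {{n - 2, n - 1}, {n - 2, n}})"
    using assms by (simp add: dynkin_D_def)
  from orientation_of_Restr[OF this edges] n show ?thesis
    unfolding dynkin_A_def by auto
qed


section \<open>Modules over the incidence algebra\<close>

text \<open>A module over the incidence algebra of \<^term>\<open>r\<close> is a family of finite-dimensional spaces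
  with linear maps. The spaces are subspaces of an ambient vector space, the type \<open>'b\<close> with
  \<open>scale\<close>; if that space is infinite-dimensional, every module occurs up to isomorphism.
  Only the values at elements of \<^term>\<open>Field r\<close> and at vectors of the spaces matter.\<close>

record ('a, 'b) poset_rep =
  sp :: "'a \<Rightarrow> 'b set"
  mp :: "'a \<Rightarrow> 'a \<Rightarrow> 'b \<Rightarrow> 'b"  \<comment> \<open>\<open>mp M x y\<close> is the map from \<open>M\<^sub>x\<close> to \<open>M\<^sub>y\<close>\<close>

definition linear_between ::
    "('k::field \<Rightarrow> 'b::ab_group_add \<Rightarrow> 'b) \<Rightarrow>
      'b set \<Rightarrow> 'b set \<Rightarrow> ('b \<Rightarrow> 'b) \<Rightarrow> bool" where
  "linear_between scale S T f \<longleftrightarrow> f ` S \<subseteq> T \<and>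
     (\<forall>u\<in>S. \<forall>v\<in>S. f (u + v) = f u + f v) \<and> (\<forall>c. \<forall>v\<in>S. f (scale c v) = scale c (f v))"

definition is_module ::
    "('k::field \<Rightarrow> 'b::ab_group_add \<Rightarrow> 'b) \<Rightarrow>
      'a rel \<Rightarrow> ('a, 'b) poset_rep \<Rightarrow> bool" where
  "is_module scale r M \<longleftrightarrow>
     (\<forall>x\<in>Field r. module.subspace scale (sp M x) \<and> (\<exists>B. finite B \<and> module.span scale B = sp M x)) \<and>
     (\<forall>(x, y)\<in>r. linear_between scale (sp M x) (sp M y) (mp M x y)) \<and>
     (\<forall>x\<in>Field r. \<forall>v\<in>sp M x. mp M x x v = v) \<and>
     (\<forall>x y w. (x, y) \<in> r \<longrightarrow> (y, w) \<in> r \<longrightarrow>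
        (\<forall>v\<in>sp M x. mp M y w (mp M x y v) = mp M x w v))"

definition is_hom ::
    "('k::field \<Rightarrow> 'b::ab_group_add \<Rightarrow> 'b) \<Rightarrow>
      'a rel \<Rightarrow> ('a, 'b) poset_rep \<Rightarrow> ('a, 'b) poset_rep \<Rightarrow> ('a \<Rightarrow> 'b \<Rightarrow> 'b) \<Rightarrow> bool" where
  "is_hom scale r M N f \<longleftrightarrow>
     (\<forall>x\<in>Field r. linear_between scale (sp M x) (sp N x) (f x)) \<and>
     (\<forall>(x, y)\<in>r. \<forall>v\<in>sp M x. f y (mp M x y v) = mp N x y (f x v))"

definition isomorphic_modules ::
    "('k::field \<Rightarrow> 'b::ab_group_add \<Rightarrow> 'b) \<Rightarrow>
      'a rel \<Rightarrow> ('a, 'b) poset_rep \<Rightarrow> ('a, 'b) poset_rep \<Rightarrow> bool" where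
  "isomorphic_modules scale r M N \<longleftrightarrow>
     (\<exists>f. is_hom scale r M N f \<and> (\<forall>x\<in>Field r. bij_betw (f x) (sp M x) (sp N x)))"

definition submodule ::
    "('k::field \<Rightarrow> 'b::ab_group_add \<Rightarrow> 'b) \<Rightarrow>
      'a rel \<Rightarrow> ('a, 'b) poset_rep \<Rightarrow> ('a \<Rightarrow> 'b set) \<Rightarrow> bool" where
  "submodule scale r M U \<longleftrightarrow>
     (\<forall>x\<in>Field r. module.subspace scale (U x) \<and> U x \<subseteq> sp M x) \<and>
     (\<forall>(x, y)\<in>r. mp M x y ` U x \<subseteq> U y)"

definition zero_family :: "'a rel \<Rightarrow> ('a \<Rightarrow> 'b::zero set) \<Rightarrow> bool" where
  "zero_family r U \<longleftrightarrow> (\<forall>x\<in>Field r. U x = {0})"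

definition simple_submodule ::
    "('k::field \<Rightarrow> 'b::ab_group_add \<Rightarrow> 'b) \<Rightarrow>
      'a rel \<Rightarrow> ('a, 'b) poset_rep \<Rightarrow> ('a \<Rightarrow> 'b set) \<Rightarrow> bool" where
  "simple_submodule scale r M U \<longleftrightarrow> submodule scale r M U \<and> \<not> zero_family r U \<and>
     (\<forall>W. submodule scale r M W \<and> (\<forall>x\<in>Field r. W x \<subseteq> U x) \<longrightarrow>
        zero_family r W \<or> (\<forall>x\<in>Field r. W x = U x))"

definition socle ::
    "('k::field \<Rightarrow> 'b::ab_group_add \<Rightarrow> 'b) \<Rightarrow>
      'a rel \<Rightarrow> ('a, 'b) poset_rep \<Rightarrow> ('a, 'b) poset_rep" where
  "socle scale r M = M\<lparr>sp := \<lambda>x. module.span scale (\<Union>U \<in> {U. simple_submodule scale r M U}. U x)\<rparr>"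

text \<open>The lifting property is tested on modules in the same ambient space. For semisimple
  modules, the only ones to which it is applied below, the test against the epimorphisms
  from indecomposable projectives onto their tops suffices, and those modules exist in every
  nonzero ambient space.\<close>

definition projective ::
    "('k::field \<Rightarrow> 'b::ab_group_add \<Rightarrow> 'b) \<Rightarrow>
      'a rel \<Rightarrow> ('a, 'b) poset_rep \<Rightarrow> bool" where
  "projective scale r M \<longleftrightarrow> is_module scale r M \<and>
     (\<forall>N N' g f. is_module scale r N \<and> is_module scale r N' \<and> is_hom scale r N N' g \<and>
        (\<forall>x\<in>Field r. g x ` sp N x = sp N' x) \<and> is_hom scale r M N' f \<longrightarrow>
        (\<exists>h. is_hom scale r M N h \<and> (\<forall>x\<in>Field r. \<forall>v\<in>sp M x. g x (h x v) = f x v)))"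

definition socle_projective ::
    "('k::field \<Rightarrow> 'b::ab_group_add \<Rightarrow> 'b) \<Rightarrow>
      'a rel \<Rightarrow> ('a, 'b) poset_rep \<Rightarrow> bool" where
  "socle_projective scale r M \<longleftrightarrow> is_module scale r M \<and> projective scale r (socle scale r M)"

text \<open>Submodules of socle-projective modules are socle-projective, so decompositions in the
  module category and in the category of socle-projective modules are the same.\<close>

definition indecomposable ::
    "('k::field \<Rightarrow> 'b::ab_group_add \<Rightarrow> 'b) \<Rightarrow>
      'a rel \<Rightarrow> ('a, 'b) poset_rep \<Rightarrow> bool" where
  "indecomposable scale r M \<longleftrightarrow> \<not> zero_family r (sp M) \<and>
     (\<forall>U W. submodule scale r M U \<and> submodule scale r M W \<and>
        (\<forall>x\<in>Field r. U x \<inter> W x = {0} \<and> {u + w | u w. u \<in> U x \<and> w \<in> W x} = sp M x) \<longrightarrow>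
        zero_family r U \<or> zero_family r W)"

definition ind_sp ::
    "('k::field \<Rightarrow> 'b::ab_group_add \<Rightarrow> 'b) \<Rightarrow>
      'a rel \<Rightarrow> ('a, 'b) poset_rep set" where
  "ind_sp scale r = {M. socle_projective scale r M \<and> indecomposable scale r M}"

definition finite_sp_type ::
    "('k::field \<Rightarrow> 'b::ab_group_add \<Rightarrow> 'b) \<Rightarrow>
      'a rel \<Rightarrow> bool" where
  "finite_sp_type scale r \<longleftrightarrow>
     finite (ind_sp scale r //
       {(M, N). M \<in> ind_sp scale r \<and> N \<in> ind_sp scale r \<and> isomorphic_modules scale r M N})"

end

theory Submission
  imports Defs
begin

text \<open>A socle-projective module \<open>M\<close> embeds each space \<open>M\<^sub>x\<close> into the direct sum of the spaces at the
  maximal elements above \<open>x\<close>. This makes most structure maps redundant: if \<open>s\<close> and \<open>t\<close> lie below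
  \<open>z\<close> and every maximal element above \<open>t\<close> is also above \<open>z\<close>, then \<open>M\<^sub>t \<rightarrow> M\<^sub>z\<close> is injective, so
  the map \<open>M\<^sub>s \<rightarrow> M\<^sub>t\<close> is forced by the maps into \<open>M\<^sub>z\<close>. A set \<open>E'\<close> of arrows that \<^emph>\<open>determines\<close>
  all the others in this way sees everything: families of linear maps that commute with \<open>E'\<close> are
  homomorphisms, and decompositions that \<open>E'\<close> respects are decompositions of the module
  (\<open>determined_hom\<close>, \<open>determined_rep_indec\<close>). It is therefore enough to bound the
  representations of \<open>E'\<close> that arise from indecomposable socle-projective modules.

  For a star with centre \<open>v\<close> every arm induces a flag in \<open>V v\<close>, by images and preimages of the
  spaces along the arm. A basis of \<open>V v\<close> adapted to the flag extends along the arm to bases such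
  that every map sends a basis vector to the basis vector with the same label or to zero
  (\<open>frame_lift\<close>, \<open>frame_push\<close>, \<open>arm_frames\<close>). If two arms have length one, then \<open>V v\<close> carries
  one flag and two single subspaces. Such a configuration is a direct sum of lines and planes;
  one basis serves the flag and the first subspace, and the second subspace has a basis of
  vectors \<open>e\<^sub>i\<close> and \<open>e\<^sub>i + e\<^sub>j\<close> (\<open>fork_frames\<close>). Hence the representation is a direct sum of
  pieces with at most two labels and coefficients -1, 0, 1 (\<open>star_blocks\<close>). An indecomposable
  one is a single piece, and up to isomorphism it is described by one of finitely many codes
  (\<open>rep_indec_coded\<close>, \<open>coded_iso\<close>).

  It remains to find \<open>E'\<close> for the poset of a quiver \<open>E\<close> of type \<open>\<bbbD>\<close> with new arrows \<open>F\<close>. An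
  alien arrow of a path joins the two slopes that descend to one sink (\<open>alien_valley\<close>). As a
  rule nothing above its target escapes from that sink, and \<open>E' = E\<close> determines the arrow. There
  are two exceptions. An arrow \<open>p \<rightarrow> q\<close> between the two ends, both of them sinks, replaces the
  arrow \<open>m \<rightarrow> q\<close> of the branch vertex, which leaves a path. An arrow \<open>c \<rightarrow> p\<close> onto an end with
  \<open>p \<rightarrow> m \<rightarrow> q\<close> cannot be recovered if \<open>p\<close> also lies below a sink \<open>z\<close> of the long branch
  (\<open>end_arrow\<close>); it is added to \<open>E\<close> and closes a cycle. Removing the arrow of \<open>E\<close> that leaves
  \<open>c\<close> towards \<open>z\<close> gives a star again, and because the spaces between \<open>c\<close> and \<open>m\<close> embed into
  \<open>M\<^sub>z\<close>, the bases can be chosen so that the removed arrow respects them as well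
  (\<open>blocks_of_cycle\<close>).\<close>

section \<open>Chains of sets and arms of a graph\<close>

lemma chain_maximum:
  assumes "finite \<F>" "\<F> \<noteq> {}" "\<And>F G. F \<in> \<F> \<Longrightarrow> G \<in> \<F> \<Longrightarrow> F \<subseteq> G \<or> G \<subseteq> (F::'c set)"
  shows "\<exists>M\<in>\<F>. \<forall>F\<in>\<F>. F \<subseteq> M"
  using assms
proof (induction \<F> rule: finite_ne_induct)
  case (insert x A)
  then obtain M where M: "M \<in> A" "\<forall>F\<in>A. F \<subseteq> M" by auto
  consider "x \<subseteq> M" | "M \<subseteq> x" using insert.prems[of x M] M by auto
  then show ?case using M by cases auto
qed auto

lemma chain_minimum:
  assumes "finite \<F>" "\<F> \<noteq> {}" "\<And>F G. F \<in> \<F> \<Longrightarrow> G \<in> \<F> \<Longrightarrow> F \<subseteq> G \<or> G \<subseteq> (F::'c set)"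
  shows "\<exists>M\<in>\<F>. \<forall>F\<in>\<F>. M \<subseteq> F"
  using assms
proof (induction \<F> rule: finite_ne_induct)
  case (insert x A)
  then obtain M where M: "M \<in> A" "\<forall>F\<in>A. M \<subseteq> F" by auto
  consider "x \<subseteq> M" | "M \<subseteq> x" using insert.prems[of x M] M by auto
  then show ?case using M by cases auto
qed auto

definition joined :: "'x rel \<Rightarrow> 'x \<Rightarrow> 'x \<Rightarrow> bool" where
  "joined E x y \<longleftrightarrow> (x, y) \<in> E \<or> (y, x) \<in> E"

definition adjacent :: "'x list \<Rightarrow> 'x \<Rightarrow> 'x \<Rightarrow> bool" where
  "adjacent zs a b \<longleftrightarrow> (\<exists>n. Suc n < length zs \<and> {zs ! n, zs ! Suc n} = {a, b})"

lemma adjacent_set: "adjacent zs a b \<Longrightarrow> a \<in> set zs \<and> b \<in> set zs"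
proof -
  assume "adjacent zs a b"
  then obtain n where n: "Suc n < length zs" "{zs ! n, zs ! Suc n} = {a, b}" by (auto simp: adjacent_def)
  then have "zs ! n \<in> set zs" "zs ! Suc n \<in> set zs" by auto
  then show ?thesis using n(2) by (auto simp: doubleton_eq_iff)
qed

lemma successively_adjacent:
  assumes "successively (\<lambda>x y. R x y \<and> R y x) zs" "adjacent zs a b"
  shows "R a b"
proof -
  obtain n where n: "Suc n < length zs" "{zs ! n, zs ! Suc n} = {a, b}"
    using assms(2) by (auto simp: adjacent_def)
  then have "R (zs ! n) (zs ! Suc n) \<and> R (zs ! Suc n) (zs ! n)"
    using assms(1) by (auto simp: successively_conv_nth)
  then show ?thesis using n(2) by (auto simp: doubleton_eq_iff)
qed

text \<open>The list runs from the centre \<open>v\<close> outwards; the orientation of the arrows along it is arbitrary.\<close>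

definition is_arm :: "'x set \<Rightarrow> 'x rel \<Rightarrow> 'x \<Rightarrow> 'x list \<Rightarrow> bool" where
  "is_arm X E v zs \<longleftrightarrow> zs \<noteq> [] \<and> hd zs = v \<and> distinct zs \<and> successively (joined E) zs \<and> set zs \<subseteq> X"

locale ambient_space = vector_space scale
  for scale :: "'k::field \<Rightarrow> 'b::ab_group_add \<Rightarrow> 'b"
begin

section \<open>Bases adapted to chains of subspaces\<close>

lemma independent_Un:
  assumes "independent A" "independent B" "span A \<inter> span B \<subseteq> {0}"
  shows "independent (A \<union> B)"
proof -
  have "a \<notin> span (A \<union> B - {a})" if a: "a \<in> A" "independent A" "independent B" "span A \<inter> span B \<subseteq> {0}" for a A B
  proof
    assume "a \<in> span (A \<union> B - {a})"
    then have "a \<in> span ((A - {a}) \<union> B)" using span_mono[of "A \<union> B - {a}" "(A - {a}) \<union> B"] by blast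
    then obtain x y where xy: "a = x + y" "x \<in> span (A - {a})" "y \<in> span B"
      unfolding span_Un by auto
    have "x \<in> span A" using xy span_mono[of "A - {a}" A] by auto
    then have "y \<in> span A" using xy a span_diff[of a A x] by (simp add: span_base)
    then have "y = 0" using xy a by auto
    then show False using xy a by (auto simp: dependent_def)
  qed
  from this[of _ A B] this[of _ B A] assms show ?thesis
    unfolding dependent_def by (metis Int_commute Un_commute Un_iff)
qed

text \<open>A common vector has one representation in \<open>A \<union> B\<close>, which is supported both in \<open>A\<close> and in \<open>B\<close>.\<close>

lemma span_Int_disjoint:
  assumes "independent (A \<union> B)" "A \<inter> B = {}"
  shows "span A \<inter> span B = {0}"
proof -
  have "x = 0" if x: "x \<in> span A" "x \<in> span B" for x
  proof -
    have i: "independent A" "independent B" using assms independent_mono by blast+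
    have "representation (A \<union> B) x = representation A x"
      by (rule representation_extend) (use assms x in auto)
    moreover have "representation (A \<union> B) x = representation B x"
      by (rule representation_extend) (use assms x in auto)
    moreover have "representation A x b = 0 \<or> representation B x b = 0" for b
      using assms(2) representation_ne_zero by blast
    ultimately have "\<And>b. representation A x b = 0" by metis
    moreover have "(\<Sum>b | representation A x b \<noteq> 0. scale (representation A x b) b) = x"
      by (rule sum_nonzero_representation_eq) (use i x in auto)
    ultimately show ?thesis by simp
  qed
  then show ?thesis by (auto simp: span_zero)
qed

definition findim :: "'b set \<Rightarrow> bool" where
  "findim V \<longleftrightarrow> subspace V \<and> (\<exists>B. finite B \<and> span B = V)"

lemma findim_subspace: "findim V \<Longrightarrow> subspace V"
  by (simp add: findim_def)

lemma extend_to_basis: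
  assumes "findim V" "I \<subseteq> V" "independent I"
  obtains B where "I \<subseteq> B" "independent B" "span B = V" "finite B"
proof -
  obtain B where B: "I \<subseteq> B" "B \<subseteq> V" "independent B" "V \<subseteq> span B"
    using maximal_independent_subset_extend[OF assms(2,3)] .
  obtain C where "finite C" "span C = V" using assms(1) by (auto simp: findim_def)
  then have "finite B" using independent_span_bound[of C B] B by auto
  moreover have "span B = V" using B assms(1) findim_subspace span_subspace by blast
  ultimately show ?thesis using that B by blast
qed

lemma findim_subset:
  assumes "findim V" "subspace S" "S \<subseteq> V"
  shows "findim S"
proof -
  obtain B where B: "B \<subseteq> S" "independent B" "S \<subseteq> span B"
    using maximal_independent_subset .
  obtain C where "finite C" "span C = V" using assms(1) by (auto simp: findim_def)
  then have "finite B" using independent_span_bound[of C B] B assms by auto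
  moreover have "span B = S" using B assms span_subspace by blast
  ultimately show ?thesis using assms by (auto simp: findim_def)
qed

text \<open>The prescribed set \<open>I\<close> has to be adapted to the chain already. The basis is built upwards: one
  of the largest member \<open>M\<close> by induction, then the part of \<open>I\<close> outside \<open>M\<close>, which is independent
  of \<open>M\<close> precisely because \<open>I\<close> is adapted to \<open>M\<close>, then an arbitrary completion.\<close>

lemma chain_adapted_basis:
  assumes "finite \<F>" "findim V" "\<And>F. F \<in> \<F> \<Longrightarrow> subspace F \<and> F \<subseteq> V"
    and "\<And>F G. F \<in> \<F> \<Longrightarrow> G \<in> \<F> \<Longrightarrow> F \<subseteq> G \<or> G \<subseteq> F"
    and "I \<subseteq> V" "independent I" "\<And>F. F \<in> \<F> \<Longrightarrow> F \<inter> span I \<subseteq> span (I \<inter> F)"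
  shows "\<exists>B. I \<subseteq> B \<and> finite B \<and> independent B \<and> span B = V \<and> (\<forall>F\<in>\<F>. F \<subseteq> span (B \<inter> F))"
  using assms
proof (induction "card \<F>" arbitrary: \<F> V I)
  case 0
  then have "\<F> = {}" by simp
  then show ?case using extend_to_basis[OF 0(3) 0(6,7)] by auto
next
  case (Suc n)
  then have "\<F> \<noteq> {}" by auto
  then obtain M where M0: "M \<in> \<F>" "\<forall>F\<in>\<F>. F \<subseteq> M"
    using chain_maximum[OF Suc.prems(1) _ Suc.prems(4)] by blast
  then have M: "M \<in> \<F>" "\<And>F. F \<in> \<F> \<Longrightarrow> F \<subseteq> M" by simp_all
  have Msub: "subspace M" "M \<subseteq> V" using Suc.prems(3) M by auto
  have "\<exists>B. I \<inter> M \<subseteq> B \<and> finite B \<and> independent B \<and> span B = M \<and> (\<forall>F\<in>\<F> - {M}. F \<subseteq> span (B \<inter> F))"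
  proof (rule Suc.hyps(1))
    show "n = card (\<F> - {M})" using Suc.hyps(2) Suc.prems(1) M by simp
    show "findim M" using Suc.prems(2) Msub by (rule findim_subset)
    show "independent (I \<inter> M)" using Suc.prems(6) independent_mono by blast
    show "F \<inter> span (I \<inter> M) \<subseteq> span (I \<inter> M \<inter> F)" if "F \<in> \<F> - {M}" for F
    proof -
      have "F \<inter> span (I \<inter> M) \<subseteq> F \<inter> span I" using span_mono[of "I \<inter> M" I] by auto
      also have "\<dots> \<subseteq> span (I \<inter> F)" using that Suc.prems(7) by auto
      also have "I \<inter> F = I \<inter> M \<inter> F" using M(2)[of F] that by auto
      finally show ?thesis .
    qed
  qed (use Suc.prems M in auto)
  then obtain B where B: "I \<inter> M \<subseteq> B" "finite B" "independent B" "span B = M"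
    "\<And>F. F\<in>\<F> - {M} \<Longrightarrow> F \<subseteq> span (B \<inter> F)" by blast
  have BM: "B \<subseteq> M" using B(4) span_superset by auto
  have "independent (B \<union> (I - M))"
  proof (rule independent_Un)
    show "independent (I - M)" using Suc.prems(6) independent_mono by blast
    have I: "independent ((I - M) \<union> (I \<inter> M))" using Suc.prems(6) by (simp add: Un_Diff_Int)
    have "span B \<inter> span (I - M) \<subseteq> span (I \<inter> M) \<inter> span (I - M)"
      using Suc.prems(7)[OF M(1)] span_mono[of "I - M" I] B(4) by auto
    also have "\<dots> \<subseteq> {0}" using span_Int_disjoint[OF I] by auto
    finally show "span B \<inter> span (I - M) \<subseteq> {0}" .
  qed (use B in auto)
  then obtain C where C: "B \<union> (I - M) \<subseteq> C" "independent C" "span C = V" "finite C"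
    using extend_to_basis[OF Suc.prems(2), of "B \<union> (I - M)"] BM Msub Suc.prems(5) by blast
  have "F \<subseteq> span (C \<inter> F)" if "F \<in> \<F>" for F
  proof (cases "F = M")
    case True
    have "F = span B" using B(4) True by simp
    also have "\<dots> \<subseteq> span (C \<inter> F)" using C(1) BM True by (intro span_mono) auto
    finally show ?thesis .
  next
    case False
    then have "F \<subseteq> span (B \<inter> F)" using B(5) that by auto
    also have "\<dots> \<subseteq> span (C \<inter> F)" using C(1) by (intro span_mono) auto
    finally show ?thesis .
  qed
  moreover have "I \<subseteq> C" using B(1) C(1) by auto
  ultimately show ?case using C by blast
qed

section \<open>Frames and linear maps\<close>

text \<open>A frame is a finite basis with labels in \<^typ>\<open>nat\<close>; the value 0 says that a label does not occur.
  Labels make it possible to compare the bases of different spaces: the aim is that maps send a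
  vector to the vector with the same label or to 0.\<close>

definition frame :: "(nat \<Rightarrow> 'b) \<Rightarrow> 'b set \<Rightarrow> bool" where
  "frame e V \<longleftrightarrow> finite {i. e i \<noteq> 0} \<and> inj_on e {i. e i \<noteq> 0} \<and>
     independent (e ` {i. e i \<noteq> 0}) \<and> span (range e) = V"

definition adapted :: "(nat \<Rightarrow> 'b) \<Rightarrow> 'b set \<Rightarrow> bool" where
  "adapted e S \<longleftrightarrow> S \<subseteq> span (range e \<inter> S)"

lemma span_support: "span (range e \<inter> S) = span (e ` {i. e i \<noteq> 0} \<inter> S)"
proof -
  have "range e \<inter> S - {0} = e ` {i. e i \<noteq> 0} \<inter> S" by auto
  then show ?thesis by (metis span_delete_0)
qed

lemma frame_span: "frame e V \<Longrightarrow> span (e ` {i. e i \<noteq> 0}) = V"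
  using span_support[of e UNIV] by (simp add: frame_def)

lemma frame_in: "frame e V \<Longrightarrow> e i \<in> V"
  unfolding frame_def using span_superset by fastforce

lemma frame_findim: "frame e V \<Longrightarrow> findim V"
  using frame_span[of e V] unfolding findim_def frame_def by (metis finite_imageI subspace_span)

text \<open>The basis vectors that have no label yet receive fresh ones.\<close>

lemma frame_of_basis:
  assumes D: "finite {i. e i \<noteq> (0::'b)}" "inj_on e {i. e i \<noteq> 0}"
    and B: "finite B" "independent B" "e ` {i. e i \<noteq> 0} \<subseteq> B" "span B = V"
  obtains e' where "frame e' V" "\<And>i. e i \<noteq> 0 \<Longrightarrow> e' i = e i" "e' ` {i. e' i \<noteq> 0} = B"
proof -
  define D where "D = {i. e i \<noteq> 0}"
  define C where "C = B - e ` D"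
  have "infinite (- D)" using D by (simp add: D_def Compl_eq_Diff_UNIV)
  then obtain T where T: "T \<subseteq> - D" "card T = card C" "finite T"
    by (meson infinite_arbitrarily_large)
  moreover have "finite C" using B C_def by simp
  ultimately obtain g where g: "bij_betw g T C"
    by (metis finite_same_card_bij)
  define e' where "e' i = (if i \<in> T then g i else e i)" for i
  have nz: "0 \<notin> B" using B(2) dependent_zero by blast
  have gC: "g i \<in> C" if "i \<in> T" for i using g that by (auto simp: bij_betw_def)
  have D': "{i. e' i \<noteq> 0} = D \<union> T"
  proof -
    have "e' i \<noteq> 0 \<longleftrightarrow> i \<in> D \<union> T" for i
      using gC[of i] nz T(1) by (cases "i \<in> T") (auto simp: e'_def D_def C_def)
    then show ?thesis by auto
  qed
  have im: "e' ` (D \<union> T) = B"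
  proof -
    have "e' ` D = e ` D" using T(1) by (intro image_cong) (auto simp: e'_def)
    moreover have "e' ` T = C" using g by (auto simp: e'_def bij_betw_def)
    ultimately show ?thesis using B(3) by (auto simp: C_def D_def image_Un)
  qed
  have "inj_on e' (D \<union> T)"
  proof -
    have "inj_on e' D" using D(2) T(1) unfolding inj_on_def D_def e'_def by auto
    moreover have "inj_on e' T" using g by (auto simp: inj_on_def e'_def bij_betw_def)
    moreover have "e' ` D \<inter> e' ` T = {}"
    proof -
      have "e' ` D = e ` D" using T(1) by (intro image_cong) (auto simp: e'_def)
      moreover have "e' ` T = C" using g by (auto simp: e'_def bij_betw_def)
      ultimately show ?thesis by (auto simp: C_def)
    qed
    ultimately show ?thesis by (subst inj_on_Un) auto
  qed
  moreover have "span (range e') = V"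
    using span_support[of e' UNIV] D' im B(4) by simp
  ultimately have "frame e' V" unfolding frame_def D' im
    using D(1) T(3) B(2) by (simp add: D_def)
  moreover have "e' i = e i" if "e i \<noteq> 0" for i using that T(1) by (auto simp: e'_def D_def)
  ultimately show ?thesis using that[of e'] im D' by simp
qed

text \<open>Pulling back. For each frame vector in the image of \<open>V\<close> a preimage is taken in the smallest
  member of the chain whose image contains it; a basis of the kernel adapted to the chain
  completes these preimages. The hypothesis on the images \<open>f ` F\<close> makes every \<open>F\<close> the span of
  the chosen preimages in it and of its part of the kernel.\<close>

lemma frame_lift:
  assumes f: "Vector_Spaces.linear scale scale f" "f ` V \<subseteq> W" and V: "findim V"
    and \<F>: "finite \<F>" "\<And>F. F \<in> \<F> \<Longrightarrow> subspace F \<and> F \<subseteq> V"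
      "\<And>F G. F \<in> \<F> \<Longrightarrow> G \<in> \<F> \<Longrightarrow> F \<subseteq> G \<or> G \<subseteq> F"
    and e: "frame e W" "\<And>F. F \<in> insert V \<F> \<Longrightarrow> adapted e (f ` F)"
  shows "\<exists>e'. frame e' V \<and> (\<forall>F\<in>\<F>. adapted e' F) \<and> (\<forall>i. f (e' i) = e i \<or> f (e' i) = 0)"
proof -
  interpret f: Vector_Spaces.linear scale scale f by fact
  define D where "D = {i. e i \<noteq> 0 \<and> e i \<in> f ` V}"
  have "\<exists>v. v \<in> V \<and> f v = e i \<and> (\<forall>F\<in>\<F>. e i \<in> f ` F \<longrightarrow> v \<in> F)" if i: "i \<in> D" for i
  proof -
    (* The smallest member whose image contains the vector yields a preimage that lies in all
       the others. *)
    let ?G = "{F \<in> insert V \<F>. e i \<in> f ` F}"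
    have "\<exists>M\<in>?G. \<forall>F\<in>?G. M \<subseteq> F"
    proof (rule chain_minimum)
      show "finite ?G" using \<F>(1) by simp
      show "?G \<noteq> {}" using i by (auto simp: D_def)
      have "F \<subseteq> G \<or> G \<subseteq> F" if "F \<in> insert V \<F>" "G \<in> insert V \<F>" for F G
        using that \<F>(2,3) by (metis insertE subset_refl)
      then show "\<And>F G. F \<in> ?G \<Longrightarrow> G \<in> ?G \<Longrightarrow> F \<subseteq> G \<or> G \<subseteq> F" by blast
    qed
    then obtain M where M0: "M \<in> ?G" "\<forall>F\<in>?G. M \<subseteq> F" by blast
    have M: "M \<subseteq> F" if "F \<in> \<F>" "e i \<in> f ` F" for F
      using M0 that by simp_all
    have "M \<in> insert V \<F>" "e i \<in> f ` M" using M0(1) by simp_all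
    then obtain v where "v \<in> M" "f v = e i" by fastforce
    moreover have "M \<subseteq> V" using \<open>M \<in> insert V \<F>\<close> \<F>(2) by blast
    ultimately show ?thesis using M by blast
  qed
  then obtain g where g: "\<And>i. i \<in> D \<Longrightarrow> g i \<in> V" "\<And>i. i \<in> D \<Longrightarrow> f (g i) = e i"
    "\<And>i F. i \<in> D \<Longrightarrow> F \<in> \<F> \<Longrightarrow> e i \<in> f ` F \<Longrightarrow> g i \<in> F" by metis
  (* The kernel, with a basis adapted to the intersections with the chain. *)
  define K where "K = {v \<in> V. f v = 0}"
  have Ksub: "subspace K"
    unfolding K_def using V f.subspace_kernel by (auto simp: findim_def subspace_def f.add f.scale)
  have "\<exists>B. {} \<subseteq> B \<and> finite B \<and> independent B \<and> span B = K \<and> (\<forall>F\<in>(\<lambda>F. F \<inter> K) ` \<F>. F \<subseteq> span (B \<inter> F))"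
  proof (rule chain_adapted_basis)
    show "findim K" by (rule findim_subset[OF V Ksub]) (auto simp: K_def)
    show "\<And>F G. F \<in> (\<lambda>F. F \<inter> K) ` \<F> \<Longrightarrow> G \<in> (\<lambda>F. F \<inter> K) ` \<F> \<Longrightarrow> F \<subseteq> G \<or> G \<subseteq> F"
      using \<F>(3) by blast
    show "F \<inter> span {} \<subseteq> span ({} \<inter> F)" for F by auto
  qed (use \<F> Ksub independent_empty in \<open>auto intro: subspace_inter\<close>)
  then obtain B where B: "finite B" "independent B" "span B = K"
    and BF: "\<forall>F\<in>(\<lambda>F. F \<inter> K) ` \<F>. F \<subseteq> span (B \<inter> F)" by metis
  have BF: "F \<inter> K \<subseteq> span (B \<inter> (F \<inter> K))" if "F \<in> \<F>" for F
    using BF that by simp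
  have Dsub: "D \<subseteq> {i. e i \<noteq> 0}" by (auto simp: D_def)
  have finD: "finite D" and injD: "inj_on e D"
    using e(1) Dsub unfolding frame_def by (blast intro: finite_subset inj_on_subset)+
  have injg: "inj_on g D" using injD g(2) by (metis inj_on_def)
  define e0 where "e0 i = (if i \<in> D then g i else 0)" for i
  have D0: "{i. e0 i \<noteq> 0} = D" using g(2) f.zero by (force simp: e0_def D_def)
  have im0: "e0 ` D = g ` D" by (simp add: e0_def)
  have fg: "f ` g ` D = e ` D" using g(2) by (auto simp: image_iff)
  have inde: "independent (e ` D)"
    using e(1) Dsub independent_mono[of "e ` {i. e i \<noteq> 0}" "e ` D"] unfolding frame_def by blast
  have injf: "inj_on f (g ` D)" using g(2) injD by (auto simp: inj_on_def)
  have injs: "inj_on f (span (g ` D))"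
    using f.inj_on_span_iff_independent_image[of "g ` D"] inde injf fg by auto
  have indg: "independent (g ` D)"
  proof
    assume "dependent (g ` D)"
    then obtain b where b: "b \<in> g ` D" "b \<in> span (g ` D - {b})" unfolding dependent_def by auto
    then have "f b \<in> span (f ` (g ` D - {b}))" unfolding f.span_image by auto
    also have "f ` (g ` D - {b}) = f ` g ` D - {f b}"
      using inj_on_image_set_diff[OF injf, of "g ` D" "{b}"] b(1) by auto
    finally show False using inde b(1) unfolding fg[symmetric] dependent_def by auto
  qed
  have ind: "independent (g ` D \<union> B)"
  proof (rule independent_Un[OF indg B(2)], rule subsetI)
    fix x assume "x \<in> span (g ` D) \<inter> span B"
    then have "x \<in> span (g ` D)" "f x = 0" using B(3) by (auto simp: K_def)
    then show "x \<in> {0}" using injs f.zero span_zero by (metis inj_onD insertI1)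
  qed
  (* Subtracting a combination of lifts with the same image leaves a vector of F in the
     kernel. *)
  have cover: "F \<subseteq> span ((g ` D \<union> B) \<inter> F)"
    if F: "F \<in> insert V \<F>" "F \<inter> K \<subseteq> span (B \<inter> (F \<inter> K))" for F
  proof
    fix v assume v: "v \<in> F"
    have Fs: "subspace F" using F \<F>(2) V by (auto simp: findim_def)
    have FV: "F \<subseteq> V" using F \<F>(2) by auto
    have "f v \<in> span (range e \<inter> f ` F)" using e(2)[OF F(1)] v unfolding adapted_def by auto
    also have "\<dots> = span (e ` {i. e i \<noteq> 0} \<inter> f ` F)" by (rule span_support)
    also have "\<dots> \<subseteq> span (f ` (g ` D \<inter> F))"
    proof (rule span_mono, rule subsetI)
      fix w assume "w \<in> e ` {i. e i \<noteq> 0} \<inter> f ` F"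
      then obtain i where i: "w = e i" "e i \<noteq> 0" "e i \<in> f ` F" by auto
      then have "i \<in> D" using FV by (auto simp: D_def)
      moreover have "g i \<in> F" using g(1,3)[OF \<open>i \<in> D\<close>] F(1) i(3) by auto
      ultimately have "g i \<in> g ` D \<inter> F" "w = f (g i)" using i(1) g(2) by auto
      then show "w \<in> f ` (g ` D \<inter> F)" by blast
    qed
    also have "\<dots> = f ` span (g ` D \<inter> F)" by (rule f.span_image)
    finally obtain u where u: "u \<in> span (g ` D \<inter> F)" "f v = f u" by auto
    have uF: "u \<in> F" using u(1) span_minimal[OF _ Fs, of "g ` D \<inter> F"] by auto
    have "v - u \<in> F \<inter> K" using v uF u(2) Fs FV subspace_diff by (auto simp: K_def f.diff)
    then have "v - u \<in> span (B \<inter> F)" using F(2) span_mono[of "B \<inter> (F \<inter> K)" "B \<inter> F"] by blast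
    then have "v - u \<in> span ((g ` D \<union> B) \<inter> F)" "u \<in> span ((g ` D \<union> B) \<inter> F)"
      using u(1) span_mono[of "B \<inter> F" "(g ` D \<union> B) \<inter> F"] span_mono[of "g ` D \<inter> F" "(g ` D \<union> B) \<inter> F"]
      by blast+
    then have "(v - u) + u \<in> span ((g ` D \<union> B) \<inter> F)" by (rule span_add)
    then show "v \<in> span ((g ` D \<union> B) \<inter> F)" by simp
  qed
  have BV: "B \<subseteq> K" using B(3) span_superset by auto
  have KV: "K \<subseteq> V" by (auto simp: K_def)
  have sp: "span (g ` D \<union> B) = V"
  proof
    show "span (g ` D \<union> B) \<subseteq> V"
      by (rule span_minimal) (use g(1) BV V in \<open>auto simp: K_def findim_def\<close>)
    have "V \<inter> K \<subseteq> span (B \<inter> (V \<inter> K))"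
      using BV KV B(3) by (simp add: Int_absorb1 Int_absorb2)
    then have "V \<subseteq> span ((g ` D \<union> B) \<inter> V)" by (intro cover) auto
    also have "\<dots> \<subseteq> span (g ` D \<union> B)" by (intro span_mono) auto
    finally show "V \<subseteq> span (g ` D \<union> B)" .
  qed
  have fin0: "finite {i. e0 i \<noteq> 0}" "inj_on e0 {i. e0 i \<noteq> 0}"
    unfolding D0 using finD injg by (auto simp: e0_def inj_on_def)
  obtain e' where e': "frame e' V" "\<And>i. e0 i \<noteq> 0 \<Longrightarrow> e' i = e0 i" "e' ` {i. e' i \<noteq> 0} = g ` D \<union> B"
  proof (rule frame_of_basis[OF fin0, of "g ` D \<union> B" V])
    show "e0 ` {i. e0 i \<noteq> 0} \<subseteq> g ` D \<union> B" unfolding D0 im0 by simp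
  qed (use sp ind finD B(1) in auto)
  have "adapted e' F" if "F \<in> \<F>" for F
    unfolding adapted_def span_support e'(3) using cover[of F] BF that by auto
  moreover have "f (e' i) = e i \<or> f (e' i) = 0" for i
  proof (cases "i \<in> D")
    case True
    then have "e0 i = g i" "e0 i \<noteq> 0" using D0 by (simp add: e0_def, blast)
    then show ?thesis using e'(2) g(2) True by simp
  next
    case False
    show ?thesis
    proof (cases "e' i = 0")
      case True then show ?thesis using f.zero by simp
    next
      case nz: False
      have "e' i \<notin> g ` D"
      proof
        assume "e' i \<in> g ` D"
        then obtain j where j: "j \<in> D" "e' i = g j" by auto
        have "e0 j \<noteq> 0" using j(1) D0 by auto
        then have "e' j = g j" using e'(2)[of j] j(1) by (simp add: e0_def)
        then have "e' j = e' i" "e' j \<noteq> 0" using j nz by auto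
        then have "i = j" using e'(1) nz unfolding frame_def inj_on_def by auto
        then show False using j False by simp
      qed
      then have "e' i \<in> B" using e'(3) nz by blast
      then show ?thesis using BV by (auto simp: K_def)
    qed
  qed
  ultimately show ?thesis using e'(1) by blast
qed

text \<open>Pushing forward. The nonzero images of the frame vectors are independent because the frame is
  adapted to the kernel, and adapted to the chain because the frame is adapted to the preimages;
  so they extend to an adapted basis.\<close>

lemma frame_push:
  assumes f: "Vector_Spaces.linear scale scale f" "f ` W \<subseteq> V" and V: "findim V"
    and \<F>: "finite \<F>" "\<And>F. F \<in> \<F> \<Longrightarrow> subspace F \<and> F \<subseteq> V"
      "\<And>F G. F \<in> \<F> \<Longrightarrow> G \<in> \<F> \<Longrightarrow> F \<subseteq> G \<or> G \<subseteq> F"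
    and e: "frame e W" "\<And>F. F \<in> insert {0} \<F> \<Longrightarrow> adapted e {w \<in> W. f w \<in> F}"
  shows "\<exists>e'. frame e' V \<and> (\<forall>F\<in>\<F>. adapted e' F) \<and> (\<forall>i. f (e i) = e' i \<or> f (e i) = 0)"
proof -
  interpret f: Vector_Spaces.linear scale scale f by fact
  define D where "D = {i. f (e i) \<noteq> 0}"
  define D' where "D' = {i. e i \<noteq> 0 \<and> f (e i) = 0}"
  have DD: "D \<union> D' = {i. e i \<noteq> 0}" "D \<inter> D' = {}" using f.zero by (auto simp: D_def D'_def)
  have inje: "inj_on e (D \<union> D')" and inde: "independent (e ` (D \<union> D'))" and fine: "finite (D \<union> D')"
    using e(1) by (auto simp: frame_def DD)
  have "inj_on f (span (e ` D))"
  proof -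
    have "x = 0" if x: "x \<in> span (e ` D)" "f x = 0" for x
    proof -
      have "x \<in> W"
        using x span_minimal[of "e ` D" W] frame_in[OF e(1)] findim_subspace[OF frame_findim[OF e(1)]] by blast
      then have "x \<in> span (range e \<inter> {w \<in> W. f w \<in> {0}})"
        using e(2)[of "{0}"] x by (auto simp: adapted_def)
      also have "\<dots> = span (e ` {i. e i \<noteq> 0} \<inter> {w \<in> W. f w \<in> {0}})" by (rule span_support)
      also have "\<dots> \<subseteq> span (e ` D')" by (intro span_mono) (auto simp: D'_def)
      finally have "x \<in> span (e ` D) \<inter> span (e ` D')" using x by simp
      moreover have "e ` D \<inter> e ` D' = {}" using DD(2) inje by (auto simp: inj_on_def)
      ultimately show "x = 0" using span_Int_disjoint[of "e ` D" "e ` D'"] inde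
        unfolding image_Un by blast
    qed
    then show ?thesis by (subst f.inj_on_iff_eq_0) auto
  qed
  moreover have "independent (e ` D)" using inde independent_mono by (metis image_mono sup_ge1)
  ultimately have ind: "independent (f ` e ` D)" and injfe: "inj_on f (e ` D)"
    using f.independent_injective_image inj_on_subset span_superset by blast+
  define I where "I = f ` e ` D"
  have "\<exists>B. I \<subseteq> B \<and> finite B \<and> independent B \<and> span B = V \<and> (\<forall>F\<in>\<F>. F \<subseteq> span (B \<inter> F))"
  proof (rule chain_adapted_basis[OF \<F>(1) V \<F>(2,3)])
    show "I \<subseteq> V" using f(2) frame_in[OF e(1)] by (auto simp: I_def)
    show "independent I" using ind by (simp add: I_def)
    show "F \<inter> span I \<subseteq> span (I \<inter> F)" if F: "F \<in> \<F>" for F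
    proof
      fix y assume y: "y \<in> F \<inter> span I"
      then obtain x where x: "x \<in> span (e ` D)" "y = f x" unfolding I_def f.span_image by auto
      have "x \<in> W"
        using x span_minimal[of "e ` D" W] frame_in[OF e(1)] findim_subspace[OF frame_findim[OF e(1)]] by blast
      then have "x \<in> span (range e \<inter> {w \<in> W. f w \<in> F})"
        using e(2)[of F] x y F by (auto simp: adapted_def)
      then have "y \<in> f ` span (range e \<inter> {w \<in> W. f w \<in> F})" using x by auto
      also have "\<dots> = span (f ` (range e \<inter> {w \<in> W. f w \<in> F}))" by (rule f.span_image[symmetric])
      also have "\<dots> \<subseteq> span (insert 0 (I \<inter> F))"
        by (intro span_mono) (auto simp: I_def D_def)
      finally show "y \<in> span (I \<inter> F)" by simp
    qed
  qed auto
  then obtain B where B: "I \<subseteq> B" "finite B" "independent B" "span B = V"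
    "\<And>F. F\<in>\<F> \<Longrightarrow> F \<subseteq> span (B \<inter> F)" by blast
  have fin0: "finite {i. (f \<circ> e) i \<noteq> 0}" "inj_on (f \<circ> e) {i. (f \<circ> e) i \<noteq> 0}"
    using fine inje injfe unfolding D_def[symmetric] comp_def
    by (auto simp: D_def[symmetric] inj_on_def)
  have im: "(f \<circ> e) ` {i. (f \<circ> e) i \<noteq> 0} = I" by (auto simp: I_def D_def)
  obtain e' where e': "frame e' V" "\<And>i. (f \<circ> e) i \<noteq> 0 \<Longrightarrow> e' i = (f \<circ> e) i" "e' ` {i. e' i \<noteq> 0} = B"
    using frame_of_basis[OF fin0, of B V] B im by auto
  have "adapted e' F" if "F \<in> \<F>" for F
    unfolding adapted_def span_support e'(3) using B(5) that by auto
  moreover have "f (e i) = e' i \<or> f (e i) = 0" for i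
    using e'(2)[of i] by auto
  ultimately show ?thesis using e'(1) by blast
qed

section \<open>Frames along an arm\<close>

abbreviation lin :: "('b \<Rightarrow> 'b) \<Rightarrow> bool" where
  "lin f \<equiv> Vector_Spaces.linear scale scale f"

text \<open>Representations of the arrows \<open>E\<close> without any relations. The maps are linear on the whole
  ambient space, so that the theory of linear maps applies to them; only their restrictions to
  the spaces \<open>V x\<close> matter.\<close>

definition is_rep :: "'x set \<Rightarrow> 'x rel \<Rightarrow> ('x \<Rightarrow> 'b set) \<Rightarrow> ('x \<Rightarrow> 'x \<Rightarrow> 'b \<Rightarrow> 'b) \<Rightarrow> bool" where
  "is_rep X E V h \<longleftrightarrow> (\<forall>x\<in>X. findim (V x)) \<and>
     (\<forall>(a, b)\<in>E. a \<in> X \<and> b \<in> X \<and> lin (h a b) \<and> h a b ` V a \<subseteq> V b)"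

lemma is_repD:
  assumes "is_rep X E V h"
  shows "x \<in> X \<Longrightarrow> findim (V x)" "(a, b) \<in> E \<Longrightarrow> lin (h a b)" "(a, b) \<in> E \<Longrightarrow> h a b ` V a \<subseteq> V b"
    "(a, b) \<in> E \<Longrightarrow> v \<in> V a \<Longrightarrow> h a b v \<in> V b"
  using assms unfolding is_rep_def by fast+

text \<open>The flag in the space at the first vertex of an arm: all subspaces that arise from the zero
  spaces and the full spaces further out, transported inwards by images and preimages.\<close>

fun arm_flag :: "'x rel \<Rightarrow> ('x \<Rightarrow> 'b set) \<Rightarrow> ('x \<Rightarrow> 'x \<Rightarrow> 'b \<Rightarrow> 'b) \<Rightarrow> 'x list \<Rightarrow> 'b set set" where
  "arm_flag E V h (y # x # zs) =
     (if (x, y) \<in> E then (\<lambda>F. h x y ` F) ` insert (V x) (arm_flag E V h (x # zs))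
      else (\<lambda>F. {v \<in> V y. h y x v \<in> F}) ` insert {0} (arm_flag E V h (x # zs)))"
| "arm_flag E V h zs = {}"

lemma arm_flag_props:
  assumes "is_rep X E V h" "successively (joined E) zs" "set zs \<subseteq> X"
  shows "finite (arm_flag E V h zs) \<and>
    (\<forall>F\<in>arm_flag E V h zs. subspace F \<and> F \<subseteq> V (hd zs)) \<and>
    (\<forall>F\<in>arm_flag E V h zs. \<forall>G\<in>arm_flag E V h zs. F \<subseteq> G \<or> G \<subseteq> F)"
  using assms
proof (induction zs rule: induct_list012)
  case (3 y x zs)
  note prems = 3(3-5)
  have ih: "finite (arm_flag E V h (x # zs)) \<and>
    (\<forall>F\<in>arm_flag E V h (x # zs). subspace F \<and> F \<subseteq> V x) \<and>
    (\<forall>F\<in>arm_flag E V h (x # zs). \<forall>G\<in>arm_flag E V h (x # zs). F \<subseteq> G \<or> G \<subseteq> F)"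
    using 3(2)[OF prems(1)] prems(2,3) by simp
  then have IH: "finite (arm_flag E V h (x # zs))"
    "\<And>F. F \<in> arm_flag E V h (x # zs) \<Longrightarrow> subspace F \<and> F \<subseteq> V x"
    "\<And>F G. F \<in> arm_flag E V h (x # zs) \<Longrightarrow> G \<in> arm_flag E V h (x # zs) \<Longrightarrow> F \<subseteq> G \<or> G \<subseteq> F"
    by blast+
  have sub: "subspace (V x)" "subspace (V y)"
    using prems(1,3) by (auto simp: is_rep_def findim_def)
  show ?case
  proof (cases "(x, y) \<in> E")
    case True
    then have h: "lin (h x y)" "h x y ` V x \<subseteq> V y" using is_repD[OF prems(1)] by blast+
    interpret h: Vector_Spaces.linear scale scale "h x y" by (rule h)
    have "F \<subseteq> G \<or> G \<subseteq> F" if "F \<in> insert (V x) (arm_flag E V h (x # zs))"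
      "G \<in> insert (V x) (arm_flag E V h (x # zs))" for F G
      using that IH(2) IH(3)[of F G] by blast
    then have "h x y ` F \<subseteq> h x y ` G \<or> h x y ` G \<subseteq> h x y ` F"
      if "F \<in> insert (V x) (arm_flag E V h (x # zs))"
        "G \<in> insert (V x) (arm_flag E V h (x # zs))" for F G
      using that by (meson image_mono)
    moreover have "subspace (h x y ` F) \<and> h x y ` F \<subseteq> V y"
      if "F \<in> insert (V x) (arm_flag E V h (x # zs))" for F
      using that IH(2) sub h(2) h.subspace_image by blast
    ultimately show ?thesis using True IH(1) by simp
  next
    case False
    then have h: "lin (h y x)" "h y x ` V y \<subseteq> V x"
      using is_repD[OF prems(1)] prems(2) by (auto simp: joined_def)
    interpret h: Vector_Spaces.linear scale scale "h y x" by (rule h)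
    have F0: "subspace F" if "F \<in> insert {0} (arm_flag E V h (x # zs))" for F
      using that IH(2) by auto
    have "F \<subseteq> G \<or> G \<subseteq> F" if "F \<in> insert {0} (arm_flag E V h (x # zs))"
      "G \<in> insert {0} (arm_flag E V h (x # zs))" for F G
      using that F0[of F] F0[of G] IH(3)[of F G] subspace_0 by auto
    then have "{v \<in> V y. h y x v \<in> F} \<subseteq> {v \<in> V y. h y x v \<in> G} \<or> {v \<in> V y. h y x v \<in> G} \<subseteq> {v \<in> V y. h y x v \<in> F}"
      if "F \<in> insert {0} (arm_flag E V h (x # zs))" "G \<in> insert {0} (arm_flag E V h (x # zs))" for F G
      using that by blast
    moreover have "subspace {v \<in> V y. h y x v \<in> F}"
      if "F \<in> insert {0} (arm_flag E V h (x # zs))" for F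
    proof -
      have "subspace (V y \<inter> {v. h y x v \<in> F})"
        using F0[OF that] sub(2) h.subspace_linear_preimage by (intro subspace_inter) auto
      then show ?thesis by (simp add: Int_def)
    qed
    ultimately have A: "\<And>F G. F \<in> insert {0} (arm_flag E V h (x # zs)) \<Longrightarrow> G \<in> insert {0} (arm_flag E V h (x # zs)) \<Longrightarrow>
        {v \<in> V y. h y x v \<in> F} \<subseteq> {v \<in> V y. h y x v \<in> G} \<or> {v \<in> V y. h y x v \<in> G} \<subseteq> {v \<in> V y. h y x v \<in> F}"
      and B: "\<And>F. F \<in> insert {0} (arm_flag E V h (x # zs)) \<Longrightarrow> subspace {v \<in> V y. h y x v \<in> F}"
      by blast+
    have eq: "arm_flag E V h (y # x # zs) = (\<lambda>F. {v \<in> V y. h y x v \<in> F}) ` insert {0} (arm_flag E V h (x # zs))"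
      using False by simp
    show ?thesis
    proof (intro conjI ballI)
      show "finite (arm_flag E V h (y # x # zs))" using IH(1) eq by simp
    next
      fix F assume "F \<in> arm_flag E V h (y # x # zs)"
      then obtain F' where F: "F' \<in> insert {0} (arm_flag E V h (x # zs))" "F = {v \<in> V y. h y x v \<in> F'}"
        unfolding eq by (rule imageE)
      show "subspace F" using B[OF F(1)] F(2) by simp
      show "F \<subseteq> V (hd (y # x # zs))" using F(2) by auto
      fix G assume "G \<in> arm_flag E V h (y # x # zs)"
      then obtain G' where G: "G' \<in> insert {0} (arm_flag E V h (x # zs))" "G = {v \<in> V y. h y x v \<in> G'}"
        unfolding eq by (rule imageE)
      show "F \<subseteq> G \<or> G \<subseteq> F" using A[OF F(1) G(1)] F(2) G(2) by simp
    qed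
  qed
qed auto

text \<open>The condition is void when there is no arrow from \<open>a\<close> to \<open>b\<close>, so \<open>follows E h e a b\<close> together
  with \<open>follows E h e b a\<close> covers an edge of either orientation.\<close>

definition follows :: "'x rel \<Rightarrow> ('x \<Rightarrow> 'x \<Rightarrow> 'b \<Rightarrow> 'b) \<Rightarrow> ('x \<Rightarrow> nat \<Rightarrow> 'b) \<Rightarrow> 'x \<Rightarrow> 'x \<Rightarrow> bool" where
  "follows E h e a b \<longleftrightarrow> ((a, b) \<in> E \<longrightarrow> (\<forall>i. h a b (e a i) = e b i \<or> h a b (e a i) = 0))"

text \<open>A frame of the first space that is adapted to the flag of the arm extends vertex by vertex: its
  adaptedness is exactly the hypothesis of \<open>frame_lift\<close> or \<open>frame_push\<close>, according to the
  direction of the first arrow, and both return a frame adapted to the flag of the rest of the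
  arm.\<close>

lemma arm_frames:
  assumes "is_rep X E V h" "successively (joined E) zs" "set zs \<subseteq> X" "distinct zs" "asym E" "zs \<noteq> []"
    and "frame e0 (V (hd zs))" "\<And>F. F \<in> arm_flag E V h zs \<Longrightarrow> adapted e0 F"
  shows "\<exists>e. e (hd zs) = e0 \<and> (\<forall>x\<in>set zs. frame (e x) (V x)) \<and>
    successively (\<lambda>x y. follows E h e x y \<and> follows E h e y x) zs"
  using assms
proof (induction zs arbitrary: e0 rule: induct_list012)
  case (3 y x zs)
  note prems = 3(3-10)
  have props: "finite (arm_flag E V h (x # zs))"
    "\<And>F. F \<in> arm_flag E V h (x # zs) \<Longrightarrow> subspace F \<and> F \<subseteq> V x"
    "\<And>F G. F \<in> arm_flag E V h (x # zs) \<Longrightarrow> G \<in> arm_flag E V h (x # zs) \<Longrightarrow> F \<subseteq> G \<or> G \<subseteq> F"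
    using arm_flag_props[OF prems(1), of "x # zs"] prems(2,3) by simp_all
  have fd: "findim (V x)" using prems(1,3) by (auto simp: is_rep_def)
  have "\<exists>e'. frame e' (V x) \<and> (\<forall>F\<in>arm_flag E V h (x # zs). adapted e' F) \<and>
     ((x, y) \<in> E \<longrightarrow> (\<forall>i. h x y (e' i) = e0 i \<or> h x y (e' i) = 0)) \<and>
     ((y, x) \<in> E \<longrightarrow> (\<forall>i. h y x (e0 i) = e' i \<or> h y x (e0 i) = 0))"
  proof (cases "(x, y) \<in> E")
    case True
    then have h: "lin (h x y)" "h x y ` V x \<subseteq> V y" using is_repD[OF prems(1)] by blast+
    have "(y, x) \<notin> E" using True prems(5) by (auto dest: asymD)
    then show ?thesis
      using frame_lift[OF h fd props, of e0] prems(7,8) True by auto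
  next
    case False
    then have h: "lin (h y x)" "h y x ` V y \<subseteq> V x"
      using is_repD[OF prems(1)] prems(2) by (auto simp: joined_def)
    have fr: "frame e0 (V y)" using prems(7) by simp
    have ad: "adapted e0 {w \<in> V y. h y x w \<in> F}" if "F \<in> insert {0} (arm_flag E V h (x # zs))" for F
    proof (rule prems(8))
      show "{w \<in> V y. h y x w \<in> F} \<in> arm_flag E V h (y # x # zs)" using False that by fastforce
    qed
    show ?thesis using frame_push[OF h fd props fr ad] False by blast
  qed
  then obtain e' where e': "frame e' (V x)" "\<And>F. F\<in>arm_flag E V h (x # zs) \<Longrightarrow> adapted e' F"
     "(x, y) \<in> E \<Longrightarrow> (\<forall>i. h x y (e' i) = e0 i \<or> h x y (e' i) = 0)"
     "(y, x) \<in> E \<Longrightarrow> (\<forall>i. h y x (e0 i) = e' i \<or> h y x (e0 i) = 0)" by blast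
  have "\<exists>e. e (hd (x # zs)) = e' \<and> (\<forall>x\<in>set (x # zs). frame (e x) (V x)) \<and>
    successively (\<lambda>x y. follows E h e x y \<and> follows E h e y x) (x # zs)"
    using 3(2)[OF prems(1), of e'] prems(2-6) e'(1,2) by simp
  then obtain e where e: "e x = e'" "\<forall>x\<in>set (x # zs). frame (e x) (V x)"
    "successively (\<lambda>x y. follows E h e x y \<and> follows E h e y x) (x # zs)" by auto
  have ny: "y \<notin> set (x # zs)" using prems(4) by auto
  define e1 where "e1 = e(y := e0)"
  have "successively (\<lambda>x y. follows E h e1 x y \<and> follows E h e1 y x) (x # zs)"
    by (rule successively_cong[THEN iffD1, OF _ refl e(3)]) (use ny in \<open>auto simp: e1_def follows_def\<close>)
  moreover have "follows E h e1 x y \<and> follows E h e1 y x"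
    using e'(3,4) e(1) ny by (auto simp: e1_def follows_def)
  moreover have "\<forall>z\<in>set (y # x # zs). frame (e1 z) (V z)"
    using e(2) ny prems(7) by (auto simp: e1_def)
  moreover have "e1 y = e0" by (simp add: e1_def)
  ultimately show ?case by (intro exI[of _ e1]) auto
next
  case (2 v)
  then show ?case by (intro exI[of _ "\<lambda>_. e0"]) auto
qed auto

section \<open>Splitting off lines and planes\<close>

abbreviation functional :: "('b \<Rightarrow> 'k) \<Rightarrow> bool" where
  "functional f \<equiv> Vector_Spaces.linear scale (*) f"

lemma functional_extend:
  assumes "independent B"
  obtains g where "functional g" "\<And>b. b \<in> B \<Longrightarrow> g b = f b"
proof -
  interpret k: vector_space "(*) :: 'k \<Rightarrow> 'k \<Rightarrow> 'k"
    by unfold_locales (auto simp: algebra_simps)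
  interpret p: vector_space_pair scale "(*) :: 'k \<Rightarrow> 'k \<Rightarrow> 'k" ..
  show ?thesis using p.linear_independent_extend[OF assms, of f] that by blast
qed

lemma functional_span_eq:
  assumes "functional f" "functional g" "\<And>b. b \<in> B \<Longrightarrow> f b = g b" "v \<in> span B"
  shows "f v = g v"
proof -
  interpret k: vector_space "(*) :: 'k \<Rightarrow> 'k \<Rightarrow> 'k"
    by unfold_locales (auto simp: algebra_simps)
  interpret p: vector_space_pair scale "(*) :: 'k \<Rightarrow> 'k \<Rightarrow> 'k" ..
  show ?thesis using p.linear_eq_on[OF assms(1,2,4,3)] .
qed

lemma functional_zero: "functional (\<lambda>_. 0)"
proof -
  interpret k: vector_space "(*) :: 'k \<Rightarrow> 'k \<Rightarrow> 'k"
    by unfold_locales (auto simp: algebra_simps)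
  interpret p: vector_space_pair scale "(*) :: 'k \<Rightarrow> 'k \<Rightarrow> 'k" ..
  show ?thesis by (rule p.linear_zero)
qed

text \<open>Prescribing a functional on \<open>A\<close> and zero on \<open>B\<close> is consistent since the two spaces are
  independent.\<close>

lemma functional_glue:
  assumes "subspace A" "subspace B" "A \<inter> B \<subseteq> {0}" "functional f"
  obtains g where "functional g" "\<And>v. v \<in> A \<Longrightarrow> g v = f v" "\<And>v. v \<in> B \<Longrightarrow> g v = 0"
proof -
  obtain P where P: "P \<subseteq> A" "independent P" "A \<subseteq> span P" using maximal_independent_subset .
  obtain Q where Q: "Q \<subseteq> B" "independent Q" "B \<subseteq> span Q" using maximal_independent_subset .
  have s: "span P = A" "span Q = B" using P Q assms span_subspace by blast+
  have ind: "independent (P \<union> Q)" using independent_Un P Q s assms(3) by simp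
  obtain g where g: "functional g" "\<And>b. b \<in> P \<union> Q \<Longrightarrow> g b = (if b \<in> P then f b else 0)"
    by (rule functional_extend[OF ind, of "\<lambda>b. if b \<in> P then f b else 0"]) (rule that)
  have "g v = f v" if "v \<in> A" for v
    using functional_span_eq[OF g(1) assms(4), of P v] g(2) s that by auto
  moreover have "g v = 0" if v: "v \<in> B" for v
  proof -
    have "b \<notin> P" if "b \<in> Q" for b
      using that P(1) Q(1,2) assms(3) dependent_zero by blast
    then have "g b = (\<lambda>_. 0) b" if "b \<in> Q" for b using that g(2) by auto
    then show ?thesis using functional_span_eq[OF g(1) functional_zero, of Q v] s v by auto
  qed
  ultimately show ?thesis using that g(1) by blast
qed

lemma separating_functional:
  assumes "subspace R" "l \<notin> R"
  obtains g where "functional g" "\<And>v. v \<in> R \<Longrightarrow> g v = 0" "g l = 1"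
proof -
  have ind: "independent {l}" using assms subspace_0 by auto
  obtain f where f: "functional f" "\<And>b. b \<in> {l} \<Longrightarrow> f b = 1"
    by (rule functional_extend[OF ind, of "\<lambda>b. 1"]) (rule that)
  have "span {l} \<inter> R \<subseteq> {0}"
  proof
    fix v assume "v \<in> span {l} \<inter> R"
    then obtain c where c: "v = scale c l" "scale c l \<in> R" by (auto simp: span_singleton)
    then have "c = 0" using subspace_scale[OF assms(1), of "scale c l" "inverse c"] assms(2)
      by (cases "c = 0") auto
    then show "v \<in> {0}" using c by simp
  qed
  then obtain g where "functional g" "\<And>v. v \<in> span {l} \<Longrightarrow> g v = f v" "\<And>v. v \<in> R \<Longrightarrow> g v = 0"
    by (rule functional_glue[OF subspace_span assms(1) _ f(1), of "{l}"]) (rule that)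
  then show ?thesis using that f(2) by (auto simp: span_base)
qed

lemma functional_add: "functional g \<Longrightarrow> g (x + y) = g x + g y"
  and functional_scale: "functional g \<Longrightarrow> g (scale c x) = c * g x"
  and functional_diff: "functional g \<Longrightarrow> g (x - y) = g x - g y"
  and functional_0: "functional g \<Longrightarrow> g 0 = 0"
proof -
  show "functional g \<Longrightarrow> g (x + y) = g x + g y" "functional g \<Longrightarrow> g (scale c x) = c * g x"
    by (auto simp: Vector_Spaces.linear_def module_hom_def module_hom_axioms_def)
  assume "functional g"
  then interpret g: Vector_Spaces.linear scale "(*)" g .
  show "g (x - y) = g x - g y" "g 0 = 0" by (rule g.diff, rule g.zero)
qed

text \<open>A functional that vanishes on all members not containing \<open>x\<close>, with value 1 at \<open>x\<close>, splits every
  member along its kernel.\<close>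

lemma split_line:
  assumes U: "subspace U" "x \<in> U" and S: "\<And>S. S \<in> \<S> \<Longrightarrow> subspace S \<and> S \<subseteq> U"
    and x: "x \<notin> span (\<Union>{S \<in> \<S>. x \<notin> S})"
  obtains H where "subspace H" "H \<subseteq> U" "x \<notin> H" "\<And>S. S \<in> insert U \<S> \<Longrightarrow> S \<subseteq> span (S \<inter> {x} \<union> (S \<inter> H))"
proof -
  obtain g where g: "functional g" "\<And>v. v \<in> span (\<Union>{S \<in> \<S>. x \<notin> S}) \<Longrightarrow> g v = 0" "g x = 1"
    by (rule separating_functional[OF subspace_span x]) (rule that)
  define H where "H = {v \<in> U. g v = 0}"
  note gs = functional_add[OF g(1)] functional_scale[OF g(1)] functional_diff[OF g(1)] functional_0[OF g(1)]
  have "subspace H" using U by (auto simp: H_def subspace_def gs)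
  moreover have "S \<subseteq> span (S \<inter> {x} \<union> (S \<inter> H))" if "S \<in> insert U \<S>" for S
  proof
    fix y assume y: "y \<in> S"
    have SU: "subspace S" "S \<subseteq> U" using that S U by auto
    show "y \<in> span (S \<inter> {x} \<union> (S \<inter> H))"
    proof (cases "x \<in> S")
      case True
      have "y - scale (g y) x \<in> S \<inter> H"
        using y True SU subspace_diff subspace_scale by (auto simp: H_def gs g(3))
      then have "y - scale (g y) x \<in> span (S \<inter> {x} \<union> (S \<inter> H))" by (auto intro: span_base)
      moreover have "scale (g y) x \<in> span (S \<inter> {x} \<union> (S \<inter> H))"
        using True by (auto intro: span_base span_scale)
      ultimately have "(y - scale (g y) x) + scale (g y) x \<in> span (S \<inter> {x} \<union> (S \<inter> H))" by (rule span_add)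
      then show ?thesis by simp
    next
      case False
      then have "y \<in> \<Union>{S \<in> \<S>. x \<notin> S}" using that y U by auto
      then have "g y = 0" by (intro g(2) span_base)
      then show ?thesis using y SU by (auto simp: H_def intro: span_base)
    qed
  qed
  ultimately show ?thesis using that[of H] g(3) by (auto simp: H_def)
qed

text \<open>The plane spanned by \<open>l\<close> and \<open>k\<close> splits off by two functionals: \<open>\<psi>\<close> vanishes on \<open>R\<close> and has
  value 1 at \<open>l\<close>, and \<open>\<phi>\<close> agrees with \<open>\<psi>\<close> on \<open>\<Lambda>\<close> and vanishes on \<open>K\<close>. The complement is their
  common kernel. A member \<open>S\<close> other than 0 meets the plane in the line of \<open>l\<close>, in that of \<open>k\<close>,
  in that of \<open>x = l + k\<close>, or in all of it.\<close>

lemma split_plane: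
  assumes U: "subspace U" and S: "\<And>S. S \<in> \<S> \<Longrightarrow> subspace S \<and> S \<subseteq> U"
    and \<Lambda>: "subspace \<Lambda>" "\<Lambda> \<subseteq> U" and K: "subspace K" "K \<subseteq> U" and \<Lambda>K: "\<Lambda> \<inter> K \<subseteq> {0}"
    and l: "l \<in> \<Lambda>" and k: "k \<in> K" and x: "x = l + k" and R: "subspace R" "x \<in> R" "l \<notin> R"
    and cases: "\<And>S. S \<in> \<S> \<Longrightarrow> S = \<Lambda> \<or> S = K \<or> S = {0} \<or> (x \<in> S \<and> (l \<in> S \<or> S \<subseteq> R))"
  obtains H where "subspace H" "H \<subseteq> U" "x \<notin> H" "l \<notin> span (insert x H)" "k \<notin> H" "l \<notin> span (insert k H)"
    "\<And>S. S \<in> insert U \<S> \<Longrightarrow> S \<subseteq> span (S \<inter> {x, l, k} \<union> (S \<inter> H))"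
proof -
  obtain \<psi> where \<psi>: "functional \<psi>" "\<And>v. v \<in> R \<Longrightarrow> \<psi> v = 0" "\<psi> l = 1"
    by (rule separating_functional[OF R(1,3)]) (rule that)
  obtain \<phi> where \<phi>: "functional \<phi>" "\<And>v. v \<in> \<Lambda> \<Longrightarrow> \<phi> v = \<psi> v" "\<And>v. v \<in> K \<Longrightarrow> \<phi> v = 0"
    by (rule functional_glue[OF \<Lambda>(1) K(1) \<Lambda>K \<psi>(1)]) (rule that)
  note ps = functional_add[OF \<psi>(1)] functional_scale[OF \<psi>(1)] functional_diff[OF \<psi>(1)] functional_0[OF \<psi>(1)]
  note fs = functional_add[OF \<phi>(1)] functional_scale[OF \<phi>(1)] functional_diff[OF \<phi>(1)] functional_0[OF \<phi>(1)]
  have v: "\<psi> x = 0" "\<phi> l = 1" "\<phi> k = 0" "\<psi> k = -1" "\<phi> x = 1"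
  proof -
    show "\<psi> x = 0" "\<phi> l = 1" "\<phi> k = 0" using \<psi> \<phi> R l k by auto
    then show "\<psi> k = -1" "\<phi> x = 1" using x \<psi>(3) by (auto simp: ps fs eq_neg_iff_add_eq_0 add.commute)
  qed
  define H where "H = {v \<in> U. \<phi> v = 0 \<and> \<psi> v = 0}"
  have "subspace H" using U by (auto simp: H_def subspace_def ps fs)
  moreover have "S \<subseteq> span (S \<inter> {x, l, k} \<union> (S \<inter> H))" if SS: "S \<in> insert U \<S>" for S
  proof
    fix y assume y: "y \<in> S"
    let ?T = "span (S \<inter> {x, l, k} \<union> (S \<inter> H))"
    have SU: "subspace S" "S \<subseteq> U" using SS S U by auto
    have sc: "scale c z \<in> ?T" if "z \<in> S \<inter> {x, l, k}" for c z
      using that by (intro span_scale span_base) blast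
    have hh: "z \<in> ?T" if "z \<in> S" "\<phi> z = 0" "\<psi> z = 0" for z
      using that SU by (intro span_base) (auto simp: H_def)
    have "l \<in> U" "k \<in> U" using l k \<Lambda>(2) K(2) by auto
    then have xU: "x \<in> U" "l \<in> U" using subspace_add[OF U] x by auto
    consider "S = \<Lambda>" | "S = K" | "S = {0}" | "x \<in> S" "l \<in> S" | "x \<in> S" "S \<subseteq> R"
      using cases[of S] SS xU by auto
    then show "y \<in> ?T"
    proof cases
      case 1
      have "y - scale (\<phi> y) l \<in> ?T"
        using 1 y l SU v \<phi>(2)[of y] \<psi>(3) subspace_diff[OF SU(1)] subspace_add[OF SU(1)] subspace_scale[OF SU(1)] by (intro hh) (auto simp: ps fs)
      from span_add[OF this sc[of l "\<phi> y"]] 1 l show ?thesis by simp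
    next
      case 2
      have "y - scale (- \<psi> y) k \<in> ?T"
        using 2 y k SU v \<phi>(3)[of y] subspace_diff[OF SU(1)] subspace_add[OF SU(1)] subspace_scale[OF SU(1)] by (intro hh) (auto simp: ps fs)
      from span_add[OF this sc[of k "- \<psi> y"]] 2 k show ?thesis by simp
    next
      case 3
      then show ?thesis using y by (simp add: span_zero)
    next
      case 4
      have "y - scale (\<phi> y - \<psi> y) x - scale (\<psi> y) l \<in> ?T"
        using 4 y SU v \<psi>(3) subspace_diff[OF SU(1)] subspace_add[OF SU(1)] subspace_scale[OF SU(1)] by (intro hh) (auto simp: ps fs)
      from span_add[OF span_add[OF this sc[of l "\<psi> y"]] sc[of x "\<phi> y - \<psi> y"]] 4 show ?thesis by simp
    next
      case 5
      have "y - scale (\<phi> y) x \<in> ?T"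
        using 5 y SU v \<psi>(2)[of y] subspace_diff[OF SU(1)] subspace_add[OF SU(1)] subspace_scale[OF SU(1)] by (intro hh) (auto simp: ps fs)
      from span_add[OF this sc[of x "\<phi> y"]] 5 show ?thesis by simp
    qed
  qed
  moreover have "x \<notin> H" "k \<notin> H" using v by (auto simp: H_def)
  moreover have "l \<notin> span (insert x H)"
  proof -
    have "\<psi> w = 0" if "w \<in> span (insert x H)" for w
      by (rule functional_span_eq[OF \<psi>(1) functional_zero _ that]) (use v in \<open>auto simp: H_def\<close>)
    then show ?thesis using \<psi>(3) by auto
  qed
  moreover have "l \<notin> span (insert k H)"
  proof -
    have "\<phi> w = 0" if "w \<in> span (insert k H)" for w
      by (rule functional_span_eq[OF \<phi>(1) functional_zero _ that]) (use v in \<open>auto simp: H_def\<close>)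
    then show ?thesis using v by auto
  qed
  ultimately show ?thesis using that[of H] by (auto simp: H_def)
qed

lemma dim_less:
  assumes "findim U" "subspace H" "H \<subseteq> U" "H \<noteq> U"
  shows "dim H < dim U"
proof -
  have "findim H" using assms findim_subset by blast
  then obtain B where B: "independent B" "span B = H" "finite B"
    using extend_to_basis[of H "{}"] independent_empty by blast
  have "B \<subseteq> U" using B(2) span_superset assms(3) by blast
  then obtain C where C: "B \<subseteq> C" "independent C" "span C = U" "finite C"
    using extend_to_basis[OF assms(1) _ B(1)] by blast
  have "B \<subset> C" using B C assms(4) by auto
  then have "card B < card C" using C(4) psubset_card_mono by blast
  moreover have "dim H = card B" "dim U = card C"
    using dim_span_eq_card_independent[OF B(1)] dim_span_eq_card_independent[OF C(2)] B C by auto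
  ultimately show ?thesis by simp
qed

lemma frame_insert:
  assumes "frame e H" "x \<notin> H" "e i = 0"
  shows "frame (e(i := x)) (span (insert x H))"
proof -
  have x0: "x \<noteq> 0" using assms frame_findim findim_subspace subspace_0 by blast
  let ?D = "{j. e j \<noteq> 0}"
  have D: "{j. (e(i := x)) j \<noteq> 0} = insert i ?D" using x0 by auto
  have i: "i \<notin> ?D" using assms by simp
  have im: "(e(i := x)) ` insert i ?D = insert x (e ` ?D)" using i by auto
  have sp: "span (e ` ?D) = H" using assms frame_span by blast
  have "x \<notin> e ` ?D" using sp assms(2) span_superset[of "e ` ?D"] by auto
  then have "inj_on (e(i := x)) (insert i ?D)"
    using assms(1) i by (auto simp: frame_def inj_on_def)
  moreover have "independent (insert x (e ` ?D))"
    using assms(1,2) sp independent_insertI by (auto simp: frame_def)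
  moreover have "span (range (e(i := x))) = span (insert x H)"
  proof -
    have "span (range (e(i := x))) = span (insert x (e ` ?D))"
      using span_support[of "e(i := x)" UNIV] D im by simp
    also have "\<dots> = span (insert x (span (e ` ?D)))"
      unfolding span_eq using span_superset[of "insert x (e ` ?D)"] span_superset[of "e ` ?D"]
        span_mono[of "e ` ?D" "insert x (e ` ?D)"] span_superset[of "insert x (span (e ` ?D))"] by blast
    finally show ?thesis using sp by simp
  qed
  ultimately show ?thesis using assms(1) unfolding frame_def D im by simp
qed

lemma adapted_extend:
  assumes "S \<subseteq> span (S \<inter> P \<union> (S \<inter> H))" "adapted e (S \<inter> H)" "\<And>i. e i \<noteq> 0 \<Longrightarrow> e' i = e i"
    "S \<inter> P \<subseteq> range e'"
  shows "adapted e' S"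
proof -
  have "range e \<inter> (S \<inter> H) \<subseteq> insert 0 (range e' \<inter> S)"
  proof
    fix v assume "v \<in> range e \<inter> (S \<inter> H)"
    then obtain i where "v = e i" "v \<in> S" by auto
    then show "v \<in> insert 0 (range e' \<inter> S)" using assms(3)[of i] by (cases "e i = 0") (auto, metis rangeI)
  qed
  then have "span (range e \<inter> (S \<inter> H)) \<subseteq> span (range e' \<inter> S)" using span_mono span_insert_0 by metis
  then have "S \<inter> H \<subseteq> span (range e' \<inter> S)" using assms(2) by (auto simp: adapted_def)
  moreover have "S \<inter> P \<subseteq> span (range e' \<inter> S)" using assms(4) by (auto intro: span_base)
  ultimately have "span (S \<inter> P \<union> (S \<inter> H)) \<subseteq> span (range e' \<inter> S)"
    by (intro span_minimal) auto
  then show ?thesis using assms(1) by (auto simp: adapted_def)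
qed

text \<open>The members that avoid \<open>x\<close> are among \<open>\<Lambda>\<close>, \<open>K\<close> and 0. Since \<open>x\<close> is in their span, it is a sum of
  a vector of \<open>\<Lambda>\<close> and one of \<open>K\<close>; neither is zero, for otherwise \<open>x\<close> would lie in one of the two
  spaces and hence in the span of the other.\<close>

lemma plane_vectors:
  assumes "subspace \<Lambda>" "subspace K" "\<Lambda> \<inter> K \<subseteq> {0}" "x \<noteq> 0"
    and "\<And>S. S \<in> \<S> \<Longrightarrow> S = \<Lambda> \<or> S = K \<or> S = {0} \<or> x \<in> S"
    and x: "x \<in> span (\<Union>{S \<in> \<S>. x \<notin> S})"
  obtains l k where "l \<in> \<Lambda>" "k \<in> K" "x = l + k" "l \<noteq> 0" "k \<noteq> 0"
proof -
  have xK: "x \<notin> K"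
  proof
    assume "x \<in> K"
    then have "\<Union>{S \<in> \<S>. x \<notin> S} \<subseteq> \<Lambda>" using assms(5) subspace_0[OF assms(1)] by blast
    then have "x \<in> \<Lambda>" using x span_minimal[OF _ assms(1)] by blast
    then show False using \<open>x \<in> K\<close> assms by auto
  qed
  have x\<Lambda>: "x \<notin> \<Lambda>"
  proof
    assume "x \<in> \<Lambda>"
    then have "\<Union>{S \<in> \<S>. x \<notin> S} \<subseteq> K" using assms(5) subspace_0[OF assms(2)] by blast
    then have "x \<in> K" using x span_minimal[OF _ assms(2)] by blast
    then show False using \<open>x \<in> \<Lambda>\<close> assms by auto
  qed
  have "\<Union>{S \<in> \<S>. x \<notin> S} \<subseteq> \<Lambda> \<union> K" using assms(5) subspace_0[OF assms(2)] by blast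
  then have "x \<in> span (\<Lambda> \<union> K)" using x span_mono by blast
  moreover have "span \<Lambda> = \<Lambda>" "span K = K" using assms(1,2) span_eq_iff by blast+
  ultimately obtain l k where lk: "x = l + k" "l \<in> \<Lambda>" "k \<in> K"
    unfolding span_Un by auto
  have "l \<noteq> 0" "k \<noteq> 0" using lk xK x\<Lambda> by auto
  then show ?thesis using that[of l k] lk by blast
qed

section \<open>Two chains and a further subspace\<close>

lemma span_chain_not_in:
  assumes "finite \<Q>" "\<And>F G. F \<in> \<Q> \<Longrightarrow> G \<in> \<Q> \<Longrightarrow> F \<subseteq> G \<or> G \<subseteq> F"
    "\<And>F. F \<in> \<Q> \<Longrightarrow> subspace F \<and> x \<notin> F" "x \<noteq> 0"
  shows "x \<notin> span (\<Union>\<Q>)"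
proof (cases "\<Q> = {}")
  case False
  then obtain M where M: "M \<in> \<Q>" "\<forall>F\<in>\<Q>. F \<subseteq> M" using chain_maximum[OF assms(1) _ assms(2)] by blast
  then have "span (\<Union>\<Q>) \<subseteq> M" using assms(3) by (intro span_minimal) auto
  then show ?thesis using M(1) assms(3) by blast
qed (use assms in auto)

text \<open>The space \<open>R\<close> that \<open>split_plane\<close> asks for is the largest member of the chain \<open>\<C>\<close> that contains
  \<open>x\<close> but not \<open>l\<close>, or the line of \<open>x\<close> if there is no such member.\<close>

lemma exists_plane:
  assumes "subspace \<Lambda>" "subspace K" "\<Lambda> \<inter> K \<subseteq> {0}" "x \<noteq> 0"
    and S: "\<And>S. S \<in> \<S> \<Longrightarrow> subspace S"
    and cases: "\<And>S. S \<in> \<S> \<Longrightarrow> S = \<Lambda> \<or> S = K \<or> S = {0} \<or> x \<in> S"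
    and x: "x \<in> span (\<Union>{S \<in> \<S>. x \<notin> S})"
    and chain: "\<C> \<subseteq> \<S>" "finite \<C>" "\<And>F G. F \<in> \<C> \<Longrightarrow> G \<in> \<C> \<Longrightarrow> F \<subseteq> G \<or> G \<subseteq> F"
    and big: "\<And>S. S \<in> \<S> - \<C> \<Longrightarrow> S = \<Lambda> \<or> S = K \<or> S = {0} \<or> \<Lambda> \<subseteq> S"
  obtains l k R where "l \<in> \<Lambda>" "k \<in> K" "x = l + k" "subspace R" "x \<in> R" "l \<notin> R"
    "\<And>S. S \<in> \<S> \<Longrightarrow> S = \<Lambda> \<or> S = K \<or> S = {0} \<or> (x \<in> S \<and> (l \<in> S \<or> S \<subseteq> R))"
proof -
  obtain l k where lk: "l \<in> \<Lambda>" "k \<in> K" "x = l + k" "l \<noteq> 0" "k \<noteq> 0"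
    by (rule plane_vectors[OF assms(1-4) cases x]) (assumption, rule that)
  define \<Q> where "\<Q> = insert (span {x}) {S \<in> \<C>. x \<in> S \<and> l \<notin> S}"
  have lx: "l \<notin> span {x}"
  proof
    assume "l \<in> span {x}"
    then obtain c where c: "l = scale c (l + k)" using lk(3) by (auto simp: span_singleton)
    then have e: "l - scale c l = scale c k" by (metis add_diff_cancel_left' scale_right_distrib)
    have "l - scale c l \<in> \<Lambda>" using lk(1) assms(1) subspace_diff subspace_scale by blast
    moreover have "scale c k \<in> K" using lk(2) assms(2) subspace_scale by blast
    ultimately have "scale c k = 0" using e assms(3) by auto
    then have "c = 0" using lk(5) by simp
    then show False using c lk(4) by simp
  qed
  have sp: "span {x} \<subseteq> S" if "S \<in> \<C>" "x \<in> S" for S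
    using that S chain(1) by (intro span_minimal) auto
  have "\<exists>M\<in>\<Q>. \<forall>F\<in>\<Q>. F \<subseteq> M"
  proof (rule chain_maximum)
    fix F G assume "F \<in> \<Q>" "G \<in> \<Q>"
    then show "F \<subseteq> G \<or> G \<subseteq> F" using sp[of F] sp[of G] chain(3)[of F G] by (auto simp: \<Q>_def)
  qed (use chain(2) in \<open>auto simp: \<Q>_def\<close>)
  then obtain R where R: "R \<in> \<Q>" "\<And>F. F \<in> \<Q> \<Longrightarrow> F \<subseteq> R" by blast
  have "subspace R" using R(1) S chain(1) by (auto simp: \<Q>_def)
  moreover have "x \<in> R" using R(2)[of "span {x}"] by (auto simp: \<Q>_def span_base)
  moreover have "l \<notin> R" using R(1) lx by (auto simp: \<Q>_def)
  moreover have "S = \<Lambda> \<or> S = K \<or> S = {0} \<or> (x \<in> S \<and> (l \<in> S \<or> S \<subseteq> R))" if "S \<in> \<S>" for S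
    using cases[OF that] big[of S] R(2)[of S] that lk(1) by (auto simp: \<Q>_def)
  ultimately show ?thesis using that[OF lk(1-3)] by blast
qed

text \<open>The configuration consists of a chain \<open>\<T>\<close> inside \<open>N\<close>, a chain \<open>\<X>\<close> above \<open>L\<close> and above \<open>\<T>\<close>, and a
  further subspace \<open>K\<close> that meets \<open>L\<close> trivially. The frame \<open>e\<close> serves all of it except \<open>K\<close>, the
  frame \<open>e'\<close> serves \<open>K\<close>, and \<open>\<sigma>\<close> pairs the labels at which they differ with further ones.

  The proof splits off lines as long as possible. If no vector spans a line that splits off, a
  nonzero vector \<open>x\<close> of the smallest nonzero space among the chains lies in every member except
  \<open>K\<close>, the zero space and one space \<open>\<Lambda>\<close>, which is \<open>L\<close> or \<open>N\<close>. Then \<open>x\<close> is a sum \<open>l + k\<close> with \<open>l\<close>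
  in \<open>\<Lambda>\<close> and \<open>k\<close> in \<open>K\<close>, and the plane of \<open>l\<close> and \<open>k\<close> splits off. In it \<open>e\<close> takes \<open>x\<close> and \<open>- l\<close>,
  and \<open>e'\<close> takes \<open>k = x + (- l)\<close> and \<open>- l\<close>.\<close>

lemma fork_frames:
  assumes "findim U" "finite \<T>" "finite \<X>"
    and "\<And>S. S \<in> \<T> \<union> \<X> \<union> {N, L, K} \<Longrightarrow> subspace S \<and> S \<subseteq> U"
    and "\<And>F G. F \<in> \<T> \<Longrightarrow> G \<in> \<T> \<Longrightarrow> F \<subseteq> G \<or> G \<subseteq> F"
    and "\<And>F G. F \<in> \<X> \<Longrightarrow> G \<in> \<X> \<Longrightarrow> F \<subseteq> G \<or> G \<subseteq> F"
    and "\<And>T. T \<in> \<T> \<Longrightarrow> T \<subseteq> N" "\<And>T X. T \<in> \<T> \<Longrightarrow> X \<in> \<X> \<Longrightarrow> T \<subseteq> X"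
    and "\<And>X. X \<in> \<X> \<Longrightarrow> L \<subseteq> X" "L \<inter> K \<subseteq> {0}"
  shows "\<exists>e e' I \<sigma>. frame e U \<and> frame e' U \<and> (\<forall>S\<in>\<T> \<union> \<X> \<union> {N, L}. adapted e S) \<and> adapted e' K \<and>
    finite I \<and> inj_on \<sigma> I \<and> (\<forall>i\<in>I. \<sigma> i \<notin> I \<and> e' i = e i + e (\<sigma> i)) \<and> (\<forall>i. i \<notin> I \<longrightarrow> e' i = e i)"
  using assms
proof (induction "dim U" arbitrary: U \<T> \<X> N L K rule: less_induct)
  case less
  note U = less.prems(1) and sub = less.prems(4)
  have Us: "subspace U" using U findim_subspace by blast
  define \<S> where "\<S> = \<T> \<union> \<X> \<union> {N, L, K}"
  have subS: "\<And>S. S \<in> \<S> \<Longrightarrow> subspace S \<and> S \<subseteq> U" using sub by (simp add: \<S>_def)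
  have IH: "\<exists>e e' I \<sigma> A. frame e H \<and> frame e' H \<and> (\<forall>S\<in>\<T> \<union> \<X> \<union> {N, L}. adapted e (S \<inter> H)) \<and>
      adapted e' (K \<inter> H) \<and> finite I \<and> inj_on \<sigma> I \<and>
      (\<forall>i\<in>I. \<sigma> i \<notin> I \<and> e' i = e i + e (\<sigma> i)) \<and> (\<forall>i. i \<notin> I \<longrightarrow> e' i = e i) \<and>
      finite A \<and> (\<forall>i. i \<notin> A \<longrightarrow> e i = 0 \<and> e' i = 0 \<and> i \<notin> I \<and> i \<notin> \<sigma> ` I)"
    if H: "subspace H" "H \<subseteq> U" "H \<noteq> U" for H
  proof -
    have "\<exists>e e' I \<sigma>. frame e H \<and> frame e' H \<and>
      (\<forall>S\<in>(\<lambda>S. S \<inter> H) ` \<T> \<union> (\<lambda>S. S \<inter> H) ` \<X> \<union> {N \<inter> H, L \<inter> H}. adapted e S) \<and> adapted e' (K \<inter> H) \<and>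
      finite I \<and> inj_on \<sigma> I \<and> (\<forall>i\<in>I. \<sigma> i \<notin> I \<and> e' i = e i + e (\<sigma> i)) \<and> (\<forall>i. i \<notin> I \<longrightarrow> e' i = e i)"
    proof (rule less.hyps)
      show "dim H < dim U" using dim_less U H by blast
      show "findim H" using findim_subset U H by blast
      show "subspace S \<and> S \<subseteq> H"
        if S: "S \<in> (\<lambda>S. S \<inter> H) ` \<T> \<union> (\<lambda>S. S \<inter> H) ` \<X> \<union> {N \<inter> H, L \<inter> H, K \<inter> H}" for S
      proof -
        obtain S' where S': "S' \<in> \<T> \<union> \<X> \<union> {N, L, K}" "S = S' \<inter> H" using S by blast
        then show ?thesis using sub[OF S'(1)] subspace_inter[OF _ H(1), of S'] by simp
      qed
      show "F \<subseteq> G \<or> G \<subseteq> F" if "F \<in> (\<lambda>S. S \<inter> H) ` \<T>" "G \<in> (\<lambda>S. S \<inter> H) ` \<T>" for F G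
        using that less.prems(5) by blast
      show "F \<subseteq> G \<or> G \<subseteq> F" if "F \<in> (\<lambda>S. S \<inter> H) ` \<X>" "G \<in> (\<lambda>S. S \<inter> H) ` \<X>" for F G
        using that less.prems(6) by blast
      show "T \<subseteq> X" if "T \<in> (\<lambda>S. S \<inter> H) ` \<T>" "X \<in> (\<lambda>S. S \<inter> H) ` \<X>" for T X
        using that less.prems(8) by blast
      show "L \<inter> H \<subseteq> X" if "X \<in> (\<lambda>S. S \<inter> H) ` \<X>" for X
        using that less.prems(9) by blast
    qed (use less.prems(2,3,7,10) in \<open>auto\<close>)
    then obtain e e' I \<sigma> where *: "frame e H" "frame e' H"
      "\<forall>S\<in>(\<lambda>S. S \<inter> H) ` \<T> \<union> (\<lambda>S. S \<inter> H) ` \<X> \<union> {N \<inter> H, L \<inter> H}. adapted e S" "adapted e' (K \<inter> H)"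
      "finite I" "inj_on \<sigma> I" "\<forall>i\<in>I. \<sigma> i \<notin> I \<and> e' i = e i + e (\<sigma> i)" "\<forall>i. i \<notin> I \<longrightarrow> e' i = e i"
      by blast
    (* All labels in use; the labels of the line or plane are taken outside of this finite
       set. *)
    define A where "A = {i. e i \<noteq> 0} \<union> {i. e' i \<noteq> 0} \<union> I \<union> \<sigma> ` I"
    have "finite A" using * by (auto simp: A_def frame_def)
    moreover have "\<forall>i. i \<notin> A \<longrightarrow> e i = 0 \<and> e' i = 0 \<and> i \<notin> I \<and> i \<notin> \<sigma> ` I" by (auto simp: A_def)
    moreover have "\<forall>S\<in>\<T> \<union> \<X> \<union> {N, L}. adapted e (S \<inter> H)" using *(3) by auto
    ultimately show ?thesis using *(1,2,4-8) by blast
  qed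
  show ?case
  proof (cases "\<exists>x\<in>U. x \<notin> span (\<Union>{S \<in> \<S>. x \<notin> S})")
    case True
    then obtain x where x: "x \<in> U" "x \<notin> span (\<Union>{S \<in> \<S>. x \<notin> S})" by blast
    obtain H where H: "subspace H" "H \<subseteq> U" "x \<notin> H"
      "\<And>S. S \<in> insert U \<S> \<Longrightarrow> S \<subseteq> span (S \<inter> {x} \<union> (S \<inter> H))"
      by (rule split_line[OF Us x(1) subS x(2)]) (assumption, rule that)
    have "H \<noteq> U" using x H by auto
    from IH[OF H(1,2) this] obtain e e' I \<sigma> A where *: "frame e H" "frame e' H"
      "\<forall>S\<in>\<T> \<union> \<X> \<union> {N, L}. adapted e (S \<inter> H)" "adapted e' (K \<inter> H)" "finite I" "inj_on \<sigma> I"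
      "\<forall>i\<in>I. \<sigma> i \<notin> I \<and> e' i = e i + e (\<sigma> i)" "\<forall>i. i \<notin> I \<longrightarrow> e' i = e i"
      "finite A" "\<forall>i. i \<notin> A \<longrightarrow> e i = 0 \<and> e' i = 0 \<and> i \<notin> I \<and> i \<notin> \<sigma> ` I" by (elim exE conjE) (rule that)
    obtain i where "i \<notin> A" using *(9) ex_new_if_finite infinite_UNIV_nat by blast
    then have i: "e i = 0" "e' i = 0" "i \<notin> I" "i \<notin> \<sigma> ` I" using *(10) by auto
    have sp: "span (insert x H) = U"
    proof
      show "span (insert x H) \<subseteq> U" using x H Us by (intro span_minimal) auto
      have "U \<subseteq> span (U \<inter> {x} \<union> (U \<inter> H))" using H(4) by blast
      also have "\<dots> \<subseteq> span (insert x H)" by (intro span_mono) auto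
      finally show "U \<subseteq> span (insert x H)" .
    qed
    have f: "frame (e(i := x)) U" "frame (e'(i := x)) U"
      using frame_insert[OF *(1) H(3) i(1)] frame_insert[OF *(2) H(3) i(2)] sp by auto
    have a: "adapted (e(i := x)) S" if "S \<in> \<T> \<union> \<X> \<union> {N, L}" for S
    proof (rule adapted_extend[where e = e])
      show "S \<subseteq> span (S \<inter> {x} \<union> (S \<inter> H))" using H(4)[of S] that by (auto simp: \<S>_def)
      show "adapted e (S \<inter> H)" using *(3) that by blast
      show "S \<inter> {x} \<subseteq> range (e(i := x))" by (auto intro!: image_eqI[of _ _ i])
    qed (use i in auto)
    have a': "adapted (e'(i := x)) K"
    proof (rule adapted_extend[where e = e'])
      show "K \<subseteq> span (K \<inter> {x} \<union> (K \<inter> H))" using H(4)[of K] by (auto simp: \<S>_def)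
      show "K \<inter> {x} \<subseteq> range (e'(i := x))" by (auto intro!: image_eqI[of _ _ i])
      show "adapted e' (K \<inter> H)" by (rule *(4))
    qed (use i in auto)
    show ?thesis
    proof (intro exI conjI)
      show "\<forall>S\<in>\<T> \<union> \<X> \<union> {N, L}. adapted (e(i := x)) S" using a by blast
      show "\<forall>j\<in>I. \<sigma> j \<notin> I \<and> (e'(i := x)) j = (e(i := x)) j + (e(i := x)) (\<sigma> j)"
      proof
        fix j assume j: "j \<in> I"
        then have "j \<noteq> i" "\<sigma> j \<noteq> i" using i(3,4) by auto
        then show "\<sigma> j \<notin> I \<and> (e'(i := x)) j = (e(i := x)) j + (e(i := x)) (\<sigma> j)"
          using bspec[OF *(7) j] by simp
      qed
      show "\<forall>j. j \<notin> I \<longrightarrow> (e'(i := x)) j = (e(i := x)) j" using *(8) by simp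
    qed (rule f a' *(5,6))+
  next
    case False
    then have NL: "\<And>x. x \<in> U \<Longrightarrow> x \<in> span (\<Union>{S \<in> \<S>. x \<notin> S})" by blast
    show ?thesis
    proof (cases "U = {0}")
      case True
      have "frame (\<lambda>_. 0) U" using True by (simp add: frame_def independent_empty)
      moreover have "adapted (\<lambda>_. 0) S" if "S \<in> \<S>" for S
        using subS[OF that] True by (auto simp: adapted_def span_zero)
      ultimately show ?thesis
        by (intro exI[of _ "\<lambda>_. 0"] exI[of _ "{}"] exI[of _ id]) (auto simp: \<S>_def)
    next
      case nz: False
      (* The space that plays the role of \<Lambda> is L if the chain below N is nonzero, and
         N otherwise. *)
      have "\<exists>\<Lambda> l k x R. subspace \<Lambda> \<and> \<Lambda> \<subseteq> U \<and> \<Lambda> \<inter> K \<subseteq> {0} \<and> l \<in> \<Lambda> \<and> k \<in> K \<and> x = l + k \<and> subspace R \<and>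
        x \<in> R \<and> l \<notin> R \<and> (\<forall>S\<in>\<S>. S = \<Lambda> \<or> S = K \<or> S = {0} \<or> (x \<in> S \<and> (l \<in> S \<or> S \<subseteq> R))) \<and>
        (\<forall>S\<in>\<T> \<union> \<X> \<union> {N, L}. S = \<Lambda> \<or> S = {0} \<or> x \<in> S)"
      proof (cases "\<exists>T\<in>\<T>. T \<noteq> {0}")
        case True
        let ?T = "{T \<in> \<T>. T \<noteq> {0}}"
        obtain T0 where T0: "T0 \<in> ?T" "\<And>T. T \<in> ?T \<Longrightarrow> T0 \<subseteq> T"
          using chain_minimum[of ?T] True less.prems(2,5) by auto
        then obtain x where x: "x \<in> T0" "x \<noteq> 0" using sub[of T0] subspace_0 by blast
        have xU: "x \<in> U" using x T0 sub[of T0] by auto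
        (* Only L and K can avoid x, as all other nonzero members contain the smallest one of
           the chain below N. *)
        have cov: "S = L \<or> S = {0} \<or> x \<in> S" if S: "S \<in> \<T> \<union> \<X> \<union> {N, L}" for S
        proof -
          consider "S \<in> \<T>" "S \<noteq> {0}" | "S = {0}" | "S \<in> \<X>" | "S = N" | "S = L" using S by blast
          then show ?thesis
          proof cases
            case 1
            then have "T0 \<subseteq> S" using T0(2) by simp
            then show ?thesis using x(1) by blast
          next
            case 3
            then have "T0 \<subseteq> S" using T0(1) less.prems(8) by simp
            then show ?thesis using x(1) by blast
          next
            case 4
            then have "T0 \<subseteq> S" using T0(1) less.prems(7) by simp
            then show ?thesis using x(1) by blast
          qed simp_all
        qed
        obtain l k R where P: "l \<in> L" "k \<in> K" "x = l + k" "subspace R" "x \<in> R" "l \<notin> R"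
          "\<And>S. S \<in> \<S> \<Longrightarrow> S = L \<or> S = K \<or> S = {0} \<or> (x \<in> S \<and> (l \<in> S \<or> S \<subseteq> R))"
        proof (rule exists_plane[of L K x \<S> "insert N \<T>"])
          show "\<And>S. S \<in> \<S> \<Longrightarrow> S = L \<or> S = K \<or> S = {0} \<or> x \<in> S"
            using cov unfolding \<S>_def by blast
          show "\<And>F G. F \<in> insert N \<T> \<Longrightarrow> G \<in> insert N \<T> \<Longrightarrow> F \<subseteq> G \<or> G \<subseteq> F"
            using less.prems(5,7) by blast
          show "\<And>S. S \<in> \<S> - insert N \<T> \<Longrightarrow> S = L \<or> S = K \<or> S = {0} \<or> L \<subseteq> S"
            using less.prems(9) by (auto simp: \<S>_def)
        qed (use subS NL[OF xU] less.prems(2,10) x in \<open>auto simp: \<S>_def\<close>)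
        show ?thesis
        proof (rule exI[of _ L], rule exI[of _ l], rule exI[of _ k], rule exI[of _ x], rule exI[of _ R], intro conjI)
          show "\<forall>S\<in>\<S>. S = L \<or> S = K \<or> S = {0} \<or> (x \<in> S \<and> (l \<in> S \<or> S \<subseteq> R))" using P(7) by blast
          show "\<forall>S\<in>\<T> \<union> \<X> \<union> {N, L}. S = L \<or> S = {0} \<or> x \<in> S" using cov by blast
          show "subspace L" "L \<subseteq> U" using sub[of L] by auto
        qed (rule less.prems(10) P)+
      next
        case T: False
        (* A nonzero vector of N and K would avoid only members of one chain, and its line
           would split off. *)
        have NK: "N \<inter> K \<subseteq> {0}"
        proof
          fix x assume x: "x \<in> N \<inter> K"
          have "x \<notin> span (\<Union>{S \<in> insert L \<X>. x \<notin> S})" if "x \<noteq> 0"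
            by (rule span_chain_not_in) (use less.prems(3,6,9) sub that in auto)
          moreover have "\<Union>{S \<in> \<S>. x \<notin> S} \<subseteq> insert 0 (\<Union>{S \<in> insert L \<X>. x \<notin> S})"
            using x T by (auto simp: \<S>_def)
          then have "span (\<Union>{S \<in> \<S>. x \<notin> S}) \<subseteq> span (\<Union>{S \<in> insert L \<X>. x \<notin> S})"
            using span_mono span_insert_0 by metis
          moreover have "x \<in> U" using x sub[of N] by auto
          ultimately show "x \<in> {0}" using NL[of x] by auto
        qed
        let ?T = "{T \<in> insert U (insert L \<X>). T \<noteq> {0}}"
        have ch: "F \<subseteq> G \<or> G \<subseteq> F" if "F \<in> insert U (insert L \<X>)" "G \<in> insert U (insert L \<X>)" for F G
          using that less.prems(6)[of F G] less.prems(9) sub[of F] sub[of G] by auto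
        have "\<exists>M\<in>?T. \<forall>F\<in>?T. M \<subseteq> F"
          by (rule chain_minimum) (use nz less.prems(3) ch in auto)
        then obtain T0 where T0: "T0 \<in> ?T" "\<forall>T\<in>?T. T0 \<subseteq> T" by (rule bexE)
        have "subspace T0" "T0 \<subseteq> U" using T0(1) sub[of T0] Us by auto
        then obtain x where x: "x \<in> T0" "x \<noteq> 0" "x \<in> U" using subspace_0 T0(1) by blast
        have cov: "S = N \<or> S = {0} \<or> x \<in> S" if S: "S \<in> \<T> \<union> \<X> \<union> {N, L}" for S
        proof -
          consider "S = {0}" | "S \<in> insert L \<X>" "S \<noteq> {0}" | "S = N" using S T by blast
          then show ?thesis
          proof cases
            case 2
            then have "T0 \<subseteq> S" using T0(2) by simp
            then show ?thesis using x(1) by blast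
          qed simp_all
        qed
        obtain l k R where P: "l \<in> N" "k \<in> K" "x = l + k" "subspace R" "x \<in> R" "l \<notin> R"
          "\<And>S. S \<in> \<S> \<Longrightarrow> S = N \<or> S = K \<or> S = {0} \<or> (x \<in> S \<and> (l \<in> S \<or> S \<subseteq> R))"
        proof (rule exists_plane[of N K x \<S> "insert L \<X>"])
          show "\<And>S. S \<in> \<S> \<Longrightarrow> S = N \<or> S = K \<or> S = {0} \<or> x \<in> S"
            using cov unfolding \<S>_def by blast
          show "\<And>F G. F \<in> insert L \<X> \<Longrightarrow> G \<in> insert L \<X> \<Longrightarrow> F \<subseteq> G \<or> G \<subseteq> F"
            using less.prems(6,9) by blast
          show "\<And>S. S \<in> \<S> - insert L \<X> \<Longrightarrow> S = N \<or> S = K \<or> S = {0} \<or> N \<subseteq> S"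
            using T by (auto simp: \<S>_def)
        qed (use subS NL[OF x(3)] less.prems(3) NK x in \<open>auto simp: \<S>_def\<close>)
        show ?thesis
        proof (rule exI[of _ N], rule exI[of _ l], rule exI[of _ k], rule exI[of _ x], rule exI[of _ R], intro conjI)
          show "\<forall>S\<in>\<S>. S = N \<or> S = K \<or> S = {0} \<or> (x \<in> S \<and> (l \<in> S \<or> S \<subseteq> R))" using P(7) by blast
          show "\<forall>S\<in>\<T> \<union> \<X> \<union> {N, L}. S = N \<or> S = {0} \<or> x \<in> S" using cov by blast
          show "subspace N" "N \<subseteq> U" using sub[of N] by auto
        qed (rule NK P)+
      qed
      then obtain \<Lambda> l k x R where p: "subspace \<Lambda>" "\<Lambda> \<subseteq> U" "\<Lambda> \<inter> K \<subseteq> {0}" "l \<in> \<Lambda>" "k \<in> K" "x = l + k" "subspace R"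
        "x \<in> R" "l \<notin> R" and p10: "\<forall>S\<in>\<S>. S = \<Lambda> \<or> S = K \<or> S = {0} \<or> (x \<in> S \<and> (l \<in> S \<or> S \<subseteq> R))"
        and p11: "\<forall>S\<in>\<T> \<union> \<X> \<union> {N, L}. S = \<Lambda> \<or> S = {0} \<or> x \<in> S" by (elim exE conjE) (rule that)
      have K: "subspace K" "K \<subseteq> U" using sub[of K] by auto
      obtain H where H: "subspace H" "H \<subseteq> U" "x \<notin> H" "l \<notin> span (insert x H)" "k \<notin> H" "l \<notin> span (insert k H)"
        "\<And>S. S \<in> insert U \<S> \<Longrightarrow> S \<subseteq> span (S \<inter> {x, l, k} \<union> (S \<inter> H))"
        by (rule split_plane[OF Us subS p(1,2) K p(3-9) bspec[OF p10]]) (assumption+, rule that)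
      have lU: "l \<in> U" "k \<in> U" using p(2,4,5) K(2) by auto
      then have xU: "x \<in> U" using subspace_add[OF Us] p(6) by simp
      have "H \<noteq> U" using xU H(3) by auto
      from IH[OF H(1,2) this] obtain e e' I \<sigma> A where *: "frame e H" "frame e' H"
        "\<forall>S\<in>\<T> \<union> \<X> \<union> {N, L}. adapted e (S \<inter> H)" "adapted e' (K \<inter> H)" "finite I" "inj_on \<sigma> I"
        "\<forall>i\<in>I. \<sigma> i \<notin> I \<and> e' i = e i + e (\<sigma> i)" "\<forall>i. i \<notin> I \<longrightarrow> e' i = e i"
        "finite A" "\<forall>i. i \<notin> A \<longrightarrow> e i = 0 \<and> e' i = 0 \<and> i \<notin> I \<and> i \<notin> \<sigma> ` I" by (elim exE conjE) (rule that)
      obtain i where "i \<notin> A" using *(9) ex_new_if_finite infinite_UNIV_nat by blast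
      moreover obtain j where "j \<notin> insert i A" using *(9) ex_new_if_finite infinite_UNIV_nat finite_insert by metis
      ultimately have ij: "e i = 0" "e' i = 0" "i \<notin> I" "i \<notin> \<sigma> ` I" "e j = 0" "e' j = 0" "j \<notin> I" "j \<notin> \<sigma> ` I" "i \<noteq> j"
        using *(10) by auto
      define e1 where "e1 = e(i := x, j := - l)"
      define e2 where "e2 = e'(i := k, j := - l)"
      have sp: "span (insert (- l) (span (insert x H))) = U"
      proof
        have "insert x H \<subseteq> U" using xU H(2) by auto
        then have "span (insert x H) \<subseteq> U" using Us by (rule span_minimal)
        then show "span (insert (- l) (span (insert x H))) \<subseteq> U"
          using lU Us subspace_neg by (intro span_minimal) auto
        have "U \<subseteq> span (U \<inter> {x, l, k} \<union> (U \<inter> H))" using H(7) by blast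
        also have "\<dots> \<subseteq> span (insert (- l) (span (insert x H)))"
        proof (rule span_minimal[OF _ subspace_span])
          let ?S = "span (insert (- l) (span (insert x H)))"
          have "- l \<in> ?S" by (simp add: span_base)
          then have l': "l \<in> ?S" using span_neg by fastforce
          have "insert x H \<subseteq> ?S" using span_superset[of "insert x H"] span_superset[of "insert (- l) (span (insert x H))"] by blast
          then have x': "x \<in> ?S" "H \<subseteq> ?S" by auto
          have "k = x - l" using p(6) by simp
          then have "k \<in> ?S" using span_diff[OF x'(1) l'] by simp
          then show "U \<inter> {x, l, k} \<union> (U \<inter> H) \<subseteq> ?S" using l' x' by auto
        qed
        finally show "U \<subseteq> span (insert (- l) (span (insert x H)))" .
      qed
      have sp': "span (insert (- l) (span (insert k H))) = span (insert (- l) (span (insert x H)))"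
      proof -
        have l0: "- l \<in> span (insert (- l) B)" for B by (simp add: span_base)
        then have l: "l \<in> span (insert (- l) B)" for B using span_neg[of "- l"] by fastforce
        have s: "insert z H \<subseteq> span (insert (- l) (span (insert z H)))" for z
          using span_superset[of "insert z H"] span_superset[of "insert (- l) (span (insert z H))"] by blast
        have "k \<in> span (insert (- l) (span (insert x H)))"
          using span_diff[of x _ l] l s[of x] p(6) by simp
        moreover have "x \<in> span (insert (- l) (span (insert k H)))"
          using span_add[of l _ k] l s[of k] p(6) by simp
        ultimately have "insert k H \<subseteq> span (insert (- l) (span (insert x H)))"
          "insert x H \<subseteq> span (insert (- l) (span (insert k H)))" using s by auto
        from this[THEN span_minimal[OF _ subspace_span]] show ?thesis
          unfolding span_eq insert_subset using l0 by blast
      qed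
      have nl: "- l \<notin> span (insert x H)" "- l \<notin> span (insert k H)"
        using H(4,6) span_neg[of "- l"] by auto
      have f: "frame e1 U" "frame e2 U"
        using frame_insert[OF frame_insert[OF *(1) H(3) ij(1)] nl(1), of j]
          frame_insert[OF frame_insert[OF *(2) H(5) ij(2)] nl(2), of j] sp sp' ij
        by (auto simp: e1_def e2_def)
      have a: "adapted e1 S" if S: "S \<in> \<T> \<union> \<X> \<union> {N, L}" for S
      proof (rule adapted_extend[where e = e])
        have SS: "S \<in> \<S>" "subspace S" using S subS by (auto simp: \<S>_def)
        let ?P = "{x, - l}"
        show "S \<subseteq> span (S \<inter> ?P \<union> (S \<inter> H))"
        proof -
          let ?T = "span (S \<inter> ?P \<union> (S \<inter> H))"
          have l1: "l \<in> ?T" if "l \<in> S"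
            using span_neg[OF span_base[of "- l" "S \<inter> ?P \<union> (S \<inter> H)"]] subspace_neg[OF SS(2) that] by simp
          have x1: "x \<in> ?T" if "x \<in> S" using that by (auto intro: span_base)
          have k1: "k \<in> ?T" if k: "k \<in> S"
          proof -
            consider "k = 0" | "x \<in> S" using bspec[OF p11 S] k p(3,5) by blast
            then show ?thesis
            proof cases
              case 2
              have "l = x - k" using p(6) by simp
              then have "l \<in> S" using subspace_diff[OF SS(2) 2 k] by simp
              then have "x - l \<in> ?T" using span_diff[OF x1[OF 2] l1] by blast
              then show ?thesis using p(6) by simp
            qed (simp add: span_zero)
          qed
          have "S \<inter> {x, l, k} \<union> (S \<inter> H) \<subseteq> ?T" using l1 x1 k1 by (auto intro: span_base)
          then have "span (S \<inter> {x, l, k} \<union> (S \<inter> H)) \<subseteq> ?T" by (rule span_minimal) simp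
          then show ?thesis using H(7)[of S] SS(1) by blast
        qed
        show "adapted e (S \<inter> H)" using *(3) S by blast
        show "S \<inter> ?P \<subseteq> range e1" using ij by (auto simp: e1_def intro: image_eqI[of _ _ i] image_eqI[of _ _ j])
      qed (use ij in \<open>auto simp: e1_def\<close>)
      have a': "adapted e2 K"
      proof (rule adapted_extend[where e = e'])
        have "l \<noteq> 0" using p(7,9) subspace_0 by blast
        then have l: "l \<notin> K" using p(3,4) by blast
        have "x \<notin> K"
        proof
          assume "x \<in> K"
          from subspace_diff[OF K(1) this p(5)] show False using l p(6) by simp
        qed
        with l have "K \<inter> {x, l, k} = K \<inter> {k}" by auto
        then show "K \<subseteq> span (K \<inter> {k} \<union> (K \<inter> H))" using H(7)[of K] by (simp add: \<S>_def)
        show "K \<inter> {k} \<subseteq> range e2" using ij by (auto simp: e2_def intro: image_eqI[of _ _ i])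
        show "adapted e' (K \<inter> H)" by (rule *(4))
      qed (use ij in \<open>auto simp: e2_def\<close>)
      show ?thesis
      proof (intro exI conjI)
        show "\<forall>S\<in>\<T> \<union> \<X> \<union> {N, L}. adapted e1 S" using a by blast
        show "finite (insert i I)" using *(5) by simp
        show "inj_on (\<sigma>(i := j)) (insert i I)"
        proof (rule inj_onI)
          fix a b assume ab: "a \<in> insert i I" "b \<in> insert i I" "(\<sigma>(i := j)) a = (\<sigma>(i := j)) b"
          then show "a = b" using ij(8) inj_onD[OF *(6), of a b] by (auto split: if_splits)
        qed
        show "\<forall>m\<in>insert i I. (\<sigma>(i := j)) m \<notin> insert i I \<and> e2 m = e1 m + e1 ((\<sigma>(i := j)) m)"
        proof
          fix m assume m: "m \<in> insert i I"
          show "(\<sigma>(i := j)) m \<notin> insert i I \<and> e2 m = e1 m + e1 ((\<sigma>(i := j)) m)"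
          proof (cases "m = i")
            case True
            then show ?thesis using ij(7,9) p(6) by (simp add: e1_def e2_def)
          next
            case False
            then have mI: "m \<in> I" using m by simp
            then have "m \<noteq> j" "\<sigma> m \<noteq> i" "\<sigma> m \<noteq> j" using ij by auto
            then show ?thesis using bspec[OF *(7) mI] False by (simp add: e1_def e2_def)
          qed
        qed
        show "\<forall>m. m \<notin> insert i I \<longrightarrow> e2 m = e1 m" using *(8) by (simp add: e1_def e2_def)
      qed (rule f a')+
    qed
  qed
qed

section \<open>Representations of a star\<close>

text \<open>The frames of the three arms are glued at the centre. The third arm starts from the frame \<open>e0'\<close>
  there, so its maps follow the glued family only after the centre has been changed to \<open>e0'\<close>.\<close>

lemma star_frames:
  assumes rep: "is_rep X E V h" "asym E"
    and arms: "is_arm X E v zs1" "is_arm X E v zs2" "is_arm X E v zs3"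
    and disj: "set zs1 \<inter> set zs2 = {v}" "set zs1 \<inter> set zs3 = {v}" "set zs2 \<inter> set zs3 = {v}"
    and e0: "frame e0 (V v)" "\<And>F. F \<in> arm_flag E V h zs1 \<union> arm_flag E V h zs2 \<Longrightarrow> adapted e0 F"
    and e0': "frame e0' (V v)" "\<And>F. F \<in> arm_flag E V h zs3 \<Longrightarrow> adapted e0' F"
  shows "\<exists>e. e v = e0 \<and> (\<forall>x\<in>set zs1 \<union> set zs2 \<union> set zs3. frame (e x) (V x)) \<and>
    (\<forall>a b. adjacent zs1 a b \<or> adjacent zs2 a b \<longrightarrow> follows E h e a b) \<and>
    (\<forall>a b. adjacent zs3 a b \<longrightarrow> follows E h (e(v := e0')) a b)"
proof -
  have arm: "\<exists>e. e v = f \<and> (\<forall>x\<in>set zs. frame (e x) (V x)) \<and> (\<forall>a b. adjacent zs a b \<longrightarrow> follows E h e a b)"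
    if "is_arm X E v zs" "frame f (V v)" "\<And>F. F \<in> arm_flag E V h zs \<Longrightarrow> adapted f F" for f zs
  proof -
    have "\<exists>e. e (hd zs) = f \<and> (\<forall>x\<in>set zs. frame (e x) (V x)) \<and>
        successively (\<lambda>x y. follows E h e x y \<and> follows E h e y x) zs"
      by (rule arm_frames[OF rep(1)]) (use that rep(2) in \<open>auto simp: is_arm_def\<close>)
    then show ?thesis using that(1) successively_adjacent[of "follows E h _"] unfolding is_arm_def by metis
  qed
  obtain e1 where e1: "e1 v = e0" "\<forall>x\<in>set zs1. frame (e1 x) (V x)" "\<forall>a b. adjacent zs1 a b \<longrightarrow> follows E h e1 a b"
    using arm[OF arms(1) e0(1)] e0(2) by auto
  obtain e2 where e2: "e2 v = e0" "\<forall>x\<in>set zs2. frame (e2 x) (V x)" "\<forall>a b. adjacent zs2 a b \<longrightarrow> follows E h e2 a b"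
    using arm[OF arms(2) e0(1)] e0(2) by auto
  obtain e3 where e3: "e3 v = e0'" "\<forall>x\<in>set zs3. frame (e3 x) (V x)" "\<forall>a b. adjacent zs3 a b \<longrightarrow> follows E h e3 a b"
    using arm[OF arms(3) e0'] by auto
  define e where "e x = (if x \<in> set zs1 then e1 x else if x \<in> set zs2 then e2 x else e3 x)" for x
  have eq1: "e x = e1 x" if "x \<in> set zs1" for x using that by (simp add: e_def)
  have v1: "v \<in> set zs1" using disj by auto
  have eq2: "e x = e2 x" if "x \<in> set zs2" for x
    using that disj(1) e1(1) e2(1) by (cases "x = v") (auto simp: e_def)
  have eq3: "(e(v := e0')) x = e3 x" if "x \<in> set zs3" for x
    using that disj(2,3) e3(1) by (cases "x = v") (auto simp: e_def)
  have f: "follows E h g a b" if "follows E h g' a b" "g a = g' a" "g b = g' b" for g g' a b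
    using that by (simp add: follows_def)
  have "follows E h e a b" if "adjacent zs1 a b" for a b
    using f[of e1 a b e] e1(3) that eq1 adjacent_set[OF that] by auto
  moreover have "follows E h e a b" if "adjacent zs2 a b" for a b
    using f[of e2 a b e] e2(3) that eq2 adjacent_set[OF that] by auto
  moreover have "follows E h (e(v := e0')) a b" if "adjacent zs3 a b" for a b
  proof (rule f[of e3])
    show "follows E h e3 a b" using e3(3) that by blast
  qed (use eq3 adjacent_set[OF that] in blast)+
  moreover have "frame (e x) (V x)" if x: "x \<in> set zs1 \<union> set zs2 \<union> set zs3" for x
  proof -
    consider "x \<in> set zs1" | "x \<in> set zs2" | "x \<in> set zs3" "x \<noteq> v" using x v1 by blast
    then show ?thesis
    proof cases
      case 3
      then have "e x = e3 x" using eq3[of x] by simp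
      then show ?thesis using 3 e3(2) by simp
    qed (use eq1 eq2 e1(2) e2(2) in auto)
  qed
  moreover have "e v = e0" using eq1 v1 e1(1) by simp
  ultimately show ?thesis by blast
qed

text \<open>The labels fall into classes of at most two elements, the fibres of \<open>\<beta>\<close>, which all maps
  preserve. Restricting the coefficients to -1, 0 and 1 leaves only finitely many possibilities
  for one class, over any field.\<close>

definition blocks :: "'x set \<Rightarrow> 'x rel \<Rightarrow> ('x \<Rightarrow> 'b set) \<Rightarrow> ('x \<Rightarrow> 'x \<Rightarrow> 'b \<Rightarrow> 'b) \<Rightarrow> ('x \<Rightarrow> nat \<Rightarrow> 'b) \<Rightarrow> (nat \<Rightarrow> nat) \<Rightarrow> bool" where
  "blocks X E V h e \<beta> \<longleftrightarrow> (\<forall>x\<in>X. frame (e x) (V x)) \<and> (\<forall>k. \<exists>p q. {i. \<beta> i = k} \<subseteq> {p, q}) \<and>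
     (\<forall>(a, b)\<in>E. \<forall>i. \<exists>c. (\<forall>j. c j \<in> {-1, 0, 1}) \<and> h a b (e a i) = (\<Sum>j | \<beta> j = \<beta> i. scale (c j) (e b j)))"

text \<open>An arrow that follows the frames apart from the exchange of \<open>e v\<close> for \<open>e'\<close> respects the classes
  \<open>{i, \<sigma> i}\<close>, because \<open>e' i = e v i + e v (\<sigma> i)\<close> can be solved for \<open>e v i\<close> with coefficients 1
  and -1.\<close>

lemma star_blocks:
  assumes rep: "is_rep X E V h" "asym E" and frames: "\<And>x. x \<in> X \<Longrightarrow> frame (e x) (V x)"
    and I: "frame e' (V v)" "inj_on \<sigma> I" "\<And>i. i \<in> I \<Longrightarrow> \<sigma> i \<notin> I \<and> e' i = e v i + e v (\<sigma> i)" "\<And>i. i \<notin> I \<Longrightarrow> e' i = e v i"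
    and E: "\<And>a b. (a, b) \<in> E \<Longrightarrow> (\<forall>i. h a b (e a i) = e b i \<or> h a b (e a i) = 0) \<or> follows E h (e(v := e')) a b"
  shows "\<exists>\<beta>. blocks X E V h e \<beta>"
proof -
  define \<beta> where "\<beta> i = (if i \<in> I then \<sigma> i else i)" for i
  have fib: "\<exists>p q. {i. \<beta> i = k} \<subseteq> {p, q}" for k
  proof (cases "\<exists>p\<in>I. \<sigma> p = k")
    case True
    then obtain p where "p \<in> I" "\<sigma> p = k" by auto
    then have "{i. \<beta> i = k} \<subseteq> {p, k}" using I(2) by (auto simp: \<beta>_def inj_on_def split: if_splits)
    then show ?thesis by blast
  next
    case False
    then have "{i. \<beta> i = k} \<subseteq> {k, k}" by (auto simp: \<beta>_def split: if_splits)
    then show ?thesis by blast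
  qed
  have fin: "finite {j. \<beta> j = k}" for k
    using fib[of k] by (metis finite.emptyI finite.insertI finite_subset)
  have one: "\<exists>c. (\<forall>j. c j \<in> {-1, 0, 1 :: 'k}) \<and> s i = (\<Sum>j | \<beta> j = \<beta> i. scale (c j) (s j))" for s i
    by (rule exI[of _ "\<lambda>j. if j = i then 1 else 0"])
      (use fin in \<open>auto simp: if_distrib[of "\<lambda>c. scale c _"] cong: if_cong\<close>)
  have two: "\<exists>c. (\<forall>j. c j \<in> {-1, 0, 1 :: 'k}) \<and> scale a (s i) + scale b (s k) = (\<Sum>j | \<beta> j = \<beta> i. scale (c j) (s j))"
    if "k \<noteq> i" "\<beta> k = \<beta> i" "a \<in> {-1, 0, 1}" "b \<in> {-1, 0, 1}" for s i k a b
  proof -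
    let ?c = "\<lambda>j. (if j = i then a else 0) + (if j = k then b else 0)"
    have "(\<Sum>j | \<beta> j = \<beta> i. scale (?c j) (s j)) =
        (\<Sum>j | \<beta> j = \<beta> i. (if j = i then scale a (s j) else 0) + (if j = k then scale b (s j) else 0))"
      by (intro sum.cong refl) (simp add: scale_left_distrib)
    also have "\<dots> = scale a (s i) + scale b (s k)"
      using fin that(2) by (simp add: sum.distrib)
    finally show ?thesis using that by (intro exI[of _ ?c]) auto
  qed
  have nul: "\<exists>c. (\<forall>j. c j \<in> {-1, 0, 1 :: 'k}) \<and> 0 = (\<Sum>j | \<beta> j = \<beta> i. scale (c j) (s j))" for s i
    by (rule exI[of _ "\<lambda>j. 0"]) simp
  have "\<exists>c. (\<forall>j. c j \<in> {-1, 0, 1}) \<and> h a b (e a i) = (\<Sum>j | \<beta> j = \<beta> i. scale (c j) (e b j))"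
    if ab: "(a, b) \<in> E" for a b i
  proof (cases "\<forall>i. h a b (e a i) = e b i \<or> h a b (e a i) = 0")
    case True
    then show ?thesis using one[of "e b" i] nul[of "e b" i] by metis
  next
    case False
    then have f: "\<And>i. h a b ((e(v := e')) a i) = (e(v := e')) b i \<or> h a b ((e(v := e')) a i) = 0"
      using E[OF ab] ab by (auto simp: follows_def)
    have "a \<noteq> b" using ab rep(2) by (auto dest: asymD)
    interpret h: Vector_Spaces.linear scale scale "h a b" using is_repD(2)[OF rep(1) ab] .
    consider "a = v" | "b = v" | "a \<noteq> v" "b \<noteq> v" by blast
    then show ?thesis
    proof cases
      case 1
      then have f: "h a b (e' i) = e b i \<or> h a b (e' i) = 0" for i using f[of i] \<open>a \<noteq> b\<close> by auto
      show ?thesis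
      proof (cases "i \<in> I")
        case True
        then have s: "\<sigma> i \<notin> I" "e' i = e v i + e v (\<sigma> i)" "\<sigma> i \<noteq> i" using I(3)[OF True] True by auto
        then have "e v i = e' i - e' (\<sigma> i)" using I(4)[of "\<sigma> i"] by simp
        then have "h a b (e a i) = h a b (e' i) - h a b (e' (\<sigma> i))" using 1 h.diff by simp
        moreover have "\<exists>c. c \<in> {-1, 0, 1} \<and> h a b (e' i) = scale c (e b i)"
          using f[of i] by (elim disjE) (rule exI[of _ 1], simp, rule exI[of _ 0], simp)
        moreover have "\<exists>d. d \<in> {-1, 0, 1} \<and> - h a b (e' (\<sigma> i)) = scale d (e b (\<sigma> i))"
        proof -
          show ?thesis using f[of "\<sigma> i"]
            by (elim disjE) (rule exI[of _ "-1"], simp, rule exI[of _ 0], simp)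
        qed
        ultimately have "\<exists>c d. c \<in> {-1, 0, 1} \<and> d \<in> {-1, 0, 1} \<and> h a b (e a i) = scale c (e b i) + scale d (e b (\<sigma> i))"
          by (metis diff_conv_add_uminus)
        then obtain c d where cd: "c \<in> {-1, 0, 1}" "d \<in> {-1, 0, 1}" "h a b (e a i) = scale c (e b i) + scale d (e b (\<sigma> i))"
          by blast
        have "\<beta> (\<sigma> i) = \<beta> i" using True s by (simp add: \<beta>_def)
        from two[OF s(3) this cd(1,2), of "e b"] show ?thesis using cd(3) by simp
      next
        case False
        then have "e a i = e' i" using I(4) 1 by simp
        then show ?thesis using f[of i] one[of "e b" i] nul[of "e b" i] by metis
      qed
    next
      case 2
      then have f: "h a b (e a i) = e' i \<or> h a b (e a i) = 0" using f[of i] \<open>a \<noteq> b\<close> by auto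
      show ?thesis
      proof (cases "i \<in> I")
        case True
        then have s: "\<sigma> i \<notin> I" "e' i = e v i + e v (\<sigma> i)" "\<sigma> i \<noteq> i" using I(3)[OF True] True by auto
        have "\<beta> (\<sigma> i) = \<beta> i" using True s by (simp add: \<beta>_def)
        from two[OF s(3) this, of 1 1 "e b"] show ?thesis using f s(2) 2 nul[of "e b" i] by auto
      next
        case False
        then have "e' i = e b i" using I(4) 2 by simp
        then show ?thesis using f one[of "e b" i] nul[of "e b" i] by metis
      qed
    next
      case 3
      then have "h a b (e a i) = e b i \<or> h a b (e a i) = 0" using f[of i] by simp
      then show ?thesis using one[of "e b" i] nul[of "e b" i] by metis
    qed
  qed
  then show ?thesis using fib frames unfolding blocks_def by (intro exI[of _ \<beta>]) auto
qed

section \<open>Indecomposable representations with small blocks\<close>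

definition rep_indec :: "'x set \<Rightarrow> 'x rel \<Rightarrow> ('x \<Rightarrow> 'b set) \<Rightarrow> ('x \<Rightarrow> 'x \<Rightarrow> 'b \<Rightarrow> 'b) \<Rightarrow> bool" where
  "rep_indec X E V h \<longleftrightarrow> (\<exists>x\<in>X. V x \<noteq> {0}) \<and>
     (\<forall>U W. (\<forall>x\<in>X. subspace (U x) \<and> subspace (W x) \<and> U x \<inter> W x = {0} \<and>
          {u + w | u w. u \<in> U x \<and> w \<in> W x} = V x) \<and>
        (\<forall>(a, b)\<in>E. h a b ` U a \<subseteq> U b \<and> h a b ` W a \<subseteq> W b) \<longrightarrow>
        (\<forall>x\<in>X. U x = {0}) \<or> (\<forall>x\<in>X. W x = {0}))"

text \<open>The vectors with labels in one class and those with labels outside it span complementary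
  subrepresentations.\<close>

lemma rep_indec_single_block:
  assumes rep: "is_rep X E V h" and ind: "rep_indec X E V h" and bl: "blocks X E V h e \<beta>"
  shows "\<exists>k. \<forall>x\<in>X. \<forall>i. e x i \<noteq> 0 \<longrightarrow> \<beta> i = k"
proof -
  have fr: "\<And>x. x \<in> X \<Longrightarrow> frame (e x) (V x)" using bl by (auto simp: blocks_def)
  obtain x0 where x0: "x0 \<in> X" "V x0 \<noteq> {0}" using ind by (auto simp: rep_indec_def)
  have "\<exists>i. e x0 i \<noteq> 0"
  proof (rule ccontr)
    assume "\<nexists>i. e x0 i \<noteq> 0"
    then have "range (e x0) = {0}" by auto
    then show False using fr[OF x0(1)] x0(2) by (simp add: frame_def)
  qed
  then obtain i0 where i0: "e x0 i0 \<noteq> 0" by blast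
  define B where "B P x = e x ` {i. e x i \<noteq> 0 \<and> P (\<beta> i)}" for P x
  define U where "U P x = span (B P x)" for P x
  have eU: "e x i \<in> U P x" if "P (\<beta> i)" for x i P
  proof (cases "e x i = 0")
    case False
    then show ?thesis unfolding U_def by (intro span_base) (use that in \<open>auto simp: B_def\<close>)
  qed (simp add: U_def span_zero)
  have BB: "B P x \<union> B (\<lambda>k. \<not> P k) x = e x ` {i. e x i \<noteq> 0}" for P x by (auto simp: B_def)
  have closed: "h a b ` U P a \<subseteq> U P b" if ab: "(a, b) \<in> E" for a b P
  proof -
    interpret h: Vector_Spaces.linear scale scale "h a b" using is_repD(2)[OF rep ab] .
    have "h a b v \<in> U P b" if v: "v \<in> B P a" for v
    proof -
      obtain i where i: "v = e a i" "P (\<beta> i)" using v by (auto simp: B_def)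
      obtain c where "h a b (e a i) = (\<Sum>j | \<beta> j = \<beta> i. scale (c j) (e b j))"
        using bl ab unfolding blocks_def by blast
      moreover have "(\<Sum>j | \<beta> j = \<beta> i. scale (c j) (e b j)) \<in> U P b"
      proof -
        have "subspace (U P b)" by (simp add: U_def)
        moreover have "scale (c j) (e b j) \<in> U P b" if "j \<in> {j. \<beta> j = \<beta> i}" for j
          using eU[of P j b] that i(2) by (auto simp: U_def intro: span_scale)
        ultimately show ?thesis by (rule subspace_sum)
      qed
      ultimately show ?thesis using i by simp
    qed
    then have "h a b ` B P a \<subseteq> U P b" by blast
    then have "span (h a b ` B P a) \<subseteq> U P b" unfolding U_def by (rule span_minimal) simp
    then show ?thesis by (simp add: U_def h.span_image)
  qed
  let ?P = "\<lambda>k. k = \<beta> i0"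
  have dec: "U ?P x \<inter> U (\<lambda>k. \<not> ?P k) x = {0}"
    "{u + w | u w. u \<in> U ?P x \<and> w \<in> U (\<lambda>k. \<not> ?P k) x} = V x" if x: "x \<in> X" for x
  proof -
    have inj: "inj_on (e x) {i. e x i \<noteq> 0}" and indep: "independent (e x ` {i. e x i \<noteq> 0})"
      using fr[OF x] by (auto simp: frame_def)
    have "B ?P x \<inter> B (\<lambda>k. \<not> ?P k) x = {}" using inj by (auto simp: B_def inj_on_def)
    then show "U ?P x \<inter> U (\<lambda>k. \<not> ?P k) x = {0}"
      unfolding U_def using span_Int_disjoint indep BB[of ?P x] by metis
    show "{u + w | u w. u \<in> U ?P x \<and> w \<in> U (\<lambda>k. \<not> ?P k) x} = V x"
      unfolding U_def span_Un[symmetric] BB using frame_span[OF fr[OF x]] .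
  qed
  have "(\<forall>x\<in>X. U ?P x = {0}) \<or> (\<forall>x\<in>X. U (\<lambda>k. \<not> ?P k) x = {0})"
  proof (rule ind[unfolded rep_indec_def, THEN conjunct2, rule_format], intro conjI ballI)
    show "\<And>x. subspace (U ?P x)" "\<And>x. subspace (U (\<lambda>k. \<not> ?P k) x)" by (simp_all add: U_def)
    show "\<And>x. x \<in> X \<Longrightarrow> U ?P x \<inter> U (\<lambda>k. \<not> ?P k) x = {0}" by (rule dec)
    show "\<And>x. x \<in> X \<Longrightarrow> {u + w | u w. u \<in> U ?P x \<and> w \<in> U (\<lambda>k. \<not> ?P k) x} = V x" by (rule dec)
    fix z assume "z \<in> E"
    then show "case z of (a, b) \<Rightarrow> h a b ` U ?P a \<subseteq> U ?P b \<and> h a b ` U (\<lambda>k. \<not> ?P k) a \<subseteq> U (\<lambda>k. \<not> ?P k) b"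
      using closed[of _ _ ?P] closed[of _ _ "\<lambda>k. \<not> ?P k"] by (cases z) simp
  qed
  moreover have "U ?P x0 \<noteq> {0}" using eU[of ?P i0 x0] i0 by auto
  ultimately have z: "\<forall>x\<in>X. U (\<lambda>k. \<not> ?P k) x = {0}" using x0(1) by blast
  have "\<beta> i = \<beta> i0" if "x \<in> X" "e x i \<noteq> 0" for x i
    using eU[of "\<lambda>k. \<not> ?P k" i x] z that by auto
  then show ?thesis by blast
qed

text \<open>After renaming the two labels of its only class to 0 and 1, an indecomposable representation is
  recorded by the set of labels that occur at each vertex and by the matrices of its maps.\<close>

definition coded :: "'x set \<Rightarrow> 'x rel \<Rightarrow> ('x \<Rightarrow> 'b set) \<Rightarrow> ('x \<Rightarrow> 'x \<Rightarrow> 'b \<Rightarrow> 'b) \<Rightarrow>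
    ('x \<times> nat) set \<times> ('x \<times> 'x \<times> nat \<times> nat \<times> 'k) set \<Rightarrow> bool" where
  "coded X E V h \<kappa> \<longleftrightarrow> (\<exists>e c. (\<forall>x\<in>X. frame (e x) (V x) \<and> (\<forall>i. e x i \<noteq> 0 \<longrightarrow> i < 2)) \<and>
     (\<forall>(a, b)\<in>E. \<forall>i<2. h a b (e a i) = (\<Sum>j<2. scale (c a b i j) (e b j)) \<and> (\<forall>j<2. c a b i j \<in> {-1, 0, 1})) \<and>
     \<kappa> = ({(x, i). x \<in> X \<and> e x i \<noteq> 0}, {(a, b, i, j, s). (a, b) \<in> E \<and> i < 2 \<and> j < 2 \<and> s = c a b i j}))"

lemma coded_finite:
  assumes "finite X" "E \<subseteq> X \<times> X" "coded X E V h \<kappa>"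
  shows "\<kappa> \<in> Pow (X \<times> {..<2}) \<times> Pow (X \<times> X \<times> {..<2} \<times> {..<2} \<times> {-1, 0, 1})"
proof -
  obtain e c where *: "\<forall>x\<in>X. frame (e x) (V x) \<and> (\<forall>i. e x i \<noteq> 0 \<longrightarrow> i < 2)"
     "\<forall>(a, b)\<in>E. \<forall>i<2. h a b (e a i) = (\<Sum>j<2. scale (c a b i j) (e b j)) \<and> (\<forall>j<2. c a b i j \<in> {-1, 0, 1})"
     "\<kappa> = ({(x, i). x \<in> X \<and> e x i \<noteq> 0}, {(a, b, i, j, s). (a, b) \<in> E \<and> i < 2 \<and> j < 2 \<and> s = c a b i j})"
    using assms(3) unfolding coded_def by blast
  have "{(x, i). x \<in> X \<and> e x i \<noteq> 0} \<subseteq> X \<times> {..<2}" using *(1) by auto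
  moreover have "{(a, b, i, j, s). (a, b) \<in> E \<and> i < 2 \<and> j < 2 \<and> s = c a b i j}
      \<subseteq> X \<times> X \<times> {..<2} \<times> {..<2} \<times> {-1, 0, 1}"
    using *(2) assms(2) by fastforce
  ultimately show ?thesis using *(3) by simp
qed

lemma rep_indec_coded:
  assumes rep: "is_rep X E V h" and ind: "rep_indec X E V h" and bl: "blocks X E V h e \<beta>"
  shows "\<exists>\<kappa>. coded X E V h \<kappa>"
proof -
  obtain k where k: "\<And>x i. x \<in> X \<Longrightarrow> e x i \<noteq> 0 \<Longrightarrow> \<beta> i = k"
    using rep_indec_single_block[OF assms] by blast
  obtain p q0 where pq0: "{i. \<beta> i = k} \<subseteq> {p, q0}" using bl unfolding blocks_def by blast
  (* A class with a single label is padded to two distinct labels. *)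
  define q where "q = (if p = q0 then Suc p else q0)"
  have pq: "{i. \<beta> i = k} \<subseteq> {p, q}" "p \<noteq> q" using pq0 by (auto simp: q_def)
  define e' where "e' x i = (if i = 0 then e x p else if i = 1 then e x q else 0)" for x and i :: nat
  have supp: "e x i \<noteq> 0 \<Longrightarrow> i = p \<or> i = q" if "x \<in> X" for x i using k[OF that] pq by blast
  have fr: "frame (e' x) (V x)" if x: "x \<in> X" for x
  proof -
    have f: "frame (e x) (V x)" using bl x by (auto simp: blocks_def)
    have r: "range (e' x) - {0} = range (e x) - {0}"
    proof (intro equalityI subsetI)
      fix y assume "y \<in> range (e' x) - {0}"
      then show "y \<in> range (e x) - {0}" by (auto simp: e'_def split: if_splits)
    next
      fix y assume "y \<in> range (e x) - {0}"
      then obtain i where i: "y = e x i" "e x i \<noteq> 0" by auto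
      then have "y = e' x 0 \<or> y = e' x 1" using supp[OF x i(2)] by (auto simp: e'_def)
      then show "y \<in> range (e' x) - {0}" using i by auto
    qed
    have "g ` {i. g i \<noteq> 0} = range g - {0}" for g :: "nat \<Rightarrow> 'b" by auto
    then have "e' x ` {i. e' x i \<noteq> 0} = e x ` {i. e x i \<noteq> 0}" using r by simp
    moreover have "finite {i. e' x i \<noteq> 0}"
      by (rule finite_subset[of _ "{0, 1}"]) (auto simp: e'_def)
    moreover have "inj_on (e' x) {i. e' x i \<noteq> 0}"
      using f pq(2) by (auto simp: frame_def inj_on_def e'_def split: if_splits)
    moreover have "span (range (e' x)) = V x" using r f span_delete_0[of "range (e' x)"] span_delete_0[of "range (e x)"]
      by (simp add: frame_def)
    ultimately show ?thesis using f by (simp add: frame_def)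
  qed
  have "\<exists>c. (\<forall>j. c j \<in> {-1, 0, 1}) \<and> h a b (e' a i) = (\<Sum>j<2. scale (c j) (e' b j))"
    if ab: "(a, b) \<in> E" for a b and i :: nat
  proof -
    have X: "a \<in> X" "b \<in> X" using rep ab by (auto simp: is_rep_def)
    interpret h: Vector_Spaces.linear scale scale "h a b" using is_repD(2)[OF rep ab] .
    define l where "l = (if i = 0 then p else q)"
    show ?thesis
    proof (cases "e' a i = 0")
      case True
      then show ?thesis using h.zero by (intro exI[of _ "\<lambda>_. 0"]) simp
    next
      case False
      then have el: "e' a i = e a l" by (auto simp: e'_def l_def split: if_splits)
      then have bl': "\<beta> l = k" using k[OF X(1)] False by simp
      obtain c where c: "\<forall>j. c j \<in> {-1, 0, 1}" "h a b (e a l) = (\<Sum>j | \<beta> j = k. scale (c j) (e b j))"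
        using bl ab bl' unfolding blocks_def by blast
      have "(\<Sum>j | \<beta> j = k. scale (c j) (e b j)) = (\<Sum>j\<in>{p, q}. scale (c j) (e b j))"
        using pq k[OF X(2)] by (intro sum.mono_neutral_left) auto
      also have "\<dots> = scale (c p) (e b p) + scale (c q) (e b q)" using pq(2) by simp
      also have "\<dots> = (\<Sum>j<2. scale ((if j = 0 then c p else c q)) (e' b j))"
        by (simp add: e'_def numeral_2_eq_2)
      finally show ?thesis using c el by (intro exI[of _ "\<lambda>j. if j = 0 then c p else c q"]) auto
    qed
  qed
  then obtain c where c: "\<And>a b i. (a, b) \<in> E \<Longrightarrow> (\<forall>j. c a b i j \<in> {-1, 0, 1}) \<and>
      h a b (e' a i) = (\<Sum>j<2. scale (c a b i j) (e' b j))"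
    by metis
  have "\<forall>x\<in>X. frame (e' x) (V x) \<and> (\<forall>i. e' x i \<noteq> 0 \<longrightarrow> i < 2)" using fr by (auto simp: e'_def)
  moreover have "\<forall>(a, b)\<in>E. \<forall>i<2. h a b (e' a i) = (\<Sum>j<2. scale (c a b i j) (e' b j)) \<and>
      (\<forall>j<2. c a b i j \<in> {-1, 0, 1})" using c by auto
  ultimately show ?thesis unfolding coded_def by blast
qed

lemma lin_eq_on_frame:
  assumes "lin f" "lin g" "frame e V" "\<And>i. f (e i) = g (e i)" "v \<in> V"
  shows "f v = g v"
proof -
  interpret p: vector_space_pair scale scale ..
  show ?thesis
  proof (rule p.linear_eq_on[OF assms(1,2)])
    show "v \<in> span (range e)" using assms(3,5) by (simp add: frame_def)
  qed (use assms(4) in auto)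
qed

lemma frame_iso:
  assumes "frame e V" "frame e' V'" "\<And>i. e i = 0 \<longleftrightarrow> e' i = 0"
  shows "\<exists>f. lin f \<and> bij_betw f V V' \<and> (\<forall>i. f (e i) = e' i)"
proof -
  interpret p: vector_space_pair scale scale ..
  let ?D = "{i. e i \<noteq> 0}"
  have D: "{i. e' i \<noteq> 0} = ?D" using assms(3) by auto
  have inj: "inj_on e ?D" "inj_on e' ?D" and ind: "independent (e ` ?D)" "independent (e' ` ?D)"
    using assms(1,2) by (auto simp: frame_def D)
  obtain f where f: "lin f" "\<forall>x\<in>e ` ?D. f x = e' (inv_into ?D e x)"
    using p.linear_independent_extend[OF ind(1), of "\<lambda>x. e' (inv_into ?D e x)"] by blast
  interpret f: Vector_Spaces.linear scale scale f by (rule f)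
  have fe: "f (e i) = e' i" for i
  proof (cases "e i = 0")
    case True
    moreover from True have "e' i = 0" using assms(3) by blast
    ultimately show ?thesis using f.zero by simp
  next
    case False
    then show ?thesis using f(2) inv_into_f_f[OF inj(1), of i] by auto
  qed
  have im: "f ` e ` ?D = e' ` ?D" using fe by (auto simp: image_iff)
  have "inj_on f (e ` ?D)" using fe inj(2) by (auto simp: inj_on_def)
  then have "inj_on f (span (e ` ?D))" using f.inj_on_span_iff_independent_image[of "e ` ?D"] ind(2) im by simp
  moreover have "f ` span (e ` ?D) = span (e' ` ?D)" using f.span_image[of "e ` ?D"] im by simp
  ultimately have "bij_betw f V V'"
    using frame_span[OF assms(1)] frame_span[OF assms(2)] D by (simp add: bij_betw_def)
  then show ?thesis using f(1) fe by blast
qed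

text \<open>Matching the two frames label by label is compatible with the maps because the matrices agree.\<close>

lemma coded_iso:
  assumes rep: "is_rep X E V h" "is_rep X E V' h'" and cd: "coded X E V h \<kappa>" "coded X E V' h' \<kappa>"
  shows "\<exists>f. (\<forall>x\<in>X. lin (f x) \<and> bij_betw (f x) (V x) (V' x)) \<and>
    (\<forall>(a, b)\<in>E. \<forall>v\<in>V a. f b (h a b v) = h' a b (f a v))"
proof -
  obtain e c where e: "\<forall>x\<in>X. frame (e x) (V x) \<and> (\<forall>i. e x i \<noteq> 0 \<longrightarrow> i < 2)"
     "\<forall>(a, b)\<in>E. \<forall>i<2. h a b (e a i) = (\<Sum>j<2. scale (c a b i j) (e b j)) \<and> (\<forall>j<2. c a b i j \<in> {-1, 0, 1})"
     "\<kappa> = ({(x, i). x \<in> X \<and> e x i \<noteq> 0}, {(a, b, i, j, s). (a, b) \<in> E \<and> i < 2 \<and> j < 2 \<and> s = c a b i j})"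
    using cd(1) unfolding coded_def by blast
  obtain e' c' where e': "\<forall>x\<in>X. frame (e' x) (V' x) \<and> (\<forall>i. e' x i \<noteq> 0 \<longrightarrow> i < 2)"
     "\<forall>(a, b)\<in>E. \<forall>i<2. h' a b (e' a i) = (\<Sum>j<2. scale (c' a b i j) (e' b j)) \<and> (\<forall>j<2. c' a b i j \<in> {-1, 0, 1})"
     "\<kappa> = ({(x, i). x \<in> X \<and> e' x i \<noteq> 0}, {(a, b, i, j, s). (a, b) \<in> E \<and> i < 2 \<and> j < 2 \<and> s = c' a b i j})"
    using cd(2) unfolding coded_def by blast
  have s1: "{(x, i). x \<in> X \<and> e x i \<noteq> 0} = {(x, i). x \<in> X \<and> e' x i \<noteq> 0}"
    and s2: "{(a, b, i, j, s). (a, b) \<in> E \<and> i < 2 \<and> j < 2 \<and> s = c a b i j} =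
      {(a, b, i, j, s). (a, b) \<in> E \<and> i < 2 \<and> j < 2 \<and> s = c' a b i j}"
    using e(3) e'(3) by simp_all
  have supp: "e x i = 0 \<longleftrightarrow> e' x i = 0" if "x \<in> X" for x i
    using s1 that by (auto simp: set_eq_iff)
  have cc: "c a b i j = c' a b i j" if "(a, b) \<in> E" "i < 2" "j < 2" for a b i j
  proof -
    have "(a, b, i, j, c a b i j) \<in> {(a, b, i, j, s). (a, b) \<in> E \<and> i < 2 \<and> j < 2 \<and> s = c a b i j}"
      using that by simp
    then show ?thesis unfolding s2 by simp
  qed
  have "\<exists>f. lin f \<and> bij_betw f (V x) (V' x) \<and> (\<forall>i. f (e x i) = e' x i)" if "x \<in> X" for x
    using frame_iso[of "e x" "V x" "e' x" "V' x"] e(1) e'(1) supp that by blast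
  then obtain f where f: "\<And>x. x \<in> X \<Longrightarrow> lin (f x) \<and> bij_betw (f x) (V x) (V' x) \<and> (\<forall>i. f x (e x i) = e' x i)"
    by metis
  have "f b (h a b v) = h' a b (f a v)" if ab: "(a, b) \<in> E" and v: "v \<in> V a" for a b v
  proof -
    have X: "a \<in> X" "b \<in> X" using rep(1) ab by (auto simp: is_rep_def)
    interpret fa: Vector_Spaces.linear scale scale "f a" using f[OF X(1)] by blast
    interpret fb: Vector_Spaces.linear scale scale "f b" using f[OF X(2)] by blast
    interpret h: Vector_Spaces.linear scale scale "h a b" using is_repD(2)[OF rep(1) ab] .
    interpret h': Vector_Spaces.linear scale scale "h' a b" using is_repD(2)[OF rep(2) ab] .
    have "(f b \<circ> h a b) v = (h' a b \<circ> f a) v"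
    proof (rule lin_eq_on_frame[where f = "f b \<circ> h a b" and g = "h' a b \<circ> f a"])
      show "lin (f b \<circ> h a b)" "lin (h' a b \<circ> f a)"
        by (rule Vector_Spaces.linear_compose; unfold_locales)+
      show "frame (e a) (V a)" using e(1) X by blast
      fix i
      show "(f b \<circ> h a b) (e a i) = (h' a b \<circ> f a) (e a i)"
      proof (cases "i < 2")
        case True
        have "f b (h a b (e a i)) = (\<Sum>j<2. scale (c a b i j) (e' b j))"
          using e(2) ab True f[OF X(2)] by (auto simp: fb.sum fb.scale)
        also have "\<dots> = (\<Sum>j<2. scale (c' a b i j) (e' b j))"
          using cc[OF ab True] by simp
        also have "\<dots> = h' a b (e' a i)" using e'(2) ab True by auto
        finally show ?thesis using f[OF X(1)] by simp
      next
        case False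
        then have "e a i = 0" using e(1) X by blast
        then show ?thesis by (simp add: h.zero fa.zero fb.zero h'.zero)
      qed
    qed (rule v)
    then show ?thesis by simp
  qed
  then show ?thesis using f by (intro exI[of _ f]) auto
qed

end

section \<open>The socle of a socle-projective module\<close>

lemma finite_poset_maximal:
  assumes "finite_poset r" "A \<subseteq> Field r" "A \<noteq> {}"
  obtains m where "m \<in> A" "\<And>y. y \<in> A \<Longrightarrow> (m, y) \<in> r \<Longrightarrow> y = m"
proof -
  have fin: "finite A" using assms finite_subset by (auto simp: finite_poset_def)
  have po: "antisym r" "trans r" using assms(1) by (auto simp: finite_poset_def order_on_defs)
  have "\<exists>m\<in>A. \<forall>y\<in>A. (m, y) \<in> r \<longrightarrow> y = m"
    using fin assms(3)
  proof (induction A rule: finite_ne_induct)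
    case (insert x A)
    then obtain m where m: "m \<in> A" "\<forall>y\<in>A. (m, y) \<in> r \<longrightarrow> y = m" by blast
    show ?case
    proof (cases "(m, x) \<in> r")
      case True
      have "y = x" if "y \<in> insert x A" "(x, y) \<in> r" for y
        using that m True po by (metis antisymD insertE transD)
      then show ?thesis by blast
    next
      case False
      then show ?thesis using m by blast
    qed
  qed auto
  then show ?thesis using that by blast
qed

text \<open>For a maximal \<open>x\<close> the condition holds in every module, by the identity map of \<open>M\<^sub>x\<close>.\<close>

definition joint_kernel_zero :: "'a rel \<Rightarrow> ('a, 'b::zero) poset_rep \<Rightarrow> bool" where
  "joint_kernel_zero r M \<longleftrightarrow> (\<forall>x\<in>Field r. \<forall>v\<in>sp M x.
     (\<forall>z\<in>max_elems r. (x, z) \<in> r \<longrightarrow> mp M x z v = 0) \<longrightarrow> v = 0)"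

context ambient_space
begin

lemma is_moduleD:
  assumes "is_module scale r M"
  shows "x \<in> Field r \<Longrightarrow> findim (sp M x)"
    "x \<in> Field r \<Longrightarrow> subspace (sp M x)"
    "(x, y) \<in> r \<Longrightarrow> linear_between scale (sp M x) (sp M y) (mp M x y)"
    "(x, y) \<in> r \<Longrightarrow> v \<in> sp M x \<Longrightarrow> mp M x y v \<in> sp M y"
    "(x, y) \<in> r \<Longrightarrow> u \<in> sp M x \<Longrightarrow> v \<in> sp M x \<Longrightarrow> mp M x y (u + v) = mp M x y u + mp M x y v"
    "(x, y) \<in> r \<Longrightarrow> v \<in> sp M x \<Longrightarrow> mp M x y (scale c v) = scale c (mp M x y v)"
    "(x, y) \<in> r \<Longrightarrow> mp M x y 0 = 0"
    "x \<in> Field r \<Longrightarrow> v \<in> sp M x \<Longrightarrow> mp M x x v = v"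
    "(x, y) \<in> r \<Longrightarrow> (y, w) \<in> r \<Longrightarrow> v \<in> sp M x \<Longrightarrow> mp M y w (mp M x y v) = mp M x w v"
proof -
  show 1: "x \<in> Field r \<Longrightarrow> subspace (sp M x)" for x using assms by (auto simp: is_module_def)
  show "x \<in> Field r \<Longrightarrow> findim (sp M x)" using assms by (auto simp: is_module_def findim_def)
  show lb: "(x, y) \<in> r \<Longrightarrow> linear_between scale (sp M x) (sp M y) (mp M x y)" for x y
    using assms unfolding is_module_def by fast
  show "(x, y) \<in> r \<Longrightarrow> v \<in> sp M x \<Longrightarrow> mp M x y v \<in> sp M y"
    "(x, y) \<in> r \<Longrightarrow> u \<in> sp M x \<Longrightarrow> v \<in> sp M x \<Longrightarrow> mp M x y (u + v) = mp M x y u + mp M x y v"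
    using lb[of x y] unfolding linear_between_def by blast+
  show sc: "(x, y) \<in> r \<Longrightarrow> v \<in> sp M x \<Longrightarrow> mp M x y (scale c v) = scale c (mp M x y v)" for x y c v
    using lb[of x y] unfolding linear_between_def by blast
  show "(x, y) \<in> r \<Longrightarrow> mp M x y 0 = 0"
  proof -
    assume r: "(x, y) \<in> r"
    then have "0 \<in> sp M x" using 1[of x] subspace_0 by (auto simp: Field_def)
    from sc[OF r this, of 0] show "mp M x y 0 = 0" by simp
  qed
  show "x \<in> Field r \<Longrightarrow> v \<in> sp M x \<Longrightarrow> mp M x x v = v"
    "(x, y) \<in> r \<Longrightarrow> (y, w) \<in> r \<Longrightarrow> v \<in> sp M x \<Longrightarrow> mp M y w (mp M x y v) = mp M x w v"
    using assms unfolding is_module_def by blast+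
qed

text \<open>A simple submodule \<open>U\<close> that is nonzero at \<open>a\<close> is larger than its part above \<open>b\<close>, so that part is
  zero.\<close>

lemma socle_mp_zero:
  assumes "finite_poset r" and M: "is_module scale r M" and ab: "(a, b) \<in> r" "a \<noteq> b"
    and u: "u \<in> sp (socle scale r M) a"
  shows "mp M a b u = 0"
proof -
  have po: "antisym r" "trans r" "refl_on (Field r) r"
    using assms(1) by (auto simp: finite_poset_def order_on_defs)
  have F: "a \<in> Field r" "b \<in> Field r" using ab by (auto simp: Field_def)
  define K where "K = {v \<in> sp M a. mp M a b v = 0}"
  have K: "subspace K"
    using is_moduleD(2)[OF M F(1)] is_moduleD(5,6,7)[OF M ab(1)] by (auto simp: K_def subspace_def)
  have "v \<in> K" if U: "simple_submodule scale r M U" and v: "v \<in> U a" for U v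
  proof -
    have sub: "\<And>x. x \<in> Field r \<Longrightarrow> subspace (U x) \<and> U x \<subseteq> sp M x"
      "\<And>x y. (x, y) \<in> r \<Longrightarrow> mp M x y ` U x \<subseteq> U y"
      using U unfolding simple_submodule_def submodule_def by fast+
    have vM: "v \<in> sp M a" using sub(1)[OF F(1)] v by blast
    (* The part of the simple submodule above b: it is zero or everything, and it is zero at
       a. *)
    define W where "W x = (if (b, x) \<in> r then U x else {0})" for x
    have W: "submodule scale r M W"
      unfolding submodule_def
    proof (intro conjI ballI)
      fix x assume "x \<in> Field r"
      then show "subspace (W x)" "W x \<subseteq> sp M x"
        using sub(1)[of x] is_moduleD(2)[OF M, of x] subspace_0 by (auto simp: W_def)
    next
      fix z assume z: "z \<in> r"
      obtain x y where xy: "z = (x, y)" by (cases z)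
      have "mp M x y ` W x \<subseteq> W y"
      proof (cases "(b, x) \<in> r")
        case True
        then have "(b, y) \<in> r" using z xy po(2) by (auto dest: transD)
        then show ?thesis using True sub(2)[of x y] z xy by (simp add: W_def)
      next
        case False
        have "mp M x y 0 = 0" using is_moduleD(7)[OF M] z xy by simp
        moreover have "0 \<in> W y" using sub(1)[of y] subspace_0 z xy by (auto simp: W_def Field_def)
        ultimately show ?thesis using False by (simp add: W_def)
      qed
      then show "case z of (x, y) \<Rightarrow> mp M x y ` W x \<subseteq> W y" using xy by simp
    qed
    have "\<forall>x\<in>Field r. W x \<subseteq> U x" using sub(1) subspace_0 by (auto simp: W_def)
    then have "zero_family r W \<or> (\<forall>x\<in>Field r. W x = U x)"
      using U W unfolding simple_submodule_def by blast
    then show "v \<in> K"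
    proof
      assume "zero_family r W"
      then have "W b = {0}" using F by (simp add: zero_family_def)
      moreover have "(b, b) \<in> r" using F po(3) by (simp add: refl_on_def)
      ultimately have "U b = {0}" by (simp add: W_def)
      moreover have "mp M a b v \<in> U b" using sub(2)[OF ab(1)] v by blast
      ultimately show ?thesis using vM by (simp add: K_def)
    next
      assume "\<forall>x\<in>Field r. W x = U x"
      then have "U a = W a" using F by simp
      moreover have "(b, a) \<notin> r" using ab po(1) by (auto dest: antisymD)
      ultimately have "U a = {0}" by (simp add: W_def)
      then have "v = 0" using v by simp
      then show ?thesis using vM is_moduleD(7)[OF M ab(1)] by (simp add: K_def)
    qed
  qed
  then have "(\<Union>U \<in> {U. simple_submodule scale r M U}. U a) \<subseteq> K" by blast
  then have "sp (socle scale r M) a \<subseteq> K" unfolding socle_def using K by (simp add: span_minimal)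
  then show ?thesis using u by (auto simp: K_def)
qed

lemma socle_subset:
  assumes M: "is_module scale r M" and a: "a \<in> Field r" and u: "u \<in> sp (socle scale r M) a"
  shows "u \<in> sp M a"
proof -
  have "(\<Union>U \<in> {U. simple_submodule scale r M U}. U a) \<subseteq> sp M a"
    using a by (auto simp: simple_submodule_def submodule_def)
  then have "sp (socle scale r M) a \<subseteq> sp M a"
    unfolding socle_def using is_moduleD(2)[OF M a] by (simp add: span_minimal)
  then show ?thesis using u by blast
qed

lemma simple_submodule_line:
  assumes M: "is_module scale r M" and y: "y \<in> Field r" and v: "v \<in> sp M y" "v \<noteq> 0"
    and kill: "\<And>z. (y, z) \<in> r \<Longrightarrow> z \<noteq> y \<Longrightarrow> mp M y z v = 0"
  shows "simple_submodule scale r M (\<lambda>x. if x = y then span {v} else {0})" (is "simple_submodule scale r M ?U")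
  unfolding simple_submodule_def
proof (intro conjI allI impI)
  have sv: "span {v} \<subseteq> sp M y" using v is_moduleD(2)[OF M y] by (intro span_minimal) auto
  show "submodule scale r M ?U"
    unfolding submodule_def
  proof (intro conjI ballI)
    fix x assume x: "x \<in> Field r"
    show "subspace (?U x)" by simp
    show "?U x \<subseteq> sp M x" using sv is_moduleD(2)[OF M x] subspace_0 by auto
  next
    fix z assume z: "z \<in> r"
    obtain a b where ab: "z = (a, b)" by (cases z)
    have abr: "(a, b) \<in> r" using z ab by simp
    have "mp M a b u \<in> ?U b" if u: "u \<in> ?U a" for u
    proof (cases "a = y")
      case True
      then obtain c where c: "u = scale c v" using u by (auto simp: span_singleton)
      then have "mp M a b u = scale c (mp M y b v)" using is_moduleD(6)[OF M, of y b v c] abr True v(1) by simp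
      then show ?thesis using is_moduleD(8)[OF M y v(1)] kill[of b] abr True c u by (cases "b = y") auto
    next
      case False
      then show ?thesis using u is_moduleD(7)[OF M abr] by (auto simp: span_zero)
    qed
    then show "case z of (a, b) \<Rightarrow> mp M a b ` ?U a \<subseteq> ?U b" using ab by auto
  qed
  show "\<not> zero_family r ?U" using y v(2) span_base[of v "{v}"] by (auto simp: zero_family_def)
  fix W assume W: "submodule scale r M W \<and> (\<forall>x\<in>Field r. W x \<subseteq> ?U x)"
  have sW: "subspace (W x)" if "x \<in> Field r" for x using W that by (auto simp: submodule_def)
  have other: "W x = {0}" if "x \<in> Field r" "x \<noteq> y" for x
    using W that subspace_0[OF sW[OF that(1)]] by fastforce
  show "zero_family r W \<or> (\<forall>x\<in>Field r. W x = ?U x)"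
  proof (cases "W y = {0}")
    case True
    then show ?thesis using other by (auto simp: zero_family_def)
  next
    case False
    then obtain u where u: "u \<in> W y" "u \<noteq> 0" using subspace_0[OF sW[OF y]] by blast
    then have "u \<in> span {v}" using W y by fastforce
    then obtain c where c: "u = scale c v" by (auto simp: span_singleton)
    then have "v = scale (inverse c) u" using u(2) by (auto)
    then have "v \<in> W y" using u(1) sW[OF y] subspace_scale by blast
    then have "span {v} \<subseteq> W y" using sW[OF y] by (intro span_minimal) auto
    then have "W y = span {v}" using W y by fastforce
    then show ?thesis using other by auto
  qed
qed

text \<open>Suppose that \<open>v0\<close> is a nonzero vector in the joint kernel. Among its nonzero images take one,
  \<open>v\<close>, whose vertex \<open>y\<close> is as high as possible. Then \<open>v\<close> lies in the socle and \<open>y\<close> is not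
  maximal. Let \<open>w\<close> cover \<open>y\<close>. The module \<open>N\<close> with the line of \<open>v\<close> at \<open>y\<close> and at \<open>w\<close>, joined by
  the identity, maps onto the simple module \<open>N'\<close> at \<open>y\<close>, and so does the socle, by a functional.
  This map of the socle does not lift to \<open>N\<close>, since \<open>v\<close> is killed on the way from \<open>y\<close> to \<open>w\<close> in
  the socle but not in \<open>N\<close>.\<close>

lemma socle_projective_joint_kernel:
  assumes r: "finite_poset r" and M: "socle_projective scale r M"
  shows "joint_kernel_zero r M"
  unfolding joint_kernel_zero_def
proof (intro ballI impI, rule ccontr)
  fix x0 v0 assume x0: "x0 \<in> Field r" and v0: "v0 \<in> sp M x0" "v0 \<noteq> 0"
    and kill: "\<forall>z\<in>max_elems r. (x0, z) \<in> r \<longrightarrow> mp M x0 z v0 = 0"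
  have mod: "is_module scale r M" and proj: "projective scale r (socle scale r M)"
    using M by (auto simp: socle_projective_def)
  have po: "antisym r" "trans r" "refl_on (Field r) r"
    using r by (auto simp: finite_poset_def order_on_defs)
  define A where "A = {y. (x0, y) \<in> r \<and> mp M x0 y v0 \<noteq> 0}"
  have "x0 \<in> A" using x0 v0 po(3) is_moduleD(8)[OF mod x0 v0(1)] by (auto simp: A_def dest: refl_onD)
  moreover have "A \<subseteq> Field r" by (auto simp: A_def Field_def)
  ultimately obtain y where y: "y \<in> A" "\<And>z. z \<in> A \<Longrightarrow> (y, z) \<in> r \<Longrightarrow> z = y"
    using finite_poset_maximal[OF r] by (metis empty_iff)
  define v where "v = mp M x0 y v0"
  have x0y: "(x0, y) \<in> r" and v: "v \<noteq> 0" using y(1) by (auto simp: A_def v_def)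
  have yF: "y \<in> Field r" using x0y by (auto simp: Field_def)
  have vM: "v \<in> sp M y" unfolding v_def by (rule is_moduleD(4)[OF mod x0y v0(1)])
  have vkill: "mp M y z v = 0" if "(y, z) \<in> r" "z \<noteq> y" for z
  proof -
    have "(x0, z) \<in> r" using x0y that(1) po(2) by (auto dest: transD)
    moreover have "mp M y z v = mp M x0 z v0" unfolding v_def by (rule is_moduleD(9)[OF mod x0y that(1) v0(1)])
    ultimately show ?thesis using y(2)[of z] that by (auto simp: A_def)
  qed
  have "y \<notin> max_elems r" using kill x0y v by (auto simp: v_def)
  then obtain w0 where "(y, w0) \<in> r" "w0 \<noteq> y" using yF by (auto simp: max_elems_def)
  have "finite_poset (r\<inverse>)" using r by (simp add: finite_poset_def)
  moreover have "{w. (y, w) \<in> r \<and> w \<noteq> y} \<subseteq> Field (r\<inverse>)" by (auto simp: Field_def)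
  ultimately obtain w where w: "w \<in> {w. (y, w) \<in> r \<and> w \<noteq> y}"
    "\<And>u. u \<in> {w. (y, w) \<in> r \<and> w \<noteq> y} \<Longrightarrow> (w, u) \<in> r\<inverse> \<Longrightarrow> u = w"
    using finite_poset_maximal[of "r\<inverse>" "{w. (y, w) \<in> r \<and> w \<noteq> y}"] \<open>(y, w0) \<in> r\<close> \<open>w0 \<noteq> y\<close> by blast
  have yw: "(y, w) \<in> r" "w \<noteq> y" and cover: "\<And>u. (y, u) \<in> r \<Longrightarrow> (u, w) \<in> r \<Longrightarrow> u = y \<or> u = w"
    using w by auto
  let ?S = "socle scale r M"
  have vS: "v \<in> sp ?S y"
  proof -
    have "v \<in> (\<lambda>x. if x = y then span {v} else {0}) y" by (simp add: span_base)
    then have "v \<in> (\<Union>U \<in> {U. simple_submodule scale r M U}. U y)"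
      using simple_submodule_line[OF mod yF vM v vkill] by blast
    then show ?thesis by (simp add: socle_def span_base)
  qed
  define N where
    "N = \<lparr>sp = \<lambda>x. if x = y \<or> x = w then span {v} else {0},
          mp = \<lambda>a b u. if a = b \<or> (a = y \<and> b = w) then u else 0\<rparr>"
  define N' where
    "N' = \<lparr>sp = \<lambda>x. if x = y then span {v} else {0}, mp = \<lambda>a b u. if a = b then u else 0\<rparr>"
  have fin: "\<exists>B. finite B \<and> span B = span {v}" "\<exists>B. finite B \<and> span B = {0}"
    by (blast, metis finite.emptyI span_empty)
  have lb: "linear_between scale A B (\<lambda>u. if P then u else 0)"
    if "P \<Longrightarrow> A \<subseteq> B" "0 \<in> B" for A B P
    using that by (auto simp: linear_between_def)
  have Nm: "is_module scale r N"
    unfolding is_module_def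
  proof (intro conjI ballI allI impI)
    fix x assume "x \<in> Field r"
    show "subspace (sp N x)" "\<exists>B. finite B \<and> span B = sp N x" using fin by (auto simp: N_def)
  next
    fix z assume "z \<in> r"
    show "case z of (a, b) \<Rightarrow> linear_between scale (sp N a) (sp N b) (mp N a b)"
    proof (cases z)
      case (Pair a b)
      have "mp N a b = (\<lambda>u. if a = b \<or> (a = y \<and> b = w) then u else 0)" by (simp add: N_def)
      moreover have "linear_between scale (sp N a) (sp N b) (\<lambda>u. if a = b \<or> (a = y \<and> b = w) then u else 0)"
        by (rule lb) (auto simp: N_def span_zero)
      ultimately show ?thesis using Pair by simp
    qed
  next
    fix x v' assume "x \<in> Field r"
    show "mp N x x v' = v'" by (simp add: N_def)
  next
    fix a b c u assume abc: "(a, b) \<in> r" "(b, c) \<in> r" and u: "u \<in> sp N a"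
    have as: "a = b" if "a = c" using that abc po(1) by (auto dest: antisymD)
    have "b = y \<or> b = w" if "a = y" "c = w" using cover abc that by blast
    moreover have "c \<noteq> w" if "a = w" "b \<noteq> w" using as that by blast
    ultimately show "mp N b c (mp N a b u) = mp N a c u"
      using u as yw(2) by (auto simp: N_def)
  qed
  have N'm: "is_module scale r N'"
    unfolding is_module_def
  proof (intro conjI ballI allI impI)
    fix x assume "x \<in> Field r"
    show "subspace (sp N' x)" "\<exists>B. finite B \<and> span B = sp N' x" using fin by (auto simp: N'_def)
  next
    fix z assume "z \<in> r"
    show "case z of (a, b) \<Rightarrow> linear_between scale (sp N' a) (sp N' b) (mp N' a b)"
    proof (cases z)
      case (Pair a b)
      have "mp N' a b = (\<lambda>u. if a = b then u else 0)" by (simp add: N'_def)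
      moreover have "linear_between scale (sp N' a) (sp N' b) (\<lambda>u. if a = b then u else 0)"
        by (rule lb) (auto simp: N'_def span_zero)
      ultimately show ?thesis using Pair by simp
    qed
  next
    fix x v' assume "x \<in> Field r"
    show "mp N' x x v' = v'" by (simp add: N'_def)
  next
    fix a b c u assume abc: "(a, b) \<in> r" "(b, c) \<in> r" and u: "u \<in> sp N' a"
    have as: "a = b" if "a = c" using that abc po(1) by (auto dest: antisymD)
    then show "mp N' b c (mp N' a b u) = mp N' a c u" by (auto simp: N'_def)
  qed
  define g where "g x u = (if x = y then u else 0)" for x and u :: 'b
  have gh: "is_hom scale r N N' g"
    unfolding is_hom_def
  proof (intro conjI ballI)
    fix x assume "x \<in> Field r"
    show "linear_between scale (sp N x) (sp N' x) (g x)"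
    proof -
      have "g x = (\<lambda>u. if x = y then u else 0)" by (rule ext) (simp add: g_def)
      moreover have "linear_between scale (sp N x) (sp N' x) (\<lambda>u. if x = y then u else 0)"
        by (rule lb) (auto simp: N_def N'_def span_zero)
      ultimately show ?thesis by simp
    qed
  next
    fix z assume "z \<in> r"
    show "case z of (a, b) \<Rightarrow> \<forall>u\<in>sp N a. g b (mp N a b u) = mp N' a b (g a u)"
      using yw(2) by (cases z) (auto simp: g_def N_def N'_def)
  qed
  have gs: "\<forall>x\<in>Field r. g x ` sp N x = sp N' x"
    using span_zero[of "{v}"] by (auto simp: g_def N_def N'_def image_iff)
  obtain \<phi> where \<phi>: "functional \<phi>" "\<phi> v = 1"
    using separating_functional[OF subspace_single_0, of v] v by auto
  define f where "f x u = (if x = y then scale (\<phi> u) v else 0)" for x u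
  have fh: "is_hom scale r ?S N' f"
    unfolding is_hom_def
  proof (intro conjI ballI)
    fix x assume "x \<in> Field r"
    show "linear_between scale (sp ?S x) (sp N' x) (f x)"
      by (auto simp: linear_between_def f_def N'_def functional_add[OF \<phi>(1)] functional_scale[OF \<phi>(1)]
          scale_left_distrib span_base span_scale)
  next
    fix z assume z: "z \<in> r"
    have "f b (mp M a b u) = mp N' a b (f a u)" if ab: "(a, b) \<in> r" and u: "u \<in> sp ?S a" for a b u
    proof (cases "a = b")
      case True
      have "a \<in> Field r" using ab by (auto simp: Field_def)
      then have "mp M a a u = u" using socle_subset[OF mod _ u] is_moduleD(8)[OF mod] by blast
      then show ?thesis using True by (simp add: N'_def)
    next
      case False
      then show ?thesis using socle_mp_zero[OF r mod ab False u]
        by (simp add: N'_def f_def functional_0[OF \<phi>(1)])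
    qed
    then show "case z of (a, b) \<Rightarrow> \<forall>u\<in>sp ?S a. f b (mp ?S a b u) = mp N' a b (f a u)"
      using z by (auto simp: socle_def)
  qed
  have "is_module scale r N \<and> is_module scale r N' \<and> is_hom scale r N N' g \<and>
      (\<forall>x\<in>Field r. g x ` sp N x = sp N' x) \<and> is_hom scale r ?S N' f"
    using Nm N'm gh gs fh by blast
  then have "\<exists>h. is_hom scale r ?S N h \<and> (\<forall>x\<in>Field r. \<forall>u\<in>sp ?S x. g x (h x u) = f x u)"
    by (rule proj[unfolded projective_def, THEN conjunct2, THEN spec, THEN spec, THEN spec, THEN spec, rule_format])
  then obtain h where h: "is_hom scale r ?S N h" "\<And>x u. x \<in> Field r \<Longrightarrow> u \<in> sp ?S x \<Longrightarrow> g x (h x u) = f x u"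
    by blast
  have "h y v = v" using h(2)[OF yF vS] \<phi>(2) by (simp add: g_def f_def)
  moreover have "h w (mp ?S y w v) = mp N y w (h y v)"
    using h(1) yw(1) vS unfolding is_hom_def by fast
  moreover have "mp ?S y w v = 0" using vkill[OF yw] by (simp add: socle_def)
  moreover have "h w 0 = 0"
  proof -
    have "w \<in> Field r" using yw by (auto simp: Field_def)
    then have "linear_between scale (sp ?S w) (sp N w) (h w)" using h(1) by (auto simp: is_hom_def)
    moreover have "0 \<in> sp ?S w" by (simp add: socle_def span_zero)
    ultimately have "h w (scale 0 0) = scale 0 (h w 0)" unfolding linear_between_def by blast
    then show ?thesis by simp
  qed
  ultimately show False using v by (simp add: N_def)
qed

end

section \<open>Arrows that determine a module\<close>

lemma rtrancl_subset_order:
  assumes "finite_poset r" "G \<subseteq> r" "(x, y) \<in> G\<^sup>*" "x \<in> Field r"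
  shows "(x, y) \<in> r"
  using assms(3,4)
proof (induction rule: rtrancl_induct)
  case base
  then show ?case using assms(1) by (auto simp: finite_poset_def order_on_defs refl_on_def)
next
  case (step y z)
  then show ?case using assms(1,2) by (meson finite_poset_def order_on_defs(1,2) subsetD transD)
qed

lemma generators_induct:
  assumes "finite_poset r" "G \<subseteq> r" "(x, y) \<in> G\<^sup>*" "x \<in> Field r"
    and "\<And>x. x \<in> Field r \<Longrightarrow> Q x x"
    and "\<And>x y z. (x, y) \<in> r \<Longrightarrow> (y, z) \<in> r \<Longrightarrow> Q x y \<Longrightarrow> Q y z \<Longrightarrow> Q x z"
    and "\<And>x y. (x, y) \<in> G \<Longrightarrow> Q x y"
  shows "Q x y"
  using assms(3)
proof (induction rule: rtrancl_induct)
  case base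
  then show ?case using assms(4,5) by blast
next
  case (step y z)
  then have "(x, y) \<in> r" using rtrancl_subset_order[OF assms(1,2) _ assms(4)] by blast
  then show ?case using step assms(2,6,7) by blast
qed

text \<open>The order \<open>r\<close> is generated by \<open>G\<close>. Every arrow of \<open>G\<close> either is a composite of arrows of \<open>E\<close> or
  can be recovered from them in a socle-projective module: its target embeds into the space at
  \<open>z\<close>, by \<open>joint_kernel_inj\<close>, and both of its ends reach \<open>z\<close> along \<open>E\<close>.\<close>

definition determines :: "'a rel \<Rightarrow> 'a rel \<Rightarrow> 'a rel \<Rightarrow> bool" where
  "determines E G r \<longleftrightarrow> E \<subseteq> r \<and> G \<subseteq> r \<and> (\<forall>(x, y)\<in>r. (x, y) \<in> G\<^sup>*) \<and>
     (\<forall>(s, t)\<in>G. (s, t) \<in> E\<^sup>* \<or>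
        (\<exists>z. (s, z) \<in> E\<^sup>* \<and> (t, z) \<in> E\<^sup>* \<and> (\<forall>w\<in>max_elems r. (t, w) \<in> r \<longrightarrow> (z, w) \<in> r)))"

context ambient_space
begin

definition sp_indec :: "'a rel \<Rightarrow> ('a, 'b) poset_rep \<Rightarrow> bool" where
  "sp_indec r M \<longleftrightarrow> is_module scale r M \<and> joint_kernel_zero r M \<and> indecomposable scale r M"

text \<open>The maps of a module are constrained only on its spaces; they are extended to linear maps of the
  ambient space.\<close>

definition extends_maps :: "'a rel \<Rightarrow> ('a, 'b) poset_rep \<Rightarrow> ('a \<Rightarrow> 'a \<Rightarrow> 'b \<Rightarrow> 'b) \<Rightarrow> bool" where
  "extends_maps r M h \<longleftrightarrow> (\<forall>(x, y)\<in>r. lin (h x y) \<and> (\<forall>v\<in>sp M x. h x y v = mp M x y v))"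

lemma extends_mapsD:
  "extends_maps r M h \<Longrightarrow> (x, y) \<in> r \<Longrightarrow> lin (h x y)"
  "extends_maps r M h \<Longrightarrow> (x, y) \<in> r \<Longrightarrow> v \<in> sp M x \<Longrightarrow> h x y v = mp M x y v"
  by (auto simp: extends_maps_def)

lemma linear_between_extend:
  assumes "subspace S" "linear_between scale S T f"
  obtains g where "lin g" "\<And>v. v \<in> S \<Longrightarrow> g v = f v"
proof -
  interpret p: vector_space_pair scale scale ..
  obtain B where B: "B \<subseteq> S" "independent B" "S \<subseteq> span B" using maximal_independent_subset .
  obtain g where g: "lin g" "\<forall>x\<in>B. g x = f x" using p.linear_independent_extend[OF B(2)] by blast
  interpret g: Vector_Spaces.linear scale scale g by (rule g)
  have f: "\<And>u v. u \<in> S \<Longrightarrow> v \<in> S \<Longrightarrow> f (u + v) = f u + f v" "\<And>c v. v \<in> S \<Longrightarrow> f (scale c v) = scale c (f v)"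
    using assms(2) by (auto simp: linear_between_def)
  have "f (scale 0 0) = scale 0 (f 0)" using f(2) subspace_0[OF assms(1)] by blast
  then have f0: "f 0 = 0" by simp
  have "subspace {v \<in> S. g v = f v}"
    using assms(1) f f0 by (auto simp: subspace_def g.add g.scale g.zero)
  then have "span B \<subseteq> {v \<in> S. g v = f v}" using B(1) g(2) by (intro span_minimal) auto
  then show ?thesis using that g(1) B(3) by blast
qed

lemma extends_maps_exists:
  assumes "is_module scale r M"
  shows "\<exists>h. extends_maps r M h"
proof -
  have "\<exists>g. (x, y) \<in> r \<longrightarrow> lin g \<and> (\<forall>v\<in>sp M x. g v = mp M x y v)" for x y
  proof (cases "(x, y) \<in> r")
    case True
    then have "x \<in> Field r" by (auto simp: Field_def)
    from linear_between_extend[OF is_moduleD(2)[OF assms this] is_moduleD(3)[OF assms True]]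
    show ?thesis by metis
  qed simp
  then obtain h where "\<And>x y. (x, y) \<in> r \<longrightarrow> lin (h x y) \<and> (\<forall>v\<in>sp M x. h x y v = mp M x y v)" by metis
  then show ?thesis unfolding extends_maps_def by (intro exI[of _ h]) auto
qed

lemma joint_kernel_inj:
  assumes M: "is_module scale r M" "joint_kernel_zero r M" and tz: "(t, z) \<in> r"
    and max: "\<forall>w\<in>max_elems r. (t, w) \<in> r \<longrightarrow> (z, w) \<in> r"
    and v: "v \<in> sp M t" "mp M t z v = 0"
  shows "v = 0"
proof -
  have "mp M t w v = 0" if w: "w \<in> max_elems r" "(t, w) \<in> r" for w
  proof -
    have zw: "(z, w) \<in> r" using max w by blast
    have "mp M t w v = mp M z w (mp M t z v)" using is_moduleD(9)[OF M(1) tz zw v(1)] by simp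
    then show ?thesis using v(2) is_moduleD(7)[OF M(1) zw] by simp
  qed
  moreover have "t \<in> Field r" using tz by (auto simp: Field_def)
  ultimately show ?thesis using M(2) v(1) by (auto simp: joint_kernel_zero_def)
qed

lemma summands_subset:
  assumes "subspace A" "subspace B"
  shows "A \<subseteq> {u + w | u w. u \<in> A \<and> w \<in> B} \<and> B \<subseteq> {u + w | u w. u \<in> A \<and> w \<in> B}"
proof (intro conjI subsetI CollectI)
  fix u assume "u \<in> A"
  then show "\<exists>a b. u = a + b \<and> a \<in> A \<and> b \<in> B" using subspace_0[OF assms(2)] by (intro exI[of _ u] exI[of _ 0]) simp
next
  fix u assume "u \<in> B"
  then show "\<exists>a b. u = a + b \<and> a \<in> A \<and> b \<in> B" using subspace_0[OF assms(1)] by (intro exI[of _ 0] exI[of _ u]) simp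
qed

lemma mp_image_trans:
  assumes "is_module scale r M" "(x, y) \<in> r" "(y, z) \<in> r" "S \<subseteq> sp M x"
    and "mp M x y ` S \<subseteq> T" "mp M y z ` T \<subseteq> R"
  shows "mp M x z ` S \<subseteq> R"
proof
  fix u assume "u \<in> mp M x z ` S"
  then obtain v where v: "u = mp M x z v" "v \<in> S" by blast
  then have "u = mp M y z (mp M x y v)" using is_moduleD(9)[OF assms(1-3), of v] assms(4) by auto
  moreover have "mp M x y v \<in> T" using assms(5) v(2) by blast
  ultimately show "u \<in> R" using assms(6) by blast
qed

text \<open>The component in \<open>W t\<close> of the image of a vector of \<open>U s\<close> is mapped into \<open>U z \<inter> W z = {0}\<close>, and
  \<open>M\<^sub>t\<close> embeds into \<open>M\<^sub>z\<close>.\<close>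

lemma determined_closed:
  assumes r: "finite_poset r" and d: "determines E G r" and M: "is_module scale r M" "joint_kernel_zero r M"
    and UW: "\<And>x. x \<in> Field r \<Longrightarrow> subspace (U x) \<and> subspace (W x) \<and> U x \<inter> W x = {0} \<and>
          {u + w | u w. u \<in> U x \<and> w \<in> W x} = sp M x"
    and E: "\<And>a b. (a, b) \<in> E \<Longrightarrow> mp M a b ` U a \<subseteq> U b \<and> mp M a b ` W a \<subseteq> W b"
    and xy: "(x, y) \<in> r"
  shows "mp M x y ` U x \<subseteq> U y"
proof -
  have sub: "U x \<subseteq> sp M x \<and> W x \<subseteq> sp M x" if "x \<in> Field r" for x
    using summands_subset[of "U x" "W x"] UW[OF that] by simp
  have Es: "mp M a b ` U a \<subseteq> U b \<and> mp M a b ` W a \<subseteq> W b" if "(a, b) \<in> E\<^sup>*" "a \<in> Field r" for a b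
  proof (rule generators_induct[OF r _ that, of "\<lambda>a b. mp M a b ` U a \<subseteq> U b \<and> mp M a b ` W a \<subseteq> W b"])
    show "E \<subseteq> r" using d by (simp add: determines_def)
    fix x assume x: "x \<in> Field r"
    then have "mp M x x v = v" if "v \<in> U x \<union> W x" for v using is_moduleD(8)[OF M(1) x] sub[OF x] that by blast
    then show "mp M x x ` U x \<subseteq> U x \<and> mp M x x ` W x \<subseteq> W x" by auto
  next
    fix x y z assume xyz: "(x, y) \<in> r" "(y, z) \<in> r" and IH: "mp M x y ` U x \<subseteq> U y \<and> mp M x y ` W x \<subseteq> W y"
      "mp M y z ` U y \<subseteq> U z \<and> mp M y z ` W y \<subseteq> W z"
    have "x \<in> Field r" using xyz by (auto simp: Field_def)
    then show "mp M x z ` U x \<subseteq> U z \<and> mp M x z ` W x \<subseteq> W z"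
      using mp_image_trans[OF M(1) xyz, of "U x" "U y" "U z"] mp_image_trans[OF M(1) xyz, of "W x" "W y" "W z"] sub IH
      by simp
  qed (rule E)
  have x: "x \<in> Field r" and xyG: "(x, y) \<in> G\<^sup>*" and Gr: "G \<subseteq> r" and Er: "E \<subseteq> r"
    using xy d by (auto simp: determines_def Field_def)
  show ?thesis
  proof (rule generators_induct[OF r Gr xyG x, of "\<lambda>a b. mp M a b ` U a \<subseteq> U b"])
    fix x assume x: "x \<in> Field r"
    then show "mp M x x ` U x \<subseteq> U x" using Es[of x x] by blast
  next
    fix x y z assume xyz: "(x, y) \<in> r" "(y, z) \<in> r" and IH: "mp M x y ` U x \<subseteq> U y" "mp M y z ` U y \<subseteq> U z"
    have "x \<in> Field r" using xyz by (auto simp: Field_def)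
    then show "mp M x z ` U x \<subseteq> U z" using mp_image_trans[OF M(1) xyz, of "U x" "U y" "U z"] sub IH by simp
  next
    fix s t assume st: "(s, t) \<in> G"
    have str: "(s, t) \<in> r" using st Gr by blast
    have F: "s \<in> Field r" "t \<in> Field r" using str by (auto simp: Field_def)
    have "(s, t) \<in> E\<^sup>* \<or> (\<exists>z. (s, z) \<in> E\<^sup>* \<and> (t, z) \<in> E\<^sup>* \<and> (\<forall>w\<in>max_elems r. (t, w) \<in> r \<longrightarrow> (z, w) \<in> r))"
      using d st unfolding determines_def by blast
    then show "mp M s t ` U s \<subseteq> U t"
    proof
      assume "(s, t) \<in> E\<^sup>*" then show ?thesis using Es F by blast
    next
      assume "\<exists>z. (s, z) \<in> E\<^sup>* \<and> (t, z) \<in> E\<^sup>* \<and> (\<forall>w\<in>max_elems r. (t, w) \<in> r \<longrightarrow> (z, w) \<in> r)"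
      then obtain z where z: "(s, z) \<in> E\<^sup>*" "(t, z) \<in> E\<^sup>*" "\<forall>w\<in>max_elems r. (t, w) \<in> r \<longrightarrow> (z, w) \<in> r" by blast
      have tz: "(t, z) \<in> r" using rtrancl_subset_order[OF r Er z(2) F(2)] .
      have zF: "z \<in> Field r" using tz by (auto simp: Field_def)
      show ?thesis
      proof
        fix y assume "y \<in> mp M s t ` U s"
        then obtain u where u: "y = mp M s t u" "u \<in> U s" by blast
        have us: "u \<in> sp M s" using u sub F by blast
        have "y \<in> sp M t" using is_moduleD(4)[OF M(1) str us] u by simp
        then have "y \<in> {u + w | u w. u \<in> U t \<and> w \<in> W t}" using UW[OF F(2)] by simp
        then obtain u' w' where uw: "y = u' + w'" "u' \<in> U t" "w' \<in> W t" by blast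
        have uw': "u' \<in> sp M t" "w' \<in> sp M t" using uw sub[OF F(2)] by auto
        have "mp M t z y = mp M t z u' + mp M t z w'" using is_moduleD(5)[OF M(1) tz uw'] uw by simp
        moreover have "mp M t z y \<in> U z" using is_moduleD(9)[OF M(1) str tz us] u Es[OF z(1) F(1)] by auto
        moreover have "mp M t z u' \<in> U z" "mp M t z w' \<in> W z" using Es[OF z(2) F(2)] uw by auto
        ultimately have "mp M t z w' \<in> U z"
          using subspace_diff[of "U z" "mp M t z y" "mp M t z u'"] UW[OF zF] by simp
        then have "mp M t z w' = 0" using \<open>mp M t z w' \<in> W z\<close> UW[OF zF] by blast
        then have "w' = 0" using joint_kernel_inj[OF M tz z(3) uw'(2)] by simp
        then show "y \<in> U t" using uw by simp
      qed
    qed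
  qed
qed

lemma submoduleI:
  assumes "\<And>x. x \<in> Field r \<Longrightarrow> subspace (U x) \<and> U x \<subseteq> sp M x" "\<And>a b. (a, b) \<in> r \<Longrightarrow> mp M a b ` U a \<subseteq> U b"
  shows "submodule scale r M U"
  using assms unfolding submodule_def by fast

text \<open>A decomposition respected by \<open>E\<close> is respected by all structure maps, so \<open>E\<close> alone detects that
  the module is indecomposable.\<close>

lemma determined_rep_indec:
  assumes r: "finite_poset r" and d: "determines E G r" and M: "sp_indec r M" and h: "extends_maps r M h"
  shows "rep_indec (Field r) E (sp M) h"
  unfolding rep_indec_def
proof (intro conjI allI impI)
  have m: "is_module scale r M" "joint_kernel_zero r M" and ind: "indecomposable scale r M"
    using M by (auto simp: sp_indec_def)
  show "\<exists>x\<in>Field r. sp M x \<noteq> {0}" using ind by (auto simp: indecomposable_def zero_family_def)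
  fix U W
  assume *: "(\<forall>x\<in>Field r. subspace (U x) \<and> subspace (W x) \<and> U x \<inter> W x = {0} \<and> {u + w |u w. u \<in> U x \<and> w \<in> W x} = sp M x) \<and>
          (\<forall>(a, b)\<in>E. h a b ` U a \<subseteq> U b \<and> h a b ` W a \<subseteq> W b)"
  then have UW: "\<And>x. x \<in> Field r \<Longrightarrow> subspace (U x) \<and> subspace (W x) \<and> U x \<inter> W x = {0} \<and> {u + w |u w. u \<in> U x \<and> w \<in> W x} = sp M x"
    by blast
  have comm: "{u + w |u w. u \<in> A \<and> w \<in> B} = {u + w |u w. u \<in> B \<and> w \<in> A}" for A B :: "'b set"
    by (auto; metis add.commute)
  have WU: "\<And>x. x \<in> Field r \<Longrightarrow> subspace (W x) \<and> subspace (U x) \<and> W x \<inter> U x = {0} \<and> {u + w |u w. u \<in> W x \<and> w \<in> U x} = sp M x"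
    using UW comm by (simp add: Int_commute)
  have sub: "U x \<subseteq> sp M x \<and> W x \<subseteq> sp M x" if "x \<in> Field r" for x
    using summands_subset[of "U x" "W x"] UW[OF that] by simp
  have E: "mp M a b ` U a \<subseteq> U b \<and> mp M a b ` W a \<subseteq> W b" if ab: "(a, b) \<in> E" for a b
  proof -
    have abr: "(a, b) \<in> r" using d ab by (auto simp: determines_def)
    then have a: "a \<in> Field r" by (auto simp: Field_def)
    have "h a b v = mp M a b v" if "v \<in> U a \<union> W a" for v
      using extends_mapsD(2)[OF h abr] sub[OF a] that by blast
    then have "h a b ` U a = mp M a b ` U a" "h a b ` W a = mp M a b ` W a" by (auto intro!: image_cong)
    moreover have "h a b ` U a \<subseteq> U b \<and> h a b ` W a \<subseteq> W b" using bspec[OF conjunct2[OF *] ab] by simp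
    ultimately show ?thesis by simp
  qed
  then have E': "mp M a b ` W a \<subseteq> W b \<and> mp M a b ` U a \<subseteq> U b" if "(a, b) \<in> E" for a b using that by blast
  have "submodule scale r M U"
    by (rule submoduleI) (use UW sub in blast, rule determined_closed[OF r d m UW E])
  moreover have "submodule scale r M W"
    by (rule submoduleI) (use UW sub in blast, rule determined_closed[OF r d m WU E'])
  ultimately have "zero_family r U \<or> zero_family r W"
    using ind UW unfolding indecomposable_def by blast
  then show "(\<forall>x\<in>Field r. U x = {0}) \<or> (\<forall>x\<in>Field r. W x = {0})" by (simp add: zero_family_def)
qed

text \<open>The two ways around the square of an arrow of \<open>G\<close> agree after the injection into the space at
  \<open>z\<close>.\<close>

lemma determined_hom:
  assumes r: "finite_poset r" and d: "determines E G r"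
    and M: "is_module scale r M" and N: "is_module scale r N" "joint_kernel_zero r N"
    and f: "\<And>x. x \<in> Field r \<Longrightarrow> linear_between scale (sp M x) (sp N x) (f x)"
    and E: "\<And>a b v. (a, b) \<in> E \<Longrightarrow> v \<in> sp M a \<Longrightarrow> f b (mp M a b v) = mp N a b (f a v)"
  shows "is_hom scale r M N f"
proof -
  have fN: "f x v \<in> sp N x" if "x \<in> Field r" "v \<in> sp M x" for x v
    using f[OF that(1)] that(2) by (auto simp: linear_between_def)
  have tr: "\<forall>v\<in>sp M x. f z (mp M x z v) = mp N x z (f x v)"
    if xyz: "(x, y) \<in> r" "(y, z) \<in> r" and "\<forall>v\<in>sp M x. f y (mp M x y v) = mp N x y (f x v)"
      "\<forall>v\<in>sp M y. f z (mp M y z v) = mp N y z (f y v)" for x y z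
  proof
    fix v assume v: "v \<in> sp M x"
    have x: "x \<in> Field r" using xyz by (auto simp: Field_def)
    have "f z (mp M x z v) = f z (mp M y z (mp M x y v))" using is_moduleD(9)[OF M xyz v] by simp
    also have "\<dots> = mp N y z (mp N x y (f x v))" using that is_moduleD(4)[OF M xyz(1) v] v by simp
    also have "\<dots> = mp N x z (f x v)" using is_moduleD(9)[OF N(1) xyz fN[OF x v]] .
    finally show "f z (mp M x z v) = mp N x z (f x v)" .
  qed
  have rf: "\<forall>v\<in>sp M x. f x (mp M x x v) = mp N x x (f x v)" if "x \<in> Field r" for x
    using is_moduleD(8)[OF M that] is_moduleD(8)[OF N(1) that] fN[OF that] by simp
  have Gr: "G \<subseteq> r" and Er: "E \<subseteq> r" using d by (auto simp: determines_def)
  have Es: "\<forall>v\<in>sp M a. f b (mp M a b v) = mp N a b (f a v)" if "(a, b) \<in> E\<^sup>*" "a \<in> Field r" for a b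
    by (rule generators_induct[OF r Er that, of "\<lambda>a b. \<forall>v\<in>sp M a. f b (mp M a b v) = mp N a b (f a v)"])
      (rule rf, assumption, rule tr, assumption+, rule ballI, rule E)
  have "\<forall>v\<in>sp M a. f b (mp M a b v) = mp N a b (f a v)" if ab: "(a, b) \<in> r" for a b
  proof -
    have a: "a \<in> Field r" and abG: "(a, b) \<in> G\<^sup>*" using ab d by (auto simp: determines_def Field_def)
    show ?thesis
    proof (rule generators_induct[OF r Gr abG a, of "\<lambda>a b. \<forall>v\<in>sp M a. f b (mp M a b v) = mp N a b (f a v)"])
      fix s t assume st: "(s, t) \<in> G"
      have str: "(s, t) \<in> r" using st Gr by blast
      have F: "s \<in> Field r" "t \<in> Field r" using str by (auto simp: Field_def)
      have "(s, t) \<in> E\<^sup>* \<or> (\<exists>z. (s, z) \<in> E\<^sup>* \<and> (t, z) \<in> E\<^sup>* \<and> (\<forall>w\<in>max_elems r. (t, w) \<in> r \<longrightarrow> (z, w) \<in> r))"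
        using d st unfolding determines_def by blast
      then show "\<forall>v\<in>sp M s. f t (mp M s t v) = mp N s t (f s v)"
      proof
        assume "(s, t) \<in> E\<^sup>*" then show ?thesis using Es F by blast
      next
        assume "\<exists>z. (s, z) \<in> E\<^sup>* \<and> (t, z) \<in> E\<^sup>* \<and> (\<forall>w\<in>max_elems r. (t, w) \<in> r \<longrightarrow> (z, w) \<in> r)"
        then obtain z where z: "(s, z) \<in> E\<^sup>*" "(t, z) \<in> E\<^sup>*" "\<forall>w\<in>max_elems r. (t, w) \<in> r \<longrightarrow> (z, w) \<in> r" by blast
        have tz: "(t, z) \<in> r" using rtrancl_subset_order[OF r Er z(2) F(2)] .
        show ?thesis
        proof
          fix v assume v: "v \<in> sp M s"
          let ?d = "f t (mp M s t v) - mp N s t (f s v)"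
          have a: "f t (mp M s t v) \<in> sp N t" using fN[OF F(2)] is_moduleD(4)[OF M str v] by blast
          have b: "mp N s t (f s v) \<in> sp N t" using fN[OF F(1) v] is_moduleD(4)[OF N(1) str] by blast
          have "mp N t z (f t (mp M s t v)) = f z (mp M t z (mp M s t v))"
            using Es[OF z(2) F(2)] is_moduleD(4)[OF M str v] by simp
          also have "\<dots> = f z (mp M s z v)" using is_moduleD(9)[OF M str tz v] by simp
          also have "\<dots> = mp N s z (f s v)" using Es[OF z(1) F(1)] v by blast
          also have "\<dots> = mp N t z (mp N s t (f s v))" using is_moduleD(9)[OF N(1) str tz fN[OF F(1) v]] by simp
          finally have eq: "mp N t z (f t (mp M s t v)) = mp N t z (mp N s t (f s v))" .
          have d: "?d \<in> sp N t" using a b is_moduleD(2)[OF N(1) F(2)] subspace_diff by blast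
          have "mp N t z (f t (mp M s t v)) = mp N t z (?d + mp N s t (f s v))" by simp
          also have "\<dots> = mp N t z ?d + mp N t z (mp N s t (f s v))" by (rule is_moduleD(5)[OF N(1) tz d b])
          finally have "mp N t z ?d = 0" using eq by simp
          then have "?d = 0" using joint_kernel_inj[OF N tz z(3) d] by simp
          then show "f t (mp M s t v) = mp N s t (f s v)" by simp
        qed
      qed
    qed (rule rf, assumption, rule tr)
  qed
  then show ?thesis using f unfolding is_hom_def by blast
qed

text \<open>Finiteness of the number of isomorphism classes, stated by means of an invariant \<open>\<kappa>\<close> with
  finitely many values. The type of the values is the one of the codes in \<open>coded\<close>, since a
  formula cannot quantify over types.\<close>

definition finitely_coded :: "'a rel \<Rightarrow> bool" where
  "finitely_coded r \<longleftrightarrow> (\<exists>(\<C> :: (('a \<times> nat) set \<times> ('a \<times> 'a \<times> nat \<times> nat \<times> 'k) set) set) \<kappa>.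
     finite \<C> \<and> (\<forall>M. sp_indec r M \<longrightarrow> \<kappa> M \<in> \<C>) \<and>
     (\<forall>M N. sp_indec r M \<longrightarrow> sp_indec r N \<longrightarrow> \<kappa> M = \<kappa> N \<longrightarrow> isomorphic_modules scale r M N))"

lemma finitely_coded_of_blocks:
  assumes r: "finite_poset r" and d: "determines E G r"
    and bl: "\<And>M h. sp_indec r M \<Longrightarrow> extends_maps r M h \<Longrightarrow> is_rep (Field r) E (sp M) h \<Longrightarrow>
      \<exists>e \<beta>. blocks (Field r) E (sp M) h e \<beta>"
  shows "finitely_coded r"
proof -
  have Er: "E \<subseteq> r" using d by (auto simp: determines_def)
  have EF: "E \<subseteq> Field r \<times> Field r" using Er by (auto simp: Field_def)
  have rep: "is_rep (Field r) E (sp M) h" if M: "sp_indec r M" and h: "extends_maps r M h" for M h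
  proof -
    have m: "is_module scale r M" using M by (simp add: sp_indec_def)
    have "a \<in> Field r \<and> b \<in> Field r \<and> lin (h a b) \<and> h a b ` sp M a \<subseteq> sp M b" if "(a, b) \<in> E" for a b
    proof -
      have abr: "(a, b) \<in> r" using that Er by blast
      then show ?thesis
        using extends_mapsD[OF h abr] is_moduleD(4)[OF m abr] by (auto simp: Field_def)
    qed
    then show ?thesis using is_moduleD(1)[OF m] unfolding is_rep_def by blast
  qed
  define P where "P M \<kappa> \<longleftrightarrow> (\<exists>h. extends_maps r M h \<and> coded (Field r) E (sp M) h \<kappa>)" for M \<kappa>
  have ex: "\<exists>\<kappa>. P M \<kappa>" if M: "sp_indec r M" for M
  proof -
    obtain h where h: "extends_maps r M h" using extends_maps_exists M by (auto simp: sp_indec_def)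
    obtain e \<beta> where "blocks (Field r) E (sp M) h e \<beta>" using bl[OF M h rep[OF M h]] by blast
    then have "\<exists>\<kappa>. coded (Field r) E (sp M) h \<kappa>"
      using rep_indec_coded[OF rep[OF M h] determined_rep_indec[OF r d M h]] by blast
    then show ?thesis using h by (auto simp: P_def)
  qed
  define \<kappa> where "\<kappa> M = (SOME \<kappa>. P M \<kappa>)" for M
  have \<kappa>: "P M (\<kappa> M)" if "sp_indec r M" for M unfolding \<kappa>_def using ex[OF that] by (rule someI_ex)
  have finF: "finite (Field r)" using r by (simp add: finite_poset_def)
  let ?C = "Pow (Field r \<times> {..<2}) \<times> Pow (Field r \<times> Field r \<times> {..<2} \<times> {..<2} \<times> {-1, 0, 1})
     :: (('a \<times> nat) set \<times> ('a \<times> 'a \<times> nat \<times> nat \<times> 'k) set) set"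
  have "finite ?C" using finF by simp
  moreover have "\<kappa> M \<in> ?C" if "sp_indec r M" for M
    using \<kappa>[OF that] coded_finite[OF finF EF] unfolding P_def by blast
  moreover have "isomorphic_modules scale r M N" if M: "sp_indec r M" and N: "sp_indec r N" and eq: "\<kappa> M = \<kappa> N" for M N
  proof -
    obtain h where h: "extends_maps r M h" "coded (Field r) E (sp M) h (\<kappa> M)" using \<kappa>[OF M] by (auto simp: P_def)
    obtain h' where h': "extends_maps r N h'" "coded (Field r) E (sp N) h' (\<kappa> M)" using \<kappa>[OF N] eq by (auto simp: P_def)
    obtain f where f: "\<And>x. x \<in> Field r \<Longrightarrow> lin (f x) \<and> bij_betw (f x) (sp M x) (sp N x)"
      "\<And>a b v. (a, b) \<in> E \<Longrightarrow> v \<in> sp M a \<Longrightarrow> f b (h a b v) = h' a b (f a v)"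
      using coded_iso[OF rep[OF M h(1)] rep[OF N h'(1)] h(2) h'(2)] by fast
    have m: "is_module scale r M" "is_module scale r N" "joint_kernel_zero r N"
      using M N by (auto simp: sp_indec_def)
    have "is_hom scale r M N f"
    proof (rule determined_hom[OF r d m])
      fix x assume x: "x \<in> Field r"
      interpret f: Vector_Spaces.linear scale scale "f x" using f(1)[OF x] by blast
      show "linear_between scale (sp M x) (sp N x) (f x)"
        using f(1)[OF x] by (auto simp: linear_between_def bij_betw_def f.add f.scale)
    next
      fix a b v assume ab: "(a, b) \<in> E" and v: "v \<in> sp M a"
      have abr: "(a, b) \<in> r" and a: "a \<in> Field r" using ab Er EF by auto
      have "f a v \<in> sp N a" using f(1)[OF a] v by (auto simp: bij_betw_def)
      then show "f b (mp M a b v) = mp N a b (f a v)"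
        using f(2)[OF ab v] extends_mapsD(2)[OF h(1) abr v] extends_mapsD(2)[OF h'(1) abr] by simp
    qed
    then show ?thesis unfolding isomorphic_modules_def using f(1) by blast
  qed
  ultimately show ?thesis unfolding finitely_coded_def by blast
qed

section \<open>Isomorphic modules and isomorphic posets\<close>

lemma isomorphic_modules_sym:
  assumes M: "is_module scale r M" and N: "is_module scale r N" and iso: "isomorphic_modules scale r M N"
  shows "isomorphic_modules scale r N M"
proof -
  obtain f where f: "is_hom scale r M N f" "\<forall>x\<in>Field r. bij_betw (f x) (sp M x) (sp N x)"
    using iso by (auto simp: isomorphic_modules_def)
  define g where "g x = inv_into (sp M x) (f x)" for x
  have gf: "g x (f x v) = v" if "x \<in> Field r" "v \<in> sp M x" for x v
    unfolding g_def by (rule bij_betw_inv_into_left[OF bspec[OF f(2) that(1)] that(2)])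
  have fg: "f x (g x w) = w" if "x \<in> Field r" "w \<in> sp N x" for x w
    unfolding g_def by (rule bij_betw_inv_into_right[OF bspec[OF f(2) that(1)] that(2)])
  have gM: "g x w \<in> sp M x" if "x \<in> Field r" "w \<in> sp N x" for x w
    unfolding g_def by (rule inv_into_into) (use bspec[OF f(2) that(1)] that(2) in \<open>simp add: bij_betw_def\<close>)
  have lb: "linear_between scale (sp M x) (sp N x) (f x)" if "x \<in> Field r" for x
    using f(1) that by (auto simp: is_hom_def)
  have "linear_between scale (sp N x) (sp M x) (g x)" if x: "x \<in> Field r" for x
    unfolding linear_between_def
  proof (intro conjI ballI allI)
    show "g x ` sp N x \<subseteq> sp M x" using gM[OF x] by blast
    fix u assume u: "u \<in> sp N x"
    have add: "f x (a + b) = f x a + f x b" if "a \<in> sp M x" "b \<in> sp M x" for a b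
      using lb[OF x] that by (auto simp: linear_between_def)
    have sc: "f x (scale c a) = scale c (f x a)" if "a \<in> sp M x" for a c
      using lb[OF x] that by (auto simp: linear_between_def)
    have S: "subspace (sp M x)" by (rule is_moduleD(2)[OF M x])
    show "g x (u + w) = g x u + g x w" if w: "w \<in> sp N x" for w
    proof -
      have "u + w = f x (g x u + g x w)" using add gM[OF x u] gM[OF x w] fg[OF x u] fg[OF x w] by simp
      then show ?thesis using gf[OF x subspace_add[OF S gM[OF x u] gM[OF x w]]] by simp
    qed
    show "g x (scale c u) = scale c (g x u)" for c
    proof -
      have "scale c u = f x (scale c (g x u))" using sc gM[OF x u] fg[OF x u] by simp
      then show ?thesis using gf[OF x subspace_scale[OF S gM[OF x u]]] by simp
    qed
  qed
  moreover have "g y (mp N x y w) = mp M x y (g x w)" if xy: "(x, y) \<in> r" and w: "w \<in> sp N x" for x y w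
  proof -
    have F: "x \<in> Field r" "y \<in> Field r" using xy by (auto simp: Field_def)
    have "f y (mp M x y (g x w)) = mp N x y w"
      using f(1) xy gM[OF F(1) w] fg[OF F(1) w] unfolding is_hom_def by fastforce
    then show ?thesis using gf[OF F(2) is_moduleD(4)[OF M xy gM[OF F(1) w]]] by simp
  qed
  ultimately have "is_hom scale r N M g" unfolding is_hom_def by blast
  moreover have "bij_betw (g x) (sp N x) (sp M x)" if "x \<in> Field r" for x
    unfolding g_def using f(2) that by (simp add: bij_betw_inv_into)
  ultimately show ?thesis unfolding isomorphic_modules_def by blast
qed

lemma isomorphic_modules_trans:
  assumes "isomorphic_modules scale r M N" "isomorphic_modules scale r N P"
  shows "isomorphic_modules scale r M P"
proof -
  obtain f where f: "is_hom scale r M N f" "\<forall>x\<in>Field r. bij_betw (f x) (sp M x) (sp N x)"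
    using assms(1) by (auto simp: isomorphic_modules_def)
  obtain g where g: "is_hom scale r N P g" "\<forall>x\<in>Field r. bij_betw (g x) (sp N x) (sp P x)"
    using assms(2) by (auto simp: isomorphic_modules_def)
  have fN: "f x v \<in> sp N x" if "x \<in> Field r" "v \<in> sp M x" for x v
    using f(2) that by (auto simp: bij_betw_def)
  have "linear_between scale (sp M x) (sp P x) (g x \<circ> f x)" if x: "x \<in> Field r" for x
  proof -
    have "linear_between scale (sp M x) (sp N x) (f x)" "linear_between scale (sp N x) (sp P x) (g x)"
      using f(1) g(1) x by (auto simp: is_hom_def)
    then show ?thesis by (auto simp: linear_between_def image_subset_iff)
  qed
  moreover have "(g y \<circ> f y) (mp M x y v) = mp P x y ((g x \<circ> f x) v)" if xy: "(x, y) \<in> r" and v: "v \<in> sp M x" for x y v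
  proof -
    have x: "x \<in> Field r" using xy by (auto simp: Field_def)
    have "f y (mp M x y v) = mp N x y (f x v)" using f(1) xy v unfolding is_hom_def by fast
    moreover have "g y (mp N x y (f x v)) = mp P x y (g x (f x v))"
      using g(1) xy fN[OF x v] unfolding is_hom_def by fast
    ultimately show ?thesis by simp
  qed
  ultimately have "is_hom scale r M P (\<lambda>x. g x \<circ> f x)" unfolding is_hom_def by blast
  moreover have "bij_betw (g x \<circ> f x) (sp M x) (sp P x)" if "x \<in> Field r" for x
    using f(2) g(2) that by (meson bij_betw_trans)
  ultimately show ?thesis unfolding isomorphic_modules_def by blast
qed

lemma finite_quotient_of_invariant:
  assumes "\<And>M. M \<in> A \<Longrightarrow> \<kappa> M \<in> C" "finite C" and R: "R \<subseteq> A \<times> A" "sym R" "trans R"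
    and "\<And>M N. M \<in> A \<Longrightarrow> N \<in> A \<Longrightarrow> \<kappa> M = \<kappa> N \<Longrightarrow> (M, N) \<in> R"
  shows "finite (A // R)"
proof -
  define F where "F k = R `` {SOME M. M \<in> A \<and> \<kappa> M = k}" for k
  have "R `` {M} \<in> F ` C" if M: "M \<in> A" for M
  proof -
    define N where "N = (SOME N. N \<in> A \<and> \<kappa> N = \<kappa> M)"
    have "N \<in> A \<and> \<kappa> N = \<kappa> M" unfolding N_def by (rule someI[of _ M]) (use M in simp)
    then have "(M, N) \<in> R" using assms(6)[OF M] by simp
    then have "R `` {M} = R `` {N}" using R(2,3) by (auto dest: symD transD)
    then have "R `` {M} = F (\<kappa> M)" by (simp add: F_def N_def)
    then show ?thesis using assms(1)[OF M] by blast
  qed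
  then have "A // R \<subseteq> F ` C" unfolding quotient_def by blast
  then show ?thesis using assms(2) finite_surj by blast
qed

text \<open>Modules are transported along the isomorphism of the posets; the invariant of the transported
  module separates isomorphism classes.\<close>

lemma finite_sp_type_transfer:
  assumes r: "finite_poset r" and iso: "poset_isomorphic r s" and fin: "finitely_coded s"
  shows "finite_sp_type scale r"
proof -
  obtain \<phi> where \<phi>: "bij_betw \<phi> (Field r) (Field s)"
    "\<And>x y. x \<in> Field r \<Longrightarrow> y \<in> Field r \<Longrightarrow> (x, y) \<in> r \<longleftrightarrow> (\<phi> x, \<phi> y) \<in> s"
    using iso by (auto simp: poset_isomorphic_def)
  define g where "g = inv_into (Field r) \<phi>"
  have \<phi>g: "\<phi> (g i) = i" if "i \<in> Field s" for i
    unfolding g_def by (rule bij_betw_inv_into_right[OF \<phi>(1) that])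
  have gF: "g i \<in> Field r" if "i \<in> Field s" for i
    unfolding g_def by (rule inv_into_into) (use \<phi>(1) that in \<open>simp add: bij_betw_def\<close>)
  have g\<phi>: "g (\<phi> x) = x" and \<phi>F: "\<phi> x \<in> Field s" if "x \<in> Field r" for x
    using \<phi>(1) that by (auto simp: g_def bij_betw_inv_into_left bij_betw_apply)
  have gr: "(g i, g j) \<in> r" if "(i, j) \<in> s" for i j
  proof -
    have "i \<in> Field s" "j \<in> Field s" using that by (auto simp: Field_def)
    then show ?thesis using \<phi>(2)[of "g i" "g j"] gF \<phi>g that by simp
  qed
  have \<phi>s: "(\<phi> x, \<phi> y) \<in> s" if "(x, y) \<in> r" for x y
    using \<phi>(2)[of x y] that by (auto simp: Field_def)
  define T :: "('a, 'b) poset_rep \<Rightarrow> ('c, 'b) poset_rep" where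
    "T M = \<lparr>sp = \<lambda>i. sp M (g i), mp = \<lambda>i j. mp M (g i) (g j)\<rparr>" for M
  have T: "sp_indec s (T M)" if M: "M \<in> ind_sp scale r" for M
  proof -
    have m: "is_module scale r M" and jk: "joint_kernel_zero r M" and ind: "indecomposable scale r M"
      using M socle_projective_joint_kernel[OF r] by (auto simp: ind_sp_def socle_projective_def)
    have "is_module scale s (T M)"
      unfolding is_module_def
    proof (intro conjI ballI allI impI)
      fix x assume x: "x \<in> Field s"
      show "subspace (sp (T M) x)" "\<exists>B. finite B \<and> span B = sp (T M) x"
        using is_moduleD(1)[OF m gF[OF x]] by (auto simp: T_def findim_def)
      show "mp (T M) x x v = v" if "v \<in> sp (T M) x" for v
        using that is_moduleD(8)[OF m gF[OF x]] by (simp add: T_def)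
    next
      fix z assume "z \<in> s"
      then show "case z of (x, y) \<Rightarrow> linear_between scale (sp (T M) x) (sp (T M) y) (mp (T M) x y)"
        using is_moduleD(3)[OF m gr] by (cases z) (simp add: T_def)
    next
      fix x y w v assume "(x, y) \<in> s" "(y, w) \<in> s" "v \<in> sp (T M) x"
      then show "mp (T M) y w (mp (T M) x y v) = mp (T M) x w v"
        using is_moduleD(9)[OF m gr gr] by (simp add: T_def)
    qed
    moreover have "joint_kernel_zero s (T M)"
      unfolding joint_kernel_zero_def
    proof (intro ballI impI)
      fix x v assume x: "x \<in> Field s" and v: "v \<in> sp (T M) x"
        and kill: "\<forall>z\<in>max_elems s. (x, z) \<in> s \<longrightarrow> mp (T M) x z v = 0"
      have "mp M (g x) w v = 0" if w: "w \<in> max_elems r" "(g x, w) \<in> r" for w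
      proof -
        have wF: "w \<in> Field r" using w by (auto simp: max_elems_def)
        have "\<phi> w \<in> max_elems s"
        proof -
          have "y = \<phi> w" if y: "(\<phi> w, y) \<in> s" for y
          proof -
            have "(w, g y) \<in> r" using gr[OF y] g\<phi>[OF wF] by simp
            then have "g y = w" using w(1) by (auto simp: max_elems_def)
            moreover have "y \<in> Field s" using y by (auto simp: Field_def)
            ultimately show ?thesis using \<phi>g by metis
          qed
          then show ?thesis using \<phi>F[OF wF] by (auto simp: max_elems_def)
        qed
        moreover have "(x, \<phi> w) \<in> s" using \<phi>s[OF w(2)] \<phi>g[OF x] by simp
        ultimately show ?thesis using kill g\<phi>[OF wF] by (auto simp: T_def)
      qed
      then show "v = 0" using jk gF[OF x] v unfolding joint_kernel_zero_def T_def by simp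
    qed
    moreover have "indecomposable scale s (T M)"
      unfolding indecomposable_def
    proof (intro conjI allI impI)
      show "\<not> zero_family s (sp (T M))"
      proof
        assume z: "zero_family s (sp (T M))"
        have "sp M x = {0}" if x: "x \<in> Field r" for x
          using z \<phi>F[OF x] g\<phi>[OF x] unfolding zero_family_def T_def by force
        then show False using ind by (auto simp: indecomposable_def zero_family_def)
      qed
      fix U W
      assume *: "submodule scale s (T M) U \<and> submodule scale s (T M) W \<and>
        (\<forall>x\<in>Field s. U x \<inter> W x = {0} \<and> {u + w |u w. u \<in> U x \<and> w \<in> W x} = sp (T M) x)"
      have sm: "submodule scale r M (\<lambda>x. U (\<phi> x))" if U: "submodule scale s (T M) U" for U
      proof (rule submoduleI)
        fix x assume x: "x \<in> Field r"
        show "subspace (U (\<phi> x)) \<and> U (\<phi> x) \<subseteq> sp M x"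
          using U \<phi>F[OF x] g\<phi>[OF x] unfolding submodule_def T_def by force
      next
        fix a b assume ab: "(a, b) \<in> r"
        have "a \<in> Field r" "b \<in> Field r" using ab by (auto simp: Field_def)
        then show "mp M a b ` U (\<phi> a) \<subseteq> U (\<phi> b)"
          using U \<phi>s[OF ab] g\<phi> unfolding submodule_def T_def by force
      qed
      have "\<forall>x\<in>Field r. U (\<phi> x) \<inter> W (\<phi> x) = {0} \<and> {u + w |u w. u \<in> U (\<phi> x) \<and> w \<in> W (\<phi> x)} = sp M x"
      proof
        fix x assume x: "x \<in> Field r"
        have "sp (T M) (\<phi> x) = sp M x" using g\<phi>[OF x] by (simp add: T_def)
        then show "U (\<phi> x) \<inter> W (\<phi> x) = {0} \<and> {u + w |u w. u \<in> U (\<phi> x) \<and> w \<in> W (\<phi> x)} = sp M x"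
          using * \<phi>F[OF x] by simp
      qed
      then have "zero_family r (\<lambda>x. U (\<phi> x)) \<or> zero_family r (\<lambda>x. W (\<phi> x))"
        using ind sm[of U] sm[of W] * unfolding indecomposable_def by blast
      moreover have "zero_family s U" if "zero_family r (\<lambda>x. U (\<phi> x))" for U :: "'c \<Rightarrow> 'b set"
        using that gF \<phi>g unfolding zero_family_def by metis
      ultimately show "zero_family s U \<or> zero_family s W" by blast
    qed
    ultimately show ?thesis by (simp add: sp_indec_def)
  qed
  have pull: "isomorphic_modules scale r M N" if i: "isomorphic_modules scale s (T M) (T N)" for M N
  proof -
    obtain f where f: "is_hom scale s (T M) (T N) f" "\<forall>x\<in>Field s. bij_betw (f x) (sp (T M) x) (sp (T N) x)"
      using i unfolding isomorphic_modules_def by blast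
    have "linear_between scale (sp M x) (sp N x) (f (\<phi> x))" "bij_betw (f (\<phi> x)) (sp M x) (sp N x)"
      if x: "x \<in> Field r" for x
      using f \<phi>F[OF x] g\<phi>[OF x] unfolding is_hom_def T_def by force+
    moreover have "f (\<phi> y) (mp M x y v) = mp N x y (f (\<phi> x) v)" if xy: "(x, y) \<in> r" and v: "v \<in> sp M x" for x y v
    proof -
      have F: "x \<in> Field r" "y \<in> Field r" using xy by (auto simp: Field_def)
      have "\<forall>v\<in>sp (T M) (\<phi> x). f (\<phi> y) (mp (T M) (\<phi> x) (\<phi> y) v) = mp (T N) (\<phi> x) (\<phi> y) (f (\<phi> x) v)"
        using f(1) \<phi>s[OF xy] unfolding is_hom_def by fast
      then show ?thesis using v g\<phi>[OF F(1)] g\<phi>[OF F(2)] by (simp add: T_def)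
    qed
    ultimately show ?thesis unfolding isomorphic_modules_def is_hom_def by (intro exI[of _ "\<lambda>x. f (\<phi> x)"]) auto
  qed
  obtain C and \<kappa> :: "('c, 'b) poset_rep \<Rightarrow> ('c \<times> nat) set \<times> ('c \<times> 'c \<times> nat \<times> nat \<times> 'k) set"
    where C: "finite C" "\<And>M. sp_indec s M \<Longrightarrow> \<kappa> M \<in> C"
      "\<And>M N. sp_indec s M \<Longrightarrow> sp_indec s N \<Longrightarrow> \<kappa> M = \<kappa> N \<Longrightarrow> isomorphic_modules scale s M N"
    using fin unfolding finitely_coded_def by metis
  let ?A = "ind_sp scale r"
  let ?R = "{(M, N). M \<in> ?A \<and> N \<in> ?A \<and> isomorphic_modules scale r M N}"
  have m: "is_module scale r M" if "M \<in> ?A" for M using that by (auto simp: ind_sp_def socle_projective_def)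
  have "finite (?A // ?R)"
  proof (rule finite_quotient_of_invariant[of ?A "\<lambda>M. \<kappa> (T M)" C ?R])
    show "\<kappa> (T M) \<in> C" if "M \<in> ?A" for M using C(2) T that by blast
    show "sym ?R" using isomorphic_modules_sym m by (auto simp: sym_def)
    show "trans ?R" using isomorphic_modules_trans unfolding trans_def by blast
    show "(M, N) \<in> ?R" if "M \<in> ?A" "N \<in> ?A" "\<kappa> (T M) = \<kappa> (T N)" for M N
      using pull C(3) T that by blast
  qed (use C(1) in auto)
  then show ?thesis by (simp add: finite_sp_type_def)
qed

section \<open>Stars, and stars with one further arrow\<close>

text \<open>An arm with a single arrow contributes one subspace, an image or a kernel.\<close>

lemma short_arm_flag:
  assumes "is_rep X E V h" "is_arm X E v zs" "length zs \<le> 2"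
  obtains A where "subspace A" "A \<subseteq> V v" "arm_flag E V h zs \<subseteq> {A}"
proof -
  have v: "subspace (V v)"
  proof -
    have "v \<in> X" using assms(2) by (cases zs) (auto simp: is_arm_def)
    then show ?thesis using is_repD(1)[OF assms(1)] findim_subspace by blast
  qed
  consider "zs = [v]" | x where "zs = [v, x]"
    using assms(2,3) by (cases zs; cases "tl zs") (auto simp: is_arm_def)
  then show ?thesis
  proof cases
    case 1
    then show ?thesis using that[of "{0}"] v subspace_0 by auto
  next
    case 2
    let ?A = "if (x, v) \<in> E then h x v ` V x else {w \<in> V v. h v x w = 0}"
    have "arm_flag E V h zs = {?A}" using 2 by auto
    moreover have "subspace ?A \<and> ?A \<subseteq> V v"
      using arm_flag_props[OF assms(1), of zs] assms(2) calculation by (auto simp: is_arm_def 2)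
    ultimately show ?thesis using that[of ?A] by blast
  qed
qed

text \<open>The case of \<open>fork_frames\<close> in which \<open>\<T>\<close> is empty and \<open>L\<close> is zero: the long arm gives the chain
  \<open>\<X>\<close> and the short arms give \<open>N\<close> and \<open>K\<close>.\<close>

lemma blocks_of_short_arms:
  assumes rep: "is_rep X E V h" "asym E"
    and arms: "is_arm X E v zs1" "is_arm X E v zs2" "is_arm X E v zs3" "set zs1 \<union> set zs2 \<union> set zs3 = X"
    and disj: "set zs1 \<inter> set zs2 = {v}" "set zs1 \<inter> set zs3 = {v}" "set zs2 \<inter> set zs3 = {v}"
    and len: "length zs2 \<le> 2" "length zs3 \<le> 2"
    and E: "\<And>a b. (a, b) \<in> E \<Longrightarrow> adjacent zs1 a b \<or> adjacent zs2 a b \<or> adjacent zs3 a b"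
  shows "\<exists>e \<beta>. blocks X E V h e \<beta>"
proof -
  obtain N where N: "subspace N" "N \<subseteq> V v" "arm_flag E V h zs2 \<subseteq> {N}"
    by (rule short_arm_flag[OF rep(1) arms(2) len(1)]) (rule that)
  obtain K where K: "subspace K" "K \<subseteq> V v" "arm_flag E V h zs3 \<subseteq> {K}"
    by (rule short_arm_flag[OF rep(1) arms(3) len(2)]) (rule that)
  have vX: "v \<in> X" using disj arms by auto
  have fl: "finite (arm_flag E V h zs1)" "\<And>F. F \<in> arm_flag E V h zs1 \<Longrightarrow> subspace F \<and> F \<subseteq> V v"
    "\<And>F G. F \<in> arm_flag E V h zs1 \<Longrightarrow> G \<in> arm_flag E V h zs1 \<Longrightarrow> F \<subseteq> G \<or> G \<subseteq> F"
    using arm_flag_props[OF rep(1), of zs1] arms(1) by (auto simp: is_arm_def)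
  have Vv: "findim (V v)" using is_repD(1)[OF rep(1) vX] .
  have "\<exists>e e' I \<sigma>. frame e (V v) \<and> frame e' (V v) \<and> (\<forall>S\<in>{} \<union> arm_flag E V h zs1 \<union> {N, {0}}. adapted e S) \<and> adapted e' K \<and>
    finite I \<and> inj_on \<sigma> I \<and> (\<forall>i\<in>I. \<sigma> i \<notin> I \<and> e' i = e i + e (\<sigma> i)) \<and> (\<forall>i. i \<notin> I \<longrightarrow> e' i = e i)"
  proof (rule fork_frames[OF Vv])
    show "subspace S \<and> S \<subseteq> V v" if "S \<in> {} \<union> arm_flag E V h zs1 \<union> {N, {0}, K}" for S
      using that fl(2)[of S] N K subspace_0[OF findim_subspace[OF Vv]] by auto
    show "{0} \<subseteq> G" if "G \<in> arm_flag E V h zs1" for G using fl(2)[OF that] subspace_0 by auto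
  qed (use fl in auto)
  then obtain e e' I \<sigma> where ee: "frame e (V v)" "frame e' (V v)"
    "\<forall>S\<in>{} \<union> arm_flag E V h zs1 \<union> {N, {0}}. adapted e S" "adapted e' K"
    "finite I" "inj_on \<sigma> I" "\<forall>i\<in>I. \<sigma> i \<notin> I \<and> e' i = e i + e (\<sigma> i)" "\<forall>i. i \<notin> I \<longrightarrow> e' i = e i"
    by (elim exE conjE) (rule that)
  have "\<exists>f. f v = e \<and> (\<forall>x\<in>set zs1 \<union> set zs2 \<union> set zs3. frame (f x) (V x)) \<and>
    (\<forall>a b. adjacent zs1 a b \<or> adjacent zs2 a b \<longrightarrow> follows E h f a b) \<and>
    (\<forall>a b. adjacent zs3 a b \<longrightarrow> follows E h (f(v := e')) a b)"
    by (rule star_frames[OF rep arms(1-3) disj ee(1) _ ee(2)]) (use ee(3,4) N(3) K(3) in auto)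
  then obtain f where f: "f v = e" "\<And>x. x \<in> X \<Longrightarrow> frame (f x) (V x)"
    "\<And>a b. adjacent zs1 a b \<or> adjacent zs2 a b \<Longrightarrow> follows E h f a b"
    "\<And>a b. adjacent zs3 a b \<Longrightarrow> follows E h (f(v := e')) a b" using arms(4) by auto
  have "\<exists>\<beta>. blocks X E V h f \<beta>"
  proof (rule star_blocks[OF rep f(2) ee(2,6)])
    show "(\<forall>i. h a b (f a i) = f b i \<or> h a b (f a i) = 0) \<or> follows E h (f(v := e')) a b" if "(a, b) \<in> E" for a b
      using E[OF that] f(3)[of a b] f(4)[of a b] that unfolding follows_def by blast
  qed (use ee f(1) in auto)
  then show ?thesis by blast
qed

text \<open>Only images occur in the flag, and the image of the outermost space is contained in all of them.\<close>

lemma arm_flag_toward: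
  assumes comp: "\<And>a b d u. (a, b) \<in> r \<Longrightarrow> (b, d) \<in> r \<Longrightarrow> u \<in> V a \<Longrightarrow> h b d (h a b u) = h a d u"
    and r: "trans r" "\<And>x. x \<in> set (y # ws) \<Longrightarrow> (x, x) \<in> r" and E: "E \<subseteq> r"
    and im: "\<And>a b. (a, b) \<in> r \<Longrightarrow> h a b ` V a \<subseteq> V b"
    and ws: "successively (\<lambda>x y. (y, x) \<in> E) (y # ws)"
  shows "(last (y # ws), y) \<in> r \<and> (\<forall>F\<in>arm_flag E V h (y # ws). h (last (y # ws)) y ` V (last (y # ws)) \<subseteq> F)"
  using ws r(2)
proof (induction ws arbitrary: y)
  case (Cons x ws)
  let ?c = "last (x # ws)"
  have IH: "(?c, x) \<in> r" "\<And>F. F \<in> arm_flag E V h (x # ws) \<Longrightarrow> h ?c x ` V ?c \<subseteq> F"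
    using Cons.IH[of x] Cons.prems by auto
  have xy: "(x, y) \<in> E" "(x, y) \<in> r" using Cons.prems E by auto
  have "h ?c x ` V ?c \<subseteq> F" if "F \<in> insert (V x) (arm_flag E V h (x # ws))" for F
    using that IH(2)[of F] im[OF IH(1)] by blast
  then have "h x y ` h ?c x ` V ?c \<subseteq> h x y ` F" if "F \<in> insert (V x) (arm_flag E V h (x # ws))" for F
    using that by (meson image_mono)
  moreover have "h ?c y ` V ?c = h x y ` h ?c x ` V ?c"
    using comp[OF IH(1) xy(2)] by (auto simp: image_image)
  moreover have "arm_flag E V h (y # x # ws) = (\<lambda>F. h x y ` F) ` insert (V x) (arm_flag E V h (x # ws))"
    using xy(1) by simp
  ultimately have "h ?c y ` V ?c \<subseteq> F" if "F \<in> arm_flag E V h (y # x # ws)" for F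
    using that by (metis imageE)
  moreover have "(?c, y) \<in> r" using IH(1) xy(2) r(1) by (auto dest: transD)
  ultimately show ?case by simp
qed simp

text \<open>An arm that descends from \<open>x\<close> to a sink \<open>z\<close> and then ascends to \<open>c\<close>. Since the maps into \<open>V z\<close>
  are injective beyond \<open>x\<close>, a space of the flag either is the kernel of \<open>V x \<rightarrow> V z\<close>, or it is
  pulled back from a space at \<open>z\<close> and contains the preimage of the image of \<open>V c\<close>.\<close>

lemma arm_flag_through_sink:
  assumes comp: "\<And>a b d u. (a, b) \<in> r \<Longrightarrow> (b, d) \<in> r \<Longrightarrow> u \<in> V a \<Longrightarrow> h b d (h a b u) = h a d u"
    and r: "trans r" "\<And>x. x \<in> set (us @ z # ws) \<Longrightarrow> (x, x) \<in> r" and E: "E \<subseteq> r" "asym E"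
    and im: "\<And>a b. (a, b) \<in> r \<Longrightarrow> h a b ` V a \<subseteq> V b"
    and lin: "\<And>a b. (a, b) \<in> r \<Longrightarrow> h a b 0 = 0"
    and id: "\<And>u. u \<in> V z \<Longrightarrow> h z z u = u"
    and inj: "\<And>y u. y \<in> set (tl (us @ [z])) \<Longrightarrow> u \<in> V y \<Longrightarrow> h y z u = 0 \<Longrightarrow> u = 0"
    and ws: "successively (\<lambda>x y. (y, x) \<in> E) (z # ws)" and us: "successively (\<lambda>x y. (x, y) \<in> E) (us @ [z])"
    and c: "c = last (z # ws)" and x: "x = hd (us @ [z])"
  shows "(x, z) \<in> r \<and> (\<forall>F\<in>arm_flag E V h (us @ z # ws).
      F = {a \<in> V x. h x z a = 0} \<or> {a \<in> V x. h x z a \<in> h c z ` V c} \<subseteq> F)"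
  using us r(2) inj x
proof (induction us arbitrary: x)
  case Nil
  have "(last (z # ws), z) \<in> r \<and> (\<forall>F\<in>arm_flag E V h (z # ws). h (last (z # ws)) z ` V (last (z # ws)) \<subseteq> F)"
    by (rule arm_flag_toward[where r = r, OF _ r(1) _ E(1) im ws]) (use comp Nil.prems(2) in auto)
  then have F: "\<forall>F\<in>arm_flag E V h (z # ws). h c z ` V c \<subseteq> F" using c by simp
  have "{a \<in> V z. h z z a \<in> h c z ` V c} \<subseteq> F" if "F \<in> arm_flag E V h (z # ws)" for F
  proof
    fix a assume a: "a \<in> {a \<in> V z. h z z a \<in> h c z ` V c}"
    then have "a \<in> V z" "h z z a \<in> h c z ` V c" by simp_all
    then have "a \<in> h c z ` V c" using id[of a] by simp
    then show "a \<in> F" using F that by blast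
  qed
  moreover have "(z, z) \<in> r" using Nil.prems(2) by simp
  ultimately show ?case using Nil.prems(4) by simp
next
  case (Cons x' us)
  define y where "y = hd (us @ [z])"
  have x'[simp]: "x' = x" using Cons.prems by simp
  have split: "us @ z # ws = y # tl (us @ z # ws)" by (cases us) (auto simp: y_def)
  have xy: "(x, y) \<in> E" using Cons.prems(1) by (cases us) (auto simp: y_def)
  then have xyr: "(x, y) \<in> r" and nyx: "(y, x) \<notin> E" using E by (auto dest: asymD)
  have IH: "(y, z) \<in> r" "\<And>F. F \<in> arm_flag E V h (us @ z # ws) \<Longrightarrow>
      F = {a \<in> V y. h y z a = 0} \<or> {a \<in> V y. h y z a \<in> h c z ` V c} \<subseteq> F"
  proof -
    have "successively (\<lambda>x y. (x, y) \<in> E) (us @ [z])" using Cons.prems(1) by (cases us) auto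
    moreover have "y \<in> set (tl (us @ [z])) \<Longrightarrow> u \<in> V y \<Longrightarrow> h y z u = 0 \<Longrightarrow> u = 0" for y u
      using Cons.prems(3)[of y u] by (cases us) auto
    ultimately show "(y, z) \<in> r" "\<And>F. F \<in> arm_flag E V h (us @ z # ws) \<Longrightarrow>
      F = {a \<in> V y. h y z a = 0} \<or> {a \<in> V y. h y z a \<in> h c z ` V c} \<subseteq> F"
      using Cons.IH[of y] Cons.prems(2) by (auto simp: y_def)
  qed
  have yt: "y \<in> set (tl ((x' # us) @ [z]))" by (cases us) (auto simp: y_def)
  have comp': "h y z (h x y a) = h x z a" if "a \<in> V x" for a using comp[OF xyr IH(1) that] .
  have hy: "h x y a \<in> V y" if "a \<in> V x" for a using im[OF xyr] that by blast
  have "F = {a \<in> V x. h x z a = 0} \<or> {a \<in> V x. h x z a \<in> h c z ` V c} \<subseteq> F"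
    if F: "F \<in> arm_flag E V h ((x' # us) @ z # ws)" for F
  proof -
    have "arm_flag E V h (x # y # tl (us @ z # ws)) =
        (\<lambda>F. {a \<in> V x. h x y a \<in> F}) ` insert {0} (arm_flag E V h (y # tl (us @ z # ws)))"
      using nyx by simp
    then have "F \<in> (\<lambda>F. {a \<in> V x. h x y a \<in> F}) ` insert {0} (arm_flag E V h (us @ z # ws))"
      using F by (simp only: split[symmetric] append_Cons x')
    then obtain G where G: "G \<in> insert {0} (arm_flag E V h (us @ z # ws))" "F = {a \<in> V x. h x y a \<in> G}" by blast
    have ker: "{a \<in> V x. h x y a = 0} = {a \<in> V x. h x z a = 0}"
      using comp' hy Cons.prems(3)[OF yt] lin[OF IH(1)] by (auto; metis)
    consider "G = {0}" | "G = {a \<in> V y. h y z a = 0}" | "{a \<in> V y. h y z a \<in> h c z ` V c} \<subseteq> G"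
      using G(1) IH(2)[of G] by blast
    then show ?thesis
    proof cases
      case 1
      then show ?thesis using G(2) ker by simp
    next
      case 2
      then have "F = {a \<in> V x. h x z a = 0}" using G(2) comp' hy by auto
      then show ?thesis by simp
    next
      case 3
      then have "{a \<in> V x. h x z a \<in> h c z ` V c} \<subseteq> F" using G(2) comp' hy by auto
      then show ?thesis by simp
    qed
  qed
  moreover have "(x, z) \<in> r" using xyr IH(1) r(1) by (auto dest: transD)
  ultimately show ?case by simp
qed

lemma successively_hd_last:
  assumes "successively P zs" "zs \<noteq> []" "\<And>x. x \<in> set zs \<Longrightarrow> P x x" "\<And>x y z. P x y \<Longrightarrow> P y z \<Longrightarrow> P x z"
  shows "P (hd zs) (last zs)"
  using assms(1-3)
proof (induction zs rule: induct_list012)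
  case (3 x y zs)
  then have "P x y" "P y (last (y # zs))" by auto
  then have "P x (last (y # zs))" by (rule assms(4))
  then show ?case by simp
qed auto

text \<open>Here \<open>E\<close> consists of the arms \<open>v \<leftarrow> q \<leftarrow> c\<close>, \<open>v \<rightarrow> \<dots> \<rightarrow> z \<leftarrow> \<dots> \<leftarrow> c'\<close> and \<open>v \<rightarrow> p\<close>, the first one
  continuing beyond \<open>c\<close>, and of the arrow \<open>c \<rightarrow> c'\<close>, which closes a cycle. Without this arrow it
  is a star.

  In \<open>V v\<close> let \<open>L\<close> and \<open>K\<close> be the kernels of the maps to \<open>V z\<close> and to \<open>V p\<close>, which meet
  trivially, and let \<open>D\<close> be the preimage of the image of \<open>V c'\<close> in \<open>V z\<close>. The flag of the second
  arm consists of \<open>L\<close> and of spaces above \<open>D\<close>. The flag of the first arm consists of \<open>N\<close>, the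
  image of \<open>V q\<close>, and of spaces that come from \<open>V c\<close>; the latter lie in \<open>D\<close>, because the two
  paths from \<open>c\<close> to \<open>z\<close> compose to the same map. This is the configuration of \<open>fork_frames\<close>. The
  resulting frames also respect \<open>c \<rightarrow> c'\<close>: a frame vector at \<open>c\<close> goes to the frame vector at \<open>z\<close>
  with the same label or to zero, and \<open>V c'\<close> embeds into \<open>V z\<close> compatibly with the labels.\<close>

lemma blocks_of_cycle:
  assumes rep: "is_rep X E V h" "asym E"
    and comp: "\<And>a b d u. (a, b) \<in> r \<Longrightarrow> (b, d) \<in> r \<Longrightarrow> u \<in> V a \<Longrightarrow> h b d (h a b u) = h a d u"
    and r: "trans r" "\<And>x. x \<in> X \<Longrightarrow> (x, x) \<in> r" "E \<subseteq> r"
    and h: "\<And>a b. (a, b) \<in> r \<Longrightarrow> lin (h a b)" "\<And>a b. (a, b) \<in> r \<Longrightarrow> h a b ` V a \<subseteq> V b"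
      "\<And>x u. x \<in> X \<Longrightarrow> u \<in> V x \<Longrightarrow> h x x u = u"
    and arms: "is_arm X (E - {(c, c')}) v (v # q # c # ys)" "is_arm X (E - {(c, c')}) v (us @ z # ws)"
      "is_arm X (E - {(c, c')}) v [v, p]"
      "set (v # q # c # ys) \<union> set (us @ z # ws) \<union> set [v, p] = X"
    and disj: "set (v # q # c # ys) \<inter> set (us @ z # ws) = {v}" "set (v # q # c # ys) \<inter> set [v, p] = {v}"
      "set (us @ z # ws) \<inter> set [v, p] = {v}"
    and arrows: "(c, q) \<in> E" "(q, v) \<in> E" "(v, p) \<in> E" "(c, c') \<in> E" "us \<noteq> []" "c' = last (z # ws)"
      "successively (\<lambda>x y. (y, x) \<in> E) (z # ws)" "successively (\<lambda>x y. (x, y) \<in> E) (us @ [z])"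
    and inj: "\<And>y u. y \<in> set (tl (us @ z # ws)) \<Longrightarrow> u \<in> V y \<Longrightarrow> h y z u = 0 \<Longrightarrow> u = 0"
    and kernel: "\<And>u. u \<in> V v \<Longrightarrow> h v p u = 0 \<Longrightarrow> h v z u = 0 \<Longrightarrow> u = 0"
    and E: "\<And>a b. (a, b) \<in> E \<Longrightarrow> (a, b) \<noteq> (c, c') \<Longrightarrow>
      adjacent (v # q # c # ys) a b \<or> adjacent (us @ z # ws) a b \<or> adjacent [v, p] a b"
  shows "\<exists>e \<beta>. blocks X E V h e \<beta>"
proof -
  let ?E = "E - {(c, c')}"
  let ?zs1 = "v # q # c # ys" and ?zs2 = "us @ z # ws" and ?zs3 = "[v, p]"
  have rep': "is_rep X ?E V h" "asym ?E" using rep by (auto simp: is_rep_def asym_on_def)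
  have vhd: "v = hd (us @ [z])" using arms(2) arrows(5) by (cases us) (auto simp: is_arm_def)
  have d1: "distinct ?zs1" and d2: "distinct ?zs2" using arms by (auto simp: is_arm_def)
  have X: "v \<in> X" "q \<in> X" "c \<in> X" "p \<in> X" "z \<in> X" "c' \<in> X" using arms(4) arrows(6) by auto
  have cs: "c' \<in> set (z # ws)" unfolding arrows(6) by (rule last_in_set) simp
  then have c'2: "c' \<in> set ?zs2" by auto
  have out: "x \<notin> set ?zs2" if "x \<in> set ?zs1" "x \<noteq> v" for x
  proof
    assume "x \<in> set ?zs2"
    then have "x \<in> set ?zs1 \<inter> set ?zs2" using that(1) by blast
    then show False using disj(1) that(2) by blast
  qed
  have c2: "c \<notin> set ?zs2" "q \<notin> set ?zs2" using out[of c] out[of q] d1 by auto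
  have znv: "c' \<noteq> v" using vhd d2 arrows(5) cs by (cases us) auto
  have "c' \<noteq> q" using c'2 c2 by blast
  then have E1: "(c, q) \<in> ?E" "(q, v) \<in> ?E" "(v, p) \<in> ?E" using arrows(1-3) d1 by auto
  have ws': "successively (\<lambda>x y. (y, x) \<in> ?E) (z # ws)"
    by (rule successively_cong[THEN iffD1, OF _ refl arrows(7)]) (use c2 in auto)
  have us': "successively (\<lambda>x y. (x, y) \<in> ?E) (us @ [z])"
    by (rule successively_cong[THEN iffD1, OF _ refl arrows(8)]) (use c2 in auto)
  have Er: "?E \<subseteq> r" using r(3) by auto
  have Vs: "\<And>x. x \<in> X \<Longrightarrow> subspace (V x)" using is_repD(1)[OF rep(1)] findim_subspace by blast
  have h0: "h a b 0 = 0" if "(a, b) \<in> r" for a b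
  proof -
    interpret h: Vector_Spaces.linear scale scale "h a b" using h(1)[OF that] .
    show ?thesis by (rule h.zero)
  qed
  define L where "L = {a \<in> V v. h v z a = 0}"
  define D where "D = {a \<in> V v. h v z a \<in> h c' z ` V c'}"
  define K where "K = {a \<in> V v. h v p a = 0}"
  define \<G> where "\<G> = arm_flag ?E V h ?zs2"
  define \<X> where "\<X> = {G \<in> \<G>. D \<subseteq> G}"
  have vz: "(v, z) \<in> r" and \<G>: "\<And>G. G \<in> \<G> \<Longrightarrow> G = L \<or> D \<subseteq> G"
  proof -
    have "(v, z) \<in> r \<and> (\<forall>F\<in>arm_flag ?E V h (us @ z # ws).
      F = {a \<in> V v. h v z a = 0} \<or> {a \<in> V v. h v z a \<in> h c' z ` V c'} \<subseteq> F)"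
    proof (rule arm_flag_through_sink[where r = r, OF comp r(1) _ Er rep'(2) h(2) h0 _ _ ws' us' arrows(6) vhd])
      show "(x, x) \<in> r" if "x \<in> set (us @ z # ws)" for x using r(2)[of x] that arms(4) by auto
      show "h z z u = u" if "u \<in> V z" for u using h(3)[OF X(5) that] .
      show "u = 0" if "y \<in> set (tl (us @ [z]))" "u \<in> V y" "h y z u = 0" for y u
        using inj[of y u] that by (cases us) auto
    qed
    then show "(v, z) \<in> r" "\<And>G. G \<in> \<G> \<Longrightarrow> G = L \<or> D \<subseteq> G" unfolding L_def D_def \<G>_def by blast+
  qed
  have "(last (z # ws), z) \<in> r \<and> (\<forall>F\<in>arm_flag ?E V h (z # ws). h (last (z # ws)) z ` V (last (z # ws)) \<subseteq> F)"
    by (rule arm_flag_toward[where r = r, OF _ r(1) _ Er h(2) ws']) (use comp r(2) arms(4) in auto)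
  then have c'z: "(c', z) \<in> r" using arrows(6) by simp
  define \<T> where "\<T> = (\<lambda>F. h q v ` F) ` arm_flag ?E V h (q # c # ys)"
  define N where "N = h q v ` V q"
  have cqr: "(c, q) \<in> r" "(q, v) \<in> r" "(v, p) \<in> r" "(c, c') \<in> r" using arrows r(3) by auto
  have fl1: "arm_flag ?E V h ?zs1 = insert N \<T>" using E1 by (simp add: \<T>_def N_def)
  have props: "finite (arm_flag ?E V h zs)" "\<And>F. F \<in> arm_flag ?E V h zs \<Longrightarrow> subspace F \<and> F \<subseteq> V v"
    "\<And>F G. F \<in> arm_flag ?E V h zs \<Longrightarrow> G \<in> arm_flag ?E V h zs \<Longrightarrow> F \<subseteq> G \<or> G \<subseteq> F"
    if "is_arm X ?E v zs" for zs
    using arm_flag_props[OF rep'(1), of zs] that by (auto simp: is_arm_def)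
  note p1 = props[OF arms(1)] and p2 = props[OF arms(2)] and p3 = props[OF arms(3)]
  have T: "T \<subseteq> N \<and> T \<subseteq> D" if mem: "T \<in> \<T>" for T
  proof -
    obtain F where F: "T = h q v ` F" "F \<in> arm_flag ?E V h (q # c # ys)"
      using mem unfolding \<T>_def by blast
    obtain F' where F': "F = h c q ` F'" "F' \<in> insert (V c) (arm_flag ?E V h (c # ys))"
    proof -
      have "F \<in> (\<lambda>F. h c q ` F) ` insert (V c) (arm_flag ?E V h (c # ys))" using F(2) E1(1) by simp
      then show ?thesis using that by blast
    qed
    have "F' \<subseteq> V c"
    proof -
      have "is_arm X ?E c (c # ys)" using arms(1) by (auto simp: is_arm_def)
      then have "F \<in> arm_flag ?E V h (c # ys) \<Longrightarrow> F \<subseteq> V c" for F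
        using arm_flag_props[OF rep'(1), of "c # ys"] by (auto simp: is_arm_def)
      then show ?thesis using F'(2) by blast
    qed
    then have T: "T \<subseteq> h q v ` h c q ` V c" using F(1) F'(1) by blast
    have "h q v (h c q a) \<in> N \<and> h q v (h c q a) \<in> D" if a: "a \<in> V c" for a
    proof -
      have 1: "h c q a \<in> V q" using h(2)[OF cqr(1)] a by blast
      then have 2: "h q v (h c q a) \<in> V v" using h(2)[OF cqr(2)] by blast
      have cv: "(c, v) \<in> r" using cqr r(1) by (auto dest: transD)
      have "h v z (h q v (h c q a)) = h c z a"
        using comp[OF cqr(1,2) a] comp[OF cv vz a] by simp
      also have "\<dots> = h c' z (h c c' a)" using comp[OF cqr(4) c'z a] by simp
      finally have "h v z (h q v (h c q a)) \<in> h c' z ` V c'" using h(2)[OF cqr(4)] a by blast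
      then show ?thesis using 1 2 by (auto simp: N_def D_def)
    qed
    then show ?thesis using T by blast
  qed
  have LD: "L \<subseteq> D"
  proof -
    have "0 \<in> h c' z ` V c'" using h0[OF c'z] subspace_0[OF Vs[OF X(6)]] by (auto intro: image_eqI[of _ _ 0])
    then show ?thesis by (auto simp: L_def D_def)
  qed
  have Lsub: "subspace L"
  proof -
    interpret h: Vector_Spaces.linear scale scale "h v z" using h(1)[OF vz] .
    show ?thesis using Vs[OF X(1)] by (auto simp: L_def subspace_def h.add h.scale h.zero)
  qed
  have npv: "(p, v) \<notin> ?E" using E1(3) rep'(2) by (auto dest: asymD)
  have K: "arm_flag ?E V h ?zs3 = {K}" using npv by (auto simp: K_def)
  have Ksub: "subspace K" using p3(2)[of K] K by simp
  have Vv: "findim (V v)" using is_repD(1)[OF rep(1) X(1)] .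
  have \<T>flag: "\<And>T. T \<in> insert N \<T> \<Longrightarrow> T \<in> arm_flag ?E V h ?zs1" using fl1 by simp
  have "\<exists>e e' I \<sigma>. frame e (V v) \<and> frame e' (V v) \<and> (\<forall>S\<in>\<T> \<union> \<X> \<union> {N, L}. adapted e S) \<and> adapted e' K \<and>
    finite I \<and> inj_on \<sigma> I \<and> (\<forall>i\<in>I. \<sigma> i \<notin> I \<and> e' i = e i + e (\<sigma> i)) \<and> (\<forall>i. i \<notin> I \<longrightarrow> e' i = e i)"
  proof (rule fork_frames[OF Vv])
    show "finite \<T>" using p1(1) fl1 by simp
    show "finite \<X>" using p2(1) by (simp add: \<X>_def \<G>_def)
    show "subspace S \<and> S \<subseteq> V v" if "S \<in> \<T> \<union> \<X> \<union> {N, L, K}" for S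
    proof -
      have "S \<in> insert N \<T> \<or> S \<in> \<G> \<or> S = L \<or> S = K" using that by (auto simp: \<X>_def)
      then show ?thesis
      proof (elim disjE)
        assume "S \<in> insert N \<T>" then show ?thesis using p1(2) \<T>flag by blast
      next
        assume "S \<in> \<G>" then show ?thesis using p2(2) by (simp add: \<G>_def)
      next
        assume "S = L" then show ?thesis using Lsub by (auto simp: L_def)
      next
        assume "S = K" then show ?thesis using Ksub by (auto simp: K_def)
      qed
    qed
    show "F \<subseteq> G \<or> G \<subseteq> F" if "F \<in> \<T>" "G \<in> \<T>" for F G using p1(3) \<T>flag that by blast
    show "F \<subseteq> G \<or> G \<subseteq> F" if "F \<in> \<X>" "G \<in> \<X>" for F G using p2(3) that by (simp add: \<X>_def \<G>_def)
    show "T \<subseteq> N" if "T \<in> \<T>" for T using T[OF that] by blast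
    show "T \<subseteq> G" if "T \<in> \<T>" "G \<in> \<X>" for T G using T[OF that(1)] that(2) by (auto simp: \<X>_def)
    show "L \<subseteq> G" if "G \<in> \<X>" for G using LD that by (auto simp: \<X>_def)
    show "L \<inter> K \<subseteq> {0}" using kernel by (auto simp: L_def K_def)
  qed
  then obtain e e' I \<sigma> where ee: "frame e (V v)" "frame e' (V v)"
    "\<forall>S\<in>\<T> \<union> \<X> \<union> {N, L}. adapted e S" "adapted e' K"
    "finite I" "inj_on \<sigma> I" "\<forall>i\<in>I. \<sigma> i \<notin> I \<and> e' i = e i + e (\<sigma> i)" "\<forall>i. i \<notin> I \<longrightarrow> e' i = e i"
    by (elim exE conjE) (rule that)
  have "\<exists>f. f v = e \<and> (\<forall>x\<in>set ?zs1 \<union> set ?zs2 \<union> set ?zs3. frame (f x) (V x)) \<and>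
    (\<forall>a b. adjacent ?zs1 a b \<or> adjacent ?zs2 a b \<longrightarrow> follows ?E h f a b) \<and>
    (\<forall>a b. adjacent ?zs3 a b \<longrightarrow> follows ?E h (f(v := e')) a b)"
  proof (rule star_frames[OF rep' arms(1-3) disj ee(1) _ ee(2)])
    show "adapted e F" if "F \<in> arm_flag ?E V h ?zs1 \<union> arm_flag ?E V h ?zs2" for F
    proof -
      have "F \<in> \<T> \<union> \<X> \<union> {N, L}" using that fl1 \<G>[of F] unfolding \<X>_def \<G>_def by blast
      then show ?thesis using ee(3) by blast
    qed
    show "adapted e' F" if "F \<in> arm_flag ?E V h ?zs3" for F using that K ee(4) by simp
  qed
  then obtain f where f: "f v = e" "\<And>x. x \<in> X \<Longrightarrow> frame (f x) (V x)"
    "\<And>a b. adjacent ?zs1 a b \<or> adjacent ?zs2 a b \<Longrightarrow> follows ?E h f a b"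
    "\<And>a b. adjacent ?zs3 a b \<Longrightarrow> follows ?E h (f(v := e')) a b"
    unfolding arms(4)[symmetric] by blast
  define Fl where "Fl a b \<longleftrightarrow> (a, b) \<in> r \<and> a \<in> X \<and> b \<in> X \<and> (\<forall>i. h a b (f a i) = f b i \<or> h a b (f a i) = 0)" for a b
  have Fl_refl: "Fl x x" if "x \<in> X" for x
    using h(3)[OF that frame_in[OF f(2)[OF that]]] r(2)[OF that] that by (simp add: Fl_def)
  have Fl_trans: "Fl a d" if "Fl a b" "Fl b d" for a b d
  proof -
    have ab: "(a, b) \<in> r" "(b, d) \<in> r" "a \<in> X" "d \<in> X" using that by (auto simp: Fl_def)
    have "h a d (f a i) = f d i \<or> h a d (f a i) = 0" for i
      using comp[OF ab(1,2) frame_in[OF f(2)[OF ab(3)]], of i] that h0[OF ab(2)] unfolding Fl_def by metis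
    moreover have "(a, d) \<in> r" using ab r(1) by (auto dest: transD)
    ultimately show ?thesis using ab by (simp add: Fl_def)
  qed
  have Fl_adj: "Fl a b" if "(a, b) \<in> ?E" "adjacent ?zs1 a b \<or> adjacent ?zs2 a b" for a b
  proof -
    have "a \<in> X" "b \<in> X" using rep(1) that(1) by (auto simp: is_rep_def)
    then show ?thesis using f(3)[OF that(2)] that(1) Er by (auto simp: Fl_def follows_def)
  qed
  have vzFl: "Fl v z"
  proof -
    have "successively Fl (us @ [z])"
      unfolding successively_conv_nth
    proof (intro allI impI)
      fix i assume i: "Suc i < length (us @ [z])"
      let ?a = "(us @ [z]) ! i" and ?b = "(us @ [z]) ! Suc i"
      have e: "(?a, ?b) \<in> ?E" using us' i by (simp add: successively_conv_nth)
      have "us @ z # ws = (us @ [z]) @ ws" by simp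
      then have "adjacent ?zs2 ?a ?b"
        unfolding adjacent_def using i by (intro exI[of _ i]) (simp only: nth_append, simp)
      then show "Fl ?a ?b" using Fl_adj e by blast
    qed
    then have "Fl (hd (us @ [z])) (last (us @ [z]))"
      by (rule successively_hd_last) (use Fl_refl Fl_trans arms(4) in auto)
    then show ?thesis using vhd by simp
  qed
  have c'zFl: "Fl c' z"
  proof -
    have "successively (\<lambda>x y. Fl y x) (z # ws)"
      unfolding successively_conv_nth
    proof (intro allI impI)
      fix i assume i: "Suc i < length (z # ws)"
      let ?a = "(z # ws) ! i" and ?b = "(z # ws) ! Suc i"
      have e: "(?b, ?a) \<in> ?E" using ws' i by (simp add: successively_conv_nth)
      have "adjacent ?zs2 ?b ?a"
        unfolding adjacent_def using i by (intro exI[of _ "length us + i"]) (auto simp: nth_append insert_commute)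
      then show "Fl ?b ?a" using Fl_adj e by blast
    qed
    then have "Fl (last (z # ws)) (hd (z # ws))"
      by (rule successively_hd_last) (use Fl_refl Fl_trans arms(4) in auto)
    then show ?thesis using arrows(6) by simp
  qed
  have "adjacent ?zs1 c q" unfolding adjacent_def by (intro exI[of _ 1]) auto
  then have "Fl c q" using Fl_adj E1(1) by blast
  moreover have "adjacent ?zs1 q v" unfolding adjacent_def by (intro exI[of _ 0]) auto
  then have "Fl q v" using Fl_adj E1(2) by blast
  ultimately have czFl: "Fl c z" using vzFl Fl_trans by blast
  have c'v: "c' \<in> set (tl ?zs2)" using cs arrows(5) by (cases us) auto
  have inj': "a = b" if "a \<in> V c'" "b \<in> V c'" "h c' z a = h c' z b" for a b
  proof -
    interpret h: Vector_Spaces.linear scale scale "h c' z" using h(1)[OF c'z] .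
    have "a - b = 0"
      using inj[OF c'v, of "a - b"] that subspace_diff[OF Vs[OF X(6)]] by (simp add: h.diff)
    then show ?thesis by simp
  qed
  (* The removed arrow: comparison inside the space at z. *)
  have closing: "h c c' (f c i) = f c' i \<or> h c c' (f c i) = 0" for i
  proof -
    have fc: "f c i \<in> V c" by (rule frame_in[OF f(2)[OF X(3)]])
    define y where "y = h c c' (f c i)"
    have yV: "y \<in> V c'" using h(2)[OF cqr(4)] fc by (auto simp: y_def)
    have yz: "h c' z y = h c z (f c i)" using comp[OF cqr(4) c'z fc] by (simp add: y_def)
    show ?thesis
    proof (cases "h c z (f c i) = 0")
      case True
      then show ?thesis using inj[OF c'v yV] yz by (simp add: y_def)
    next
      case False
      then have fz: "h c z (f c i) = f z i" using czFl by (auto simp: Fl_def)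
      have fr: "frame (f c') (V c')" "frame (f z) (V z)" using f(2) X by auto
      interpret h: Vector_Spaces.linear scale scale "h c' z" using h(1)[OF c'z] .
      let ?J = "{j. h c' z (f c' j) = f z j \<and> f z j \<noteq> 0}"
      have "y \<in> span (range (f c'))" using yV fr(1) by (simp add: frame_def)
      then have "h c' z y \<in> span (h c' z ` range (f c'))" by (simp add: h.span_image)
      also have "\<dots> \<subseteq> span (insert 0 (f z ` ?J))"
      proof (rule span_mono, rule subsetI)
        fix w assume "w \<in> h c' z ` range (f c')"
        then obtain j where j: "w = h c' z (f c' j)" by blast
        moreover have "h c' z (f c' j) = f z j \<or> h c' z (f c' j) = 0" using c'zFl by (simp add: Fl_def)
        ultimately show "w \<in> insert 0 (f z ` ?J)" by (cases "w = 0") auto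
      qed
      finally have sp: "f z i \<in> span (f z ` ?J)" using yz fz by simp
      have "i \<in> ?J"
      proof (rule ccontr)
        assume ni: "i \<notin> ?J"
        have nz: "f z i \<noteq> 0" using False fz by simp
        have "f z ` ?J \<subseteq> f z ` {j. f z j \<noteq> 0} - {f z i}"
          using ni nz fr(2) by (auto simp: frame_def inj_on_def)
        then have "f z i \<in> span (f z ` {j. f z j \<noteq> 0} - {f z i})" using sp span_mono by blast
        then have "dependent (f z ` {j. f z j \<noteq> 0})" using nz unfolding dependent_def by blast
        then show False using fr(2) by (simp add: frame_def)
      qed
      then have "h c' z (f c' i) = h c' z y" using yz fz by simp
      then have "f c' i = y" using inj'[OF frame_in[OF fr(1)] yV] by simp
      then show ?thesis by (simp add: y_def)
    qed
  qed
  have "\<exists>\<beta>. blocks X E V h f \<beta>"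
  proof (rule star_blocks[OF rep f(2) ee(2,6)])
    show "(\<forall>i. h a b (f a i) = f b i \<or> h a b (f a i) = 0) \<or> follows E h (f(v := e')) a b" if ab: "(a, b) \<in> E" for a b
    proof (cases "(a, b) = (c, c')")
      case True
      then show ?thesis using closing by simp
    next
      case False
      then have abE: "(a, b) \<in> ?E" using ab by auto
      then show ?thesis using E[OF ab False] f(3)[of a b] f(4)[of a b] ab unfolding follows_def by blast
    qed
  qed (use ee f(1) in auto)
  then show ?thesis by blast
qed

end

section \<open>Alien arrows of a path\<close>

lemma rtrancl_quiver_path:
  assumes "(x, y) \<in> R\<^sup>*"
  shows "\<exists>p. quiver_path R x p y"
  using assms
proof (induction rule: converse_rtrancl_induct)
  case base
  then show ?case by (intro exI[of _ "[y]"]) (simp add: quiver_path_def)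
next
  case (step x z)
  then obtain p where p: "quiver_path R z p y" by blast
  then show ?case using step(1)
    by (intro exI[of _ "x # p"]) (cases p; auto simp: quiver_path_def)
qed

lemma quiver_path_mono: "quiver_path R x p y \<Longrightarrow> R \<subseteq> R' \<Longrightarrow> quiver_path R' x p y"
  unfolding quiver_path_def by (auto elim: successively_mono)

lemma dynkin_A_arrow:
  assumes "dynkin_A vs E" "(x, y) \<in> E"
  obtains i where "Suc i < length vs" "(x = vs ! i \<and> y = vs ! Suc i) \<or> (x = vs ! Suc i \<and> y = vs ! i)"
proof -
  have "{x, y} \<in> (\<lambda>(x, y). {x, y}) ` E" using assms(2) by (intro image_eqI[of _ _ "(x, y)"]) auto
  then have "{x, y} \<in> {{vs ! i, vs ! Suc i} | i. Suc i < length vs}"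
    using assms(1) by (simp add: dynkin_A_def orientation_of_def)
  then show ?thesis using that by (auto simp: doubleton_eq_iff)
qed

lemma dynkin_A_asym: "dynkin_A vs E \<Longrightarrow> (x, y) \<in> E \<Longrightarrow> (y, x) \<notin> E"
  by (auto simp: dynkin_A_def orientation_of_def dest: asymD)

definition up_run :: "'v list \<Rightarrow> 'v rel \<Rightarrow> nat \<Rightarrow> nat \<Rightarrow> bool" where
  "up_run vs E i k \<longleftrightarrow> (\<forall>l. i \<le> l \<and> l < k \<longrightarrow> (vs ! l, vs ! Suc l) \<in> E)"

definition down_run :: "'v list \<Rightarrow> 'v rel \<Rightarrow> nat \<Rightarrow> nat \<Rightarrow> bool" where
  "down_run vs E k i \<longleftrightarrow> (\<forall>l. k \<le> l \<and> l < i \<longrightarrow> (vs ! Suc l, vs ! l) \<in> E)"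

lemma up_run_path: "up_run vs E i k \<Longrightarrow> i \<le> k \<Longrightarrow> (vs ! i, vs ! k) \<in> E\<^sup>*"
proof (induction k)
  case (Suc k)
  show ?case
  proof (cases "i = Suc k")
    case False
    then have "(vs ! i, vs ! k) \<in> E\<^sup>*" using Suc by (auto simp: up_run_def)
    moreover have "(vs ! k, vs ! Suc k) \<in> E" using Suc.prems False by (auto simp: up_run_def)
    ultimately show ?thesis by (rule rtrancl_into_rtrancl)
  qed simp
qed (simp add: up_run_def)

lemma down_run_path: "down_run vs E k i \<Longrightarrow> k \<le> i \<Longrightarrow> (vs ! i, vs ! k) \<in> E\<^sup>*"
proof (induction i)
  case (Suc i)
  show ?case
  proof (cases "k = Suc i")
    case False
    then have "(vs ! i, vs ! k) \<in> E\<^sup>*" using Suc by (auto simp: down_run_def)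
    moreover have "(vs ! Suc i, vs ! i) \<in> E" using Suc.prems False by (auto simp: down_run_def)
    ultimately show ?thesis by (meson converse_rtrancl_into_rtrancl)
  qed simp
qed (simp add: down_run_def)

text \<open>A directed path in an oriented line never turns back.\<close>

lemma path_is_run:
  assumes A: "dynkin_A vs E" and i: "i < length vs" and xy: "(vs ! i, y) \<in> E\<^sup>*"
  shows "\<exists>k<length vs. y = vs ! k \<and> ((i \<le> k \<and> up_run vs E i k) \<or> (k \<le> i \<and> down_run vs E k i))"
  using xy
proof (induction rule: rtrancl_induct)
  case base
  then show ?case using i by (intro exI[of _ i]) (auto simp: up_run_def)
next
  case (step y w)
  then obtain k where k: "k < length vs" "y = vs ! k"
    "(i \<le> k \<and> up_run vs E i k) \<or> (k \<le> i \<and> down_run vs E k i)" by blast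
  obtain l where l: "Suc l < length vs" "(y = vs ! l \<and> w = vs ! Suc l) \<or> (y = vs ! Suc l \<and> w = vs ! l)"
    by (rule dynkin_A_arrow[OF A step(2)]) (rule that)
  have dis: "distinct vs" using A by (simp add: dynkin_A_def)
  have nth: "a = b" if "vs ! a = vs ! b" "a < length vs" "b < length vs" for a b
    using that dis nth_eq_iff_index_eq by blast
  from l(2) show ?case
  proof
    assume yw: "y = vs ! l \<and> w = vs ! Suc l"
    then have kl: "k = l" using nth k l by (metis Suc_lessD)
    show ?thesis
    proof (cases "i \<le> k")
      case True
      have "up_run vs E i k"
      proof (cases "i = k")
        case True then show ?thesis by (auto simp: up_run_def)
      next
        case False then show ?thesis using True k(3) by auto
      qed
      then have "up_run vs E i (Suc k)"
        using step(2) yw kl by (auto simp: up_run_def less_Suc_eq)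
      then show ?thesis using l kl yw True by (intro exI[of _ "Suc k"]) auto
    next
      case False
      then have "(vs ! Suc k, vs ! k) \<in> E" using k(3) by (auto simp: down_run_def)
      then show ?thesis using step(2) yw kl dynkin_A_asym[OF A] by blast
    qed
  next
    assume yw: "y = vs ! Suc l \<and> w = vs ! l"
    then have kl: "k = Suc l" using nth k l by metis
    show ?thesis
    proof (cases "k \<le> i")
      case True
      have "down_run vs E k i"
      proof (cases "i = k")
        case True then show ?thesis by (auto simp: down_run_def)
      next
        case False then show ?thesis using True k(3) by auto
      qed
      then have "down_run vs E l i"
        using step(2) yw kl unfolding down_run_def by (metis Suc_leI le_neq_implies_less)
      then show ?thesis using l kl yw True by (intro exI[of _ l]) auto
    next
      case False
      then have "(vs ! l, vs ! Suc l) \<in> E" using k(3) kl by (auto simp: up_run_def)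
      then show ?thesis using step(2) yw dynkin_A_asym[OF A] by blast
    qed
  qed
qed

text \<open>The indices \<open>i\<close> and \<open>j\<close> lie on different sides of the sink \<open>k\<close>, towards which all arrows between
  them point. The last clause in each case says that the side of \<open>j\<close> can be left only towards
  the sink; in particular no arrow leads from \<open>j\<close> away from it.\<close>

definition valley :: "'v list \<Rightarrow> 'v rel \<Rightarrow> nat \<Rightarrow> nat \<Rightarrow> nat \<Rightarrow> bool" where
  "valley vs E i k j \<longleftrightarrow> i < length vs \<and> j < length vs \<and> (\<forall>y. (vs ! k, y) \<notin> E) \<and>
     (i < k \<and> k < j \<and> up_run vs E i k \<and> down_run vs E k j \<and>
        (\<forall>l y. k < l \<and> l \<le> j \<and> (vs ! l, y) \<in> E \<longrightarrow> y = vs ! (l - 1)) \<or>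
      j < k \<and> k < i \<and> up_run vs E j k \<and> down_run vs E k i \<and>
        (\<forall>l y. j \<le> l \<and> l < k \<and> (vs ! l, y) \<in> E \<longrightarrow> y = vs ! Suc l))"

text \<open>A path of \<open>E\<close> from \<open>s\<close> to \<open>t\<close> would be a second path besides the arrow, and one from \<open>t\<close> to \<open>s\<close>
  would close a cycle.\<close>

lemma alien_incomparable:
  assumes al: "alien_set vs E F" and st: "(s, t) \<in> F"
  shows "(s, t) \<notin> E\<^sup>*" "(t, s) \<notin> E\<^sup>*"
proof -
  have FE: "F \<inter> E = {}" and ac: "acyclic (E \<union> F)"
    and uniq: "\<And>p. quiver_path (E \<union> F) s p t \<longleftrightarrow> p = [s, t]"
    using al st by (auto simp: alien_set_def)
  show "(s, t) \<notin> E\<^sup>*"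
  proof
    assume "(s, t) \<in> E\<^sup>*"
    then obtain p where p: "quiver_path E s p t" using rtrancl_quiver_path by metis
    then have "p = [s, t]" using uniq quiver_path_mono[OF p] by blast
    then have "(s, t) \<in> E" using p by (simp add: quiver_path_def)
    then show False using FE st by blast
  qed
  show "(t, s) \<notin> E\<^sup>*"
  proof
    assume "(t, s) \<in> E\<^sup>*"
    then have "(t, s) \<in> (E \<union> F)\<^sup>*" using rtrancl_mono[of E "E \<union> F"] by blast
    moreover have "(s, t) \<in> E \<union> F" using st by blast
    ultimately have "(s, s) \<in> (E \<union> F)\<^sup>+" by (rule rtrancl_into_trancl2[rotated])
    then show False using ac by (auto simp: acyclic_def)
  qed
qed

text \<open>Source and target both reach one sink, and being incomparable they do so from different sides.
  If the target had an arrow leading away from the sink, it would be a source that is not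
  extreme, which is excluded for alien arrows.\<close>

lemma alien_valley:
  assumes al: "alien_set vs E F" and st: "(s, t) \<in> F"
  shows "\<exists>i k j. s = vs ! i \<and> t = vs ! j \<and> valley vs E i k j"
proof -
  have A: "dynkin_A vs E" and sub: "s \<in> set vs" "t \<in> set vs" using al st by (auto simp: alien_set_def)
  have dis: "distinct vs" using A by (simp add: dynkin_A_def)
  have nth: "a = b" if "vs ! a = vs ! b" "a < length vs" "b < length vs" for a b
    using that dis nth_eq_iff_index_eq by blast
  have c1: "\<forall>(s, t)\<in>F. \<exists>z\<in>quiver_sinks (set vs) E. s \<in> Supp_I (set vs) E z \<and> t \<in> Supp_I (set vs) E z"
    using al unfolding alien_set_def by (elim conjE)
  have c2: "\<forall>(s, t)\<in>F. t \<in> quiver_sources (set vs) E \<longrightarrow> t = hd vs \<or> t = last vs"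
    using al unfolding alien_set_def by (elim conjE)
  from bspec[OF c1 st] bspec[OF c2 st]
  obtain z where z: "z \<in> quiver_sinks (set vs) E" "s \<in> Supp_I (set vs) E z" "t \<in> Supp_I (set vs) E z"
    and src: "t \<in> quiver_sources (set vs) E \<longrightarrow> t = hd vs \<or> t = last vs" by auto
  obtain i where i: "i < length vs" "s = vs ! i" using sub by (metis in_set_conv_nth)
  obtain j where j: "j < length vs" "t = vs ! j" using sub by (metis in_set_conv_nth)
  have sink: "\<And>y. (z, y) \<notin> E" and sz: "(vs ! i, z) \<in> E\<^sup>*" and tz: "(vs ! j, z) \<in> E\<^sup>*"
    using z i j by (auto simp: quiver_sinks_def Supp_I_def)
  obtain k where k: "k < length vs" "z = vs ! k" "(i \<le> k \<and> up_run vs E i k) \<or> (k \<le> i \<and> down_run vs E k i)"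
    using path_is_run[OF A i(1) sz] by blast
  obtain k' where "k' < length vs" "z = vs ! k'" "(j \<le> k' \<and> up_run vs E j k') \<or> (k' \<le> j \<and> down_run vs E k' j)"
    using path_is_run[OF A j(1) tz] by blast
  then have k': "(j \<le> k \<and> up_run vs E j k) \<or> (k \<le> j \<and> down_run vs E k j)" using nth k by blast
  have inc: "(vs ! i, vs ! j) \<notin> E\<^sup>*" "(vs ! j, vs ! i) \<notin> E\<^sup>*"
    using alien_incomparable[OF al st] i j by auto
  have ups: False if "i \<le> k" "up_run vs E i k" "j \<le> k" "up_run vs E j k"
  proof (cases "i \<le> j")
    case True
    then have "up_run vs E i j" using that by (auto simp: up_run_def)
    then show False using up_run_path True inc by blast
  next
    case False
    then have "up_run vs E j i" using that by (auto simp: up_run_def)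
    then show False using up_run_path False inc by (metis nat_le_linear)
  qed
  have downs: False if "k \<le> i" "down_run vs E k i" "k \<le> j" "down_run vs E k j"
  proof (cases "i \<le> j")
    case True
    then have "down_run vs E i j" using that by (auto simp: down_run_def)
    then show False using down_run_path True inc by blast
  next
    case False
    then have "down_run vs E j i" using that by (auto simp: down_run_def)
    then show False using down_run_path False inc by (metis nat_le_linear)
  qed
  have refl: "up_run vs E l l" "down_run vs E l l" for l by (auto simp: up_run_def down_run_def)
  have "vs \<noteq> []" using j(1) by auto
  then have tl: "j = length vs - 1" if "t = last vs"
    using that nth[of j "length vs - 1"] j by (simp add: last_conv_nth)
  consider "i < k" "k < j" "up_run vs E i k" "down_run vs E k j" | "j < k" "k < i" "up_run vs E j k" "down_run vs E k i"
    using k(3) k' ups downs refl by (metis le_neq_implies_less)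
  then show ?thesis
  proof cases
    case 1
    have "y = vs ! (l - 1)" if l: "k < l" "l \<le> j" "(vs ! l, y) \<in> E" for l y
    proof -
      have ll: "l < length vs" "Suc (l - 1) = l" using l j by auto
      have inner: "(vs ! l, vs ! (l - 1)) \<in> E" using 1(4) l ll(2) unfolding down_run_def
        by (metis Suc_le_lessD less_Suc_eq_le less_le_trans)
      obtain a where a: "Suc a < length vs" "(vs ! l = vs ! a \<and> y = vs ! Suc a) \<or> (vs ! l = vs ! Suc a \<and> y = vs ! a)"
        by (rule dynkin_A_arrow[OF A l(3)]) (rule that)
      from a(2) show ?thesis
      proof
        assume "vs ! l = vs ! Suc a \<and> y = vs ! a"
        then show ?thesis using nth[of l "Suc a"] a(1) ll by auto
      next
        assume "vs ! l = vs ! a \<and> y = vs ! Suc a"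
        then have la: "l = a" "y = vs ! Suc l" using nth[of l a] a(1) ll by auto
        have "(vs ! Suc l, vs ! l) \<in> E"
        proof (cases "l = j")
          case False
          then show ?thesis using 1(4) l by (auto simp: down_run_def)
        next
          case True
          have "t \<noteq> hd vs" using j True nth[of j 0] l(1) by (cases vs) (auto simp: hd_conv_nth)
          moreover have "t \<noteq> last vs" using tl a(1) la True by auto
          ultimately obtain w where w: "(w, t) \<in> E" using src sub by (auto simp: quiver_sources_def)
          obtain b where b: "Suc b < length vs" "(w = vs ! b \<and> t = vs ! Suc b) \<or> (w = vs ! Suc b \<and> t = vs ! b)"
            by (rule dynkin_A_arrow[OF A w]) (rule that)
          from b(2) show ?thesis
          proof
            assume "w = vs ! b \<and> t = vs ! Suc b"
            then have "b = l - 1" "w = vs ! (l - 1)" using nth[of j "Suc b"] j b(1) True by auto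
            then show ?thesis using w inner j(2) True dynkin_A_asym[OF A] by metis
          next
            assume "w = vs ! Suc b \<and> t = vs ! b"
            then show ?thesis using nth[of j b] j b(1) True w by auto
          qed
        qed
        then show ?thesis using l(3) la dynkin_A_asym[OF A] by metis
      qed
    qed
    then have "valley vs E i k j" using 1 i j k sink by (auto simp: valley_def)
    then show ?thesis using i j by blast
  next
    case 2
    have "y = vs ! Suc l" if l: "j \<le> l" "l < k" "(vs ! l, y) \<in> E" for l y
    proof -
      have ll: "l < length vs" "Suc l < length vs" using l k by auto
      have inner: "(vs ! l, vs ! Suc l) \<in> E" using 2(3) l by (auto simp: up_run_def)
      obtain a where a: "Suc a < length vs" "(vs ! l = vs ! a \<and> y = vs ! Suc a) \<or> (vs ! l = vs ! Suc a \<and> y = vs ! a)"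
        by (rule dynkin_A_arrow[OF A l(3)]) (rule that)
      from a(2) show ?thesis
      proof
        assume "vs ! l = vs ! a \<and> y = vs ! Suc a"
        then show ?thesis using nth[of l a] a(1) ll by auto
      next
        assume "vs ! l = vs ! Suc a \<and> y = vs ! a"
        then have la: "l = Suc a" "y = vs ! a" using nth[of l "Suc a"] a(1) ll by auto
        have "(vs ! a, vs ! l) \<in> E"
        proof (cases "l = j")
          case False
          then show ?thesis using 2(3) l la by (auto simp: up_run_def)
        next
          case True
          have "t \<noteq> hd vs" using j True nth[of j 0] la by (cases vs) (auto simp: hd_conv_nth)
          moreover have "t \<noteq> last vs" using tl ll True by auto
          ultimately obtain w where w: "(w, t) \<in> E" using src sub by (auto simp: quiver_sources_def)
          obtain b where b: "Suc b < length vs" "(w = vs ! b \<and> t = vs ! Suc b) \<or> (w = vs ! Suc b \<and> t = vs ! b)"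
            by (rule dynkin_A_arrow[OF A w]) (rule that)
          from b(2) show ?thesis
          proof
            assume "w = vs ! b \<and> t = vs ! Suc b"
            then have "b = a" "w = vs ! a" using nth[of j "Suc b"] j b(1) True la by auto
            then show ?thesis using w j(2) True by simp
          next
            assume "w = vs ! Suc b \<and> t = vs ! b"
            then have "w = vs ! Suc l" using nth[of j b] j b(1) True by auto
            then show ?thesis using w inner j(2) True dynkin_A_asym[OF A] by metis
          qed
        qed
        then show ?thesis using l(3) la dynkin_A_asym[OF A] by metis
      qed
    qed
    then have "valley vs E i k j" using 2 i j k sink by (auto simp: valley_def)
    then show ?thesis using i j by blast
  qed
qed

text \<open>A path from \<open>c\<close> to \<open>c'\<close> followed by the arrow \<open>c' \<rightarrow> t\<close> would be a second path from \<open>c\<close> to \<open>t\<close>.\<close>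

lemma alien_target_unique:
  assumes al: "alien_set vs E F" and F: "(c, t) \<in> F" "(c', t) \<in> F" and cc: "(c, c') \<in> E\<^sup>*"
  shows "c = c'"
proof (rule ccontr)
  assume ne: "c \<noteq> c'"
  obtain p where p: "quiver_path E c p c'" using rtrancl_quiver_path[OF cc] by blast
  then have p': "quiver_path (E \<union> F) c p c'" by (rule quiver_path_mono) simp
  then have q: "quiver_path (E \<union> F) c (p @ [t]) t"
    using F(2) by (auto simp: quiver_path_def successively_append_iff)
  have "\<forall>(s, t)\<in>F. \<forall>p. quiver_path (E \<union> F) s p t \<longleftrightarrow> p = [s, t]"
    using al unfolding alien_set_def by (elim conjE)
  from bspec[OF this F(1)] q have "p @ [t] = [c, t]" by simp
  then have "p = [c]" by simp
  then show False using p ne by (simp add: quiver_path_def)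
qed

section \<open>Vertices confined to one sink\<close>

text \<open>Every path that starts at \<open>t\<close> can be continued to \<open>e\<close>. In an acyclic quiver \<open>e\<close> is then the only
  sink that \<open>t\<close> reaches.\<close>

definition confined :: "'v rel \<Rightarrow> 'v \<Rightarrow> 'v \<Rightarrow> bool" where
  "confined E t e \<longleftrightarrow> (t, e) \<in> E\<^sup>* \<and> (\<forall>w. (t, w) \<in> E\<^sup>* \<longrightarrow> (w, e) \<in> E\<^sup>*)"

lemma confinedI:
  assumes "t \<in> A" "\<And>x y. x \<in> A \<Longrightarrow> (x, y) \<in> E \<Longrightarrow> y \<in> A" "\<And>x. x \<in> A \<Longrightarrow> (x, e) \<in> E\<^sup>*"
  shows "confined E t e"
proof -
  have "w \<in> A" if "(t, w) \<in> E\<^sup>*" for w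
    using that by (induction rule: rtrancl_induct) (use assms(1,2) in auto)
  then show ?thesis using assms(1,3) by (auto simp: confined_def)
qed

lemma confined_trans: "confined E t e \<Longrightarrow> (t, x) \<in> E\<^sup>* \<Longrightarrow> confined E x e"
  by (auto simp: confined_def intro: rtrancl_trans)

text \<open>A new arrow that \<open>E\<close> determines: either it is implied by a path, or its target is confined to a
  vertex that its source reaches.\<close>

definition good_arrow :: "'v rel \<Rightarrow> 'v \<Rightarrow> 'v \<Rightarrow> bool" where
  "good_arrow E s t \<longleftrightarrow> (s, t) \<in> E\<^sup>* \<or> (\<exists>e. confined E t e \<and> (s, e) \<in> E\<^sup>*)"

lemma confined_good_step:
  assumes "confined E x e" "good_arrow E x y"
  shows "confined E y e"
  using assms(2) unfolding good_arrow_def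
proof
  assume "(x, y) \<in> E\<^sup>*"
  then show ?thesis using assms(1) confined_trans by metis
next
  assume "\<exists>e'. confined E y e' \<and> (x, e') \<in> E\<^sup>*"
  then obtain e' where e': "confined E y e'" "(x, e') \<in> E\<^sup>*" by blast
  have "(e', e) \<in> E\<^sup>*" using assms(1) e'(2) by (simp add: confined_def)
  then have "(w, e) \<in> E\<^sup>*" if "(y, w) \<in> E\<^sup>*" for w
    using e'(1) that unfolding confined_def by (meson rtrancl_trans)
  then show ?thesis unfolding confined_def by blast
qed

text \<open>If \<open>x\<close> is confined to \<open>e\<close> and has a good arrow to a vertex confined to \<open>e'\<close>, then \<open>x\<close> reaches
  \<open>e'\<close>, so \<open>e'\<close> continues to \<open>e\<close>.\<close>

lemma confined_reach:
  assumes "confined E t e" "(t, w) \<in> (E \<union> F)\<^sup>*"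
    and "\<And>x y. confined E x e \<Longrightarrow> (t, x) \<in> (E \<union> F)\<^sup>* \<Longrightarrow> (x, y) \<in> F \<Longrightarrow> good_arrow E x y"
  shows "confined E w e"
  using assms(2)
proof (induction rule: rtrancl_induct)
  case base
  show ?case by (rule assms(1))
next
  case (step x y)
  show ?case
  proof (cases "(x, y) \<in> F")
    case True
    then show ?thesis using confined_good_step step assms(3) by metis
  next
    case False
    then have "(x, y) \<in> E\<^sup>*" using step by auto
    then show ?thesis using confined_trans step by metis
  qed
qed

section \<open>Alien arrows of a quiver with two ends\<close>

text \<open>The tail \<open>1, \<dots>, m\<close> of a quiver of type \<open>\<bbbD>\<close> with its two ends \<open>p\<close> and \<open>q\<close>. They enter
  symmetrically, so every result about \<open>p\<close> has a twin about \<open>q\<close>, by \<open>swapped\<close>.\<close>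

locale forked_quiver =
  fixes m p q :: nat and E F :: "nat rel"
  assumes m: "2 \<le> m" and pq: "{p, q} = {Suc m, Suc (Suc m)}"
    and asymE: "asym E"
    and edge: "\<And>x y. (x, y) \<in> E \<or> (y, x) \<in> E \<longleftrightarrow>
      (\<exists>i. 1 \<le> i \<and> i < m \<and> {x, y} = {i, Suc i}) \<or> {x, y} = {m, p} \<or> {x, y} = {m, q}"
    and alien_p: "alien_set ([1..<Suc m] @ [p]) (Restr E (insert p {1..m})) (Restr F (insert p {1..m}))"
    and alien_q: "alien_set ([1..<Suc m] @ [q]) (Restr E (insert q {1..m})) (Restr F (insert q {1..m}))"
    and acyc: "acyclic (E \<union> F)"
    and Fsub: "F \<subseteq> {1..Suc (Suc m)} \<times> {1..Suc (Suc m)}"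
begin

lemma swapped: "forked_quiver m q p E F"
proof
  show "{q, p} = {Suc m, Suc (Suc m)}" using pq by auto
  show "(x, y) \<in> E \<or> (y, x) \<in> E \<longleftrightarrow>
      (\<exists>i. 1 \<le> i \<and> i < m \<and> {x, y} = {i, Suc i}) \<or> {x, y} = {m, q} \<or> {x, y} = {m, p}" for x y
    using edge[of x y] by blast
qed (rule m asymE alien_p alien_q acyc Fsub)+

lemma ends: "p \<noteq> q" "m < p" "m < q" "p \<in> {1..Suc (Suc m)}" "q \<in> {1..Suc (Suc m)}"
  "{1..Suc (Suc m)} = {1..m} \<union> {p, q}"
proof -
  show "p \<noteq> q" using pq by (auto simp: doubleton_eq_iff)
  have P: "p = Suc m \<or> p = Suc (Suc m)" "q = Suc m \<or> q = Suc (Suc m)" using pq by (auto simp: doubleton_eq_iff)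
  then show "m < p" "m < q" "p \<in> {1..Suc (Suc m)}" "q \<in> {1..Suc (Suc m)}" by auto
  show "{1..Suc (Suc m)} = {1..m} \<union> {p, q}" unfolding pq by auto
qed

lemma not_both: "(x, y) \<in> E \<Longrightarrow> (y, x) \<notin> E"
  using asymE by (auto dest: asymD)

lemma acycE: "(x, y) \<in> (E \<union> F)\<^sup>* \<Longrightarrow> (y, x) \<in> (E \<union> F)\<^sup>* \<Longrightarrow> x = y"
  using acyc by (metis acyclic_impl_antisym_rtrancl antisymD)

lemma E_sub: "(x, y) \<in> E\<^sup>* \<Longrightarrow> (x, y) \<in> (E \<union> F)\<^sup>*"
  using rtrancl_mono[of E "E \<union> F"] by blast

lemma no_cycle: "(x, y) \<in> E \<union> F \<Longrightarrow> (y, x) \<notin> (E \<union> F)\<^sup>*"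
  using acyc by (meson acyclic_def rtrancl_into_trancl2)

lemma out_end: "(p, y) \<in> E \<Longrightarrow> y = m" and in_end: "(y, p) \<in> E \<Longrightarrow> y = m"
  using edge[of p y] ends by (auto simp: doubleton_eq_iff)

lemma out_tail: "(x, y) \<in> E \<Longrightarrow> x < m \<Longrightarrow> y = Suc x \<or> x = Suc y"
  using edge[of x y] ends m by (auto simp: doubleton_eq_iff)

lemma out_centre: "(m, y) \<in> E \<Longrightarrow> Suc y = m \<or> y = p \<or> y = q"
  using edge[of m y] ends m by (auto simp: doubleton_eq_iff)

lemma E_vertices: "(x, y) \<in> E \<Longrightarrow> x \<in> {1..Suc (Suc m)} \<and> y \<in> {1..Suc (Suc m)}"
  using edge[of x y] ends m by (auto simp: doubleton_eq_iff)

lemma tail_edge: "1 \<le> i \<Longrightarrow> i < m \<Longrightarrow> (i, Suc i) \<in> E \<or> (Suc i, i) \<in> E"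
  using edge[of i "Suc i"] by blast

lemma end_edge: "(m, p) \<in> E \<or> (p, m) \<in> E"
  using edge[of m p] by blast

lemma br_nth: "l < m \<Longrightarrow> ([1..<Suc m] @ [p]) ! l = Suc l" "([1..<Suc m] @ [p]) ! m = p"
  "length ([1..<Suc m] @ [p]) = Suc m" "set ([1..<Suc m] @ [p]) = insert p {1..m}"
  by (auto simp: nth_append simp del: upt_Suc)

text \<open>The exceptional arrows: \<open>c \<rightarrow> p\<close> leads to an end \<open>p\<close> from which one path descends along the tail
  to the sink \<open>z\<close> and another one passes through \<open>m\<close> to the sink \<open>q\<close>. Thus \<open>p\<close> lies below both
  sinks, whereas in \<open>E\<close> the vertex \<open>c\<close> reaches \<open>z\<close> but not \<open>q\<close>.\<close>

definition end_arrow :: "nat \<Rightarrow> nat \<Rightarrow> bool" where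
  "end_arrow c z \<longleftrightarrow> (c, p) \<in> F \<and> 1 \<le> c \<and> c < z \<and> z < m \<and> (p, m) \<in> E \<and> (m, q) \<in> E \<and>
     (\<forall>l. c \<le> l \<and> l < z \<longrightarrow> (l, Suc l) \<in> E) \<and> (\<forall>l. z \<le> l \<and> l < m \<longrightarrow> (Suc l, l) \<in> E)"

text \<open>The vertex with index \<open>k\<close> on the branch towards \<open>p\<close> is \<open>Suc k\<close>. A sink of the branch is a sink
  of the whole quiver, except that \<open>m\<close> may have an arrow to the other end \<open>q\<close>.\<close>

definition bottom :: "nat \<Rightarrow> nat" where
  "bottom k = (if Suc k = m \<and> (m, q) \<in> E then q else Suc k)"

lemma run_mono: "E' \<subseteq> E \<Longrightarrow> up_run vs E' i k \<Longrightarrow> up_run vs E i k"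
  "E' \<subseteq> E \<Longrightarrow> down_run vs E' k i \<Longrightarrow> down_run vs E k i"
  by (auto simp: up_run_def down_run_def)

text \<open>Outside the branch towards \<open>p\<close> there is only \<open>q\<close>, so a valley of this branch can be left only
  through an arrow \<open>m \<rightarrow> q\<close>. If \<open>m\<close> is the bottom of the valley, everything is still confined, to
  \<open>q\<close> instead of \<open>m\<close>. If \<open>m\<close> lies on the slope of the target and has an arrow to \<open>q\<close>, the target
  is \<open>p\<close>, which is the exceptional arrow, or \<open>m\<close> itself. In the latter case \<open>m\<close> would be a
  source of the other branch that is not extreme, and hence no target of an arrow that is alien
  there.\<close>

lemma branch_arrow:
  assumes st: "(s, t) \<in> F" "s \<in> insert p {1..m}" "t \<in> insert p {1..m}"
  shows "\<exists>i k j. s = ([1..<Suc m] @ [p]) ! i \<and> t = ([1..<Suc m] @ [p]) ! j \<and>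
    valley ([1..<Suc m] @ [p]) (Restr E (insert p {1..m})) i k j \<and> k < m \<and>
    ((t = p \<and> end_arrow s (Suc k)) \<or> (confined E t (bottom k) \<and> (s, bottom k) \<in> E\<^sup>* \<and> t \<noteq> bottom k))"
proof -
  note [simp del] = upt_Suc
  let ?vs = "[1..<Suc m] @ [p]" and ?S = "insert p {1..m}"
  let ?E = "Restr E ?S"
  obtain i k j where ik: "s = ?vs ! i" "t = ?vs ! j" and v: "valley ?vs ?E i k j"
    using alien_valley[OF alien_p, of s t] st by blast
  note v1 = v[unfolded valley_def, THEN conjunct1] and v2 = v[unfolded valley_def, THEN conjunct2, THEN conjunct1]
    and v3 = v[unfolded valley_def, THEN conjunct2, THEN conjunct2, THEN conjunct1]
    and v4 = v[unfolded valley_def, THEN conjunct2, THEN conjunct2, THEN conjunct2]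
  have ij: "i \<le> m" "j \<le> m" using v1 v2 unfolding br_nth(3) by simp_all
  have "k < i \<or> k < j" using v4 by (elim disjE conjE) simp_all
  then have km: "k < m" using ij by linarith
  have vk: "?vs ! k = Suc k" using br_nth(1)[OF km] .
  have inS: "?vs ! l \<in> ?S" if "l \<le> m" for l
    using that br_nth(1)[of l] br_nth(2) by (cases "l = m") auto
  have sink: "y \<notin> ?S" if "(Suc k, y) \<in> E" for y using v3[rule_format, of y] that vk km by auto
  have kb: "(Suc k, bottom k) \<in> E\<^sup>*" by (auto simp: bottom_def)
  have leave: "y \<in> ?S \<or> (x = m \<and> y = q)" if "(x, y) \<in> E" "x \<in> ?S" for x y
  proof (cases "x = m")
    case True
    then show ?thesis using out_centre[of y] that(1) E_vertices[OF that(1)] by auto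
  next
    case False
    then show ?thesis using that out_tail[of x y] out_end[of y] E_vertices[OF that(1)] m by force
  qed
  have q_end: "\<not> (q, y) \<in> E" if "(m, q) \<in> E" for y
    using forked_quiver.out_end[OF swapped] not_both that by blast
  have from_sink: "y = bottom k" if "(Suc k, y) \<in> E" for y
    using leave[OF that] sink[OF that] km that by (auto simp: bottom_def)
  have from_bottom: "y = bottom k" if y: "(bottom k, y) \<in> E" for y
  proof (cases "Suc k = m \<and> (m, q) \<in> E")
    case True
    then have "bottom k = q" by (simp add: bottom_def)
    then show ?thesis using q_end True y by simp
  next
    case False
    then have "bottom k = Suc k" unfolding bottom_def by (rule if_not_P)
    then show ?thesis using from_sink[of y] y by simp
  qed
  have E'E: "?E \<subseteq> E" by auto
  have bq: "bottom k = Suc k \<or> bottom k = q" by (auto simp: bottom_def)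
  have tb: "?vs ! l \<noteq> bottom k" if "l \<le> m" "l \<noteq> k" for l
    using that bq br_nth(1)[of l] br_nth(2) km ends by (cases "l = m") auto
  from v4 consider
    (A) "i < k" "k < j" "up_run ?vs ?E i k" "down_run ?vs ?E k j"
      "\<And>l y. k < l \<Longrightarrow> l \<le> j \<Longrightarrow> (?vs ! l, y) \<in> ?E \<Longrightarrow> y = ?vs ! (l - 1)"
    | (B) "j < k" "k < i" "up_run ?vs ?E j k" "down_run ?vs ?E k i"
      "\<And>l y. j \<le> l \<Longrightarrow> l < k \<Longrightarrow> (?vs ! l, y) \<in> ?E \<Longrightarrow> y = ?vs ! Suc l"
    by (elim disjE conjE) metis+
  then have "(t = p \<and> end_arrow s (Suc k)) \<or> (confined E t (bottom k) \<and> (s, bottom k) \<in> E\<^sup>* \<and> t \<noteq> bottom k)"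
  proof cases
    case A
    have up: "up_run ?vs E i k" and dn: "down_run ?vs E k j" using run_mono[OF E'E] A by auto
    have "(s, Suc k) \<in> E\<^sup>*" using up_run_path[OF up] A ik vk by simp
    then have sb: "(s, bottom k) \<in> E\<^sup>*" using kb by (rule rtrancl_trans)
    have dn': "(Suc l, l) \<in> E" if "Suc k \<le> l" "l < m" "l \<le> j" for l
    proof -
      have "k \<le> l - 1" "l - 1 < j" "Suc (l - 1) = l" using that by auto
      then have "(?vs ! l, ?vs ! (l - 1)) \<in> E" using dn unfolding down_run_def by metis
      then show ?thesis using br_nth(1)[of l] br_nth(1)[of "l - 1"] that by auto
    qed
    show ?thesis
    proof (cases "Suc k < m \<and> m - 1 \<le> j \<and> (m, q) \<in> E")
      case True
      (* The slope of the target contains m, so it covers the whole tail from m down to the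
         sink. *)
      have dm: "(Suc l, l) \<in> E" if "Suc k \<le> l" "l < m" for l using dn'[of l] that True by auto
      have "Suc k \<le> m - 1" "m - 1 < m" "Suc (m - 1) = m" using True m by linarith+
      then have mm: "(m, m - 1) \<in> E" using dm[of "m - 1"] by simp
      show ?thesis
      proof (cases "j = m")
        case j: True
        then have t: "t = p" using ik br_nth(2) by simp
        have a: "k \<le> m - 1" "m - 1 < j" "Suc (m - 1) = m" "m - 1 < m" using True j m by linarith+
        then have "(?vs ! Suc (m - 1), ?vs ! (m - 1)) \<in> E" using dn unfolding down_run_def by blast
        then have "(p, m) \<in> E" using br_nth(1)[OF a(4)] br_nth(2) a(3) by simp
        moreover have s: "s = Suc i" using ik br_nth(1)[of i] A(1) km by simp
        moreover have "(l, Suc l) \<in> E" if "s \<le> l" "l < Suc k" for l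
        proof -
          have "i \<le> l - 1" "l - 1 < k" "Suc (l - 1) = l" using that s by auto
          then have "(?vs ! (l - 1), ?vs ! l) \<in> E" using up unfolding up_run_def by metis
          then show ?thesis using br_nth(1)[of l] br_nth(1)[of "l - 1"] that s km by auto
        qed
        ultimately have "end_arrow s (Suc k)"
          using st(1) t True A(1) dm by (simp add: end_arrow_def)
        then show ?thesis using t by blast
      next
        case False
        then have "j = m - 1" using True ij by auto
        then have t: "t = m" using ik br_nth(1)[of "m - 1"] m by simp
        have s: "s = Suc i" using ik br_nth(1)[of i] A(1) km by simp
        have "(s, m) \<in> Restr F (insert q {1..m})" using st(1) t s A(1) km by auto
        moreover have "\<forall>(s, t)\<in>Restr F (insert q {1..m}).
            t \<in> quiver_sources (set ([1..<Suc m] @ [q])) (Restr E (insert q {1..m})) \<longrightarrow>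
            t = hd ([1..<Suc m] @ [q]) \<or> t = last ([1..<Suc m] @ [q])"
          using alien_q unfolding alien_set_def by (elim conjE)
        ultimately have *: "m \<in> quiver_sources (set ([1..<Suc m] @ [q])) (Restr E (insert q {1..m})) \<longrightarrow>
            m = hd ([1..<Suc m] @ [q]) \<or> m = last ([1..<Suc m] @ [q])" by blast
        have "(y, m) \<notin> E" if "y \<in> insert q {1..m}" for y
        proof
          assume y: "(y, m) \<in> E"
          then have "y \<noteq> q" using True not_both by blast
          then have "y < m" using that y not_both by (metis atLeastAtMost_iff insertE le_neq_implies_less)
          then have "m = Suc y" using out_tail[OF y] by auto
          then show False using y mm not_both by simp
        qed
        then have "m \<in> quiver_sources (set ([1..<Suc m] @ [q])) (Restr E (insert q {1..m}))"
          using m by (auto simp: quiver_sources_def)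
        then have "m = hd ([1..<Suc m] @ [q]) \<or> m = last ([1..<Suc m] @ [q])" using * by blast
        moreover have "hd ([1..<Suc m] @ [q]) = 1" using m by (simp add: upt_conv_Cons del: upt_Suc)
        ultimately show ?thesis using m ends by simp
      qed
    next
      case False
      have "confined E t (bottom k)"
      proof (rule confinedI[where A = "insert (bottom k) {?vs ! l | l. k \<le> l \<and> l \<le> j}"])
        show "t \<in> insert (bottom k) {?vs ! l | l. k \<le> l \<and> l \<le> j}" using ik A(2) by auto
        fix x assume x: "x \<in> insert (bottom k) {?vs ! l | l. k \<le> l \<and> l \<le> j}"
        show "(x, bottom k) \<in> E\<^sup>*"
        proof (cases "x = bottom k")
          case False
          then obtain l where l: "x = ?vs ! l" "k \<le> l" "l \<le> j" using x by blast
          have "down_run ?vs E k l" using dn l by (auto simp: down_run_def)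
          then have "(x, Suc k) \<in> E\<^sup>*" using down_run_path l vk by metis
          then show ?thesis using kb by (rule rtrancl_trans)
        qed simp
        fix y assume xy: "(x, y) \<in> E"
        show "y \<in> insert (bottom k) {?vs ! l | l. k \<le> l \<and> l \<le> j}"
        proof (cases "x = bottom k \<or> x = Suc k")
          case True
          then show ?thesis using from_sink from_bottom xy by blast
        next
          case ne: False
          then obtain l where l: "x = ?vs ! l" "k \<le> l" "l \<le> j" using x by blast
          have kl: "k < l" using ne l vk by (cases "k = l") auto
          have xS: "x \<in> ?S" using inS l ij by simp
          from leave[OF xy xS] show ?thesis
          proof
            assume "y \<in> ?S"
            then have "(?vs ! l, y) \<in> ?E" using xy xS l(1) by auto
            then have "y = ?vs ! (l - 1)" using A(5)[OF kl l(3)] by blast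
            moreover have "k \<le> l - 1" "l - 1 \<le> j" using kl l(3) by auto
            ultimately show ?thesis by blast
          next
            assume y: "x = m \<and> y = q"
            have "l \<noteq> m" using y l br_nth(2) ends by auto
            then have "Suc l = m" using y l br_nth(1)[of l] ij by auto
            then have "Suc k < m \<and> m - 1 \<le> j \<and> (m, q) \<in> E" using y kl l xy by auto
            then show ?thesis using False by blast
          qed
        qed
      qed
      moreover have "t \<noteq> bottom k" using tb[of j] ij A(2) ik by auto
      ultimately show ?thesis using sb by blast
    qed
  next
    case B
    have up: "up_run ?vs E j k" and dn: "down_run ?vs E k i" using run_mono[OF E'E] B by auto
    have "(s, Suc k) \<in> E\<^sup>*" using down_run_path[OF dn] B ik vk by simp
    then have sb: "(s, bottom k) \<in> E\<^sup>*" using kb by (rule rtrancl_trans)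
    have "confined E t (bottom k)"
    proof (rule confinedI[where A = "insert (bottom k) {?vs ! l | l. j \<le> l \<and> l \<le> k}"])
      show "t \<in> insert (bottom k) {?vs ! l | l. j \<le> l \<and> l \<le> k}" using ik B(1) by auto
      fix x assume x: "x \<in> insert (bottom k) {?vs ! l | l. j \<le> l \<and> l \<le> k}"
      show "(x, bottom k) \<in> E\<^sup>*"
      proof (cases "x = bottom k")
        case False
        then obtain l where l: "x = ?vs ! l" "j \<le> l" "l \<le> k" using x by blast
        have "up_run ?vs E l k" using up l by (auto simp: up_run_def)
        then have "(x, Suc k) \<in> E\<^sup>*" using up_run_path l vk by metis
        then show ?thesis using kb by (rule rtrancl_trans)
      qed simp
      fix y assume xy: "(x, y) \<in> E"
      show "y \<in> insert (bottom k) {?vs ! l | l. j \<le> l \<and> l \<le> k}"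
      proof (cases "x = bottom k \<or> x = Suc k")
        case True
        then show ?thesis using from_sink from_bottom xy by blast
      next
        case ne: False
        then obtain l where l: "x = ?vs ! l" "j \<le> l" "l \<le> k" using x by blast
        have kl: "l < k" using ne l vk by (cases "k = l") auto
        have xl: "x = Suc l" using l(1) br_nth(1)[of l] kl km by simp
        have xS: "x \<in> ?S" using xl kl km by simp
        have "y \<in> ?S" using leave[OF xy xS] xl kl km by auto
        then have "(?vs ! l, y) \<in> ?E" using xy xS l(1) by auto
        then have "y = ?vs ! Suc l" using B(5)[OF l(2) kl] by blast
        moreover have "j \<le> Suc l" "Suc l \<le> k" using kl l(2) by auto
        ultimately show ?thesis by blast
      qed
    qed
    moreover have "t \<noteq> bottom k" using tb[of j] ij B(1) ik by auto
    ultimately show ?thesis using sb by blast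
  qed
  then show ?thesis using ik v km by blast
qed

text \<open>Going down the tail as long as possible ends at a sink to which everything on the way is
  confined.\<close>

lemma descending_confined:
  "1 \<le> i \<Longrightarrow> i \<le> m \<Longrightarrow> (\<And>y. (i, y) \<in> E \<Longrightarrow> Suc y = i) \<Longrightarrow> \<exists>e. confined E i e"
proof (induction i)
  case (Suc i)
  show ?case
  proof (cases "(Suc i, i) \<in> E")
    case True
    then have i1: "1 \<le> i" using E_vertices by auto
    have "Suc y = i" if "(i, y) \<in> E" for y
      using out_tail[OF that] Suc.prems(2) not_both[OF that] True by auto
    then obtain e where e: "confined E i e" using Suc.IH i1 Suc.prems by auto
    have "confined E (Suc i) e"
    proof (rule confinedI[where A = "insert (Suc i) {w. (i, w) \<in> E\<^sup>*}"])
      show "y \<in> insert (Suc i) {w. (i, w) \<in> E\<^sup>*}"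
        if "x \<in> insert (Suc i) {w. (i, w) \<in> E\<^sup>*}" "(x, y) \<in> E" for x y
      proof (cases "x = Suc i")
        case True
        then have "y = i" using Suc.prems(3)[of y] that(2) by simp
        then show ?thesis by simp
      next
        case False
        then show ?thesis using that by (auto intro: rtrancl_into_rtrancl)
      qed
      show "(x, e) \<in> E\<^sup>*" if "x \<in> insert (Suc i) {w. (i, w) \<in> E\<^sup>*}" for x
        using that e True by (auto simp: confined_def intro: converse_rtrancl_into_rtrancl)
    qed simp
    then show ?thesis by blast
  next
    case False
    have "confined E (Suc i) (Suc i)"
      by (rule confinedI[where A = "{Suc i}"]) (use False Suc.prems(3) in auto)
    then show ?thesis by blast
  qed
qed simp

text \<open>Unless both ends are sinks, a path joins them or both of them descend into the tail and are
  confined to the same sink.\<close>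

lemma free_arrow:
  assumes pqF: "(p, q) \<in> F" and not_out: "\<not> ((m, p) \<in> E \<and> (m, q) \<in> E)"
  shows "good_arrow E p q"
proof -
  interpret sw: forked_quiver m q p E F by (rule swapped)
  consider "(p, m) \<in> E" "(m, q) \<in> E" | "(m, p) \<in> E" "(q, m) \<in> E" | "(p, m) \<in> E" "(q, m) \<in> E"
    using end_edge sw.end_edge not_out by blast
  then show ?thesis
  proof cases
    case 1
    then have "(p, q) \<in> E\<^sup>*" by (meson r_into_rtrancl rtrancl_into_rtrancl)
    then show ?thesis by (simp add: good_arrow_def)
  next
    case 2
    then have "(q, p) \<in> E\<^sup>*" by (meson r_into_rtrancl rtrancl_into_rtrancl)
    then show ?thesis using no_cycle[of p q] pqF E_sub by blast
  next
    case 3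
    have "Suc y = m" if "(m, y) \<in> E" for y
      using out_centre[OF that] 3 not_both that by blast
    then obtain e where e: "confined E m e" using descending_confined[of m] m by auto
    have "confined E q e"
    proof (rule confinedI[where A = "insert q {w. (m, w) \<in> E\<^sup>*}"])
      show "y \<in> insert q {w. (m, w) \<in> E\<^sup>*}"
        if "x \<in> insert q {w. (m, w) \<in> E\<^sup>*}" "(x, y) \<in> E" for x y
        using that sw.out_end[of y] by (cases "x = q") (auto intro: rtrancl_into_rtrancl)
      show "(x, e) \<in> E\<^sup>*" if "x \<in> insert q {w. (m, w) \<in> E\<^sup>*}" for x
        using that e 3 by (auto simp: confined_def intro: converse_rtrancl_into_rtrancl)
    qed simp
    moreover have "(p, e) \<in> E\<^sup>*" using 3 e by (auto simp: confined_def intro: converse_rtrancl_into_rtrancl)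
    ultimately show ?thesis unfolding good_arrow_def by blast
  qed
qed

lemma arrow_cases:
  assumes "(s, t) \<in> F"
  obtains "s \<in> insert p {1..m}" "t \<in> insert p {1..m}" | "s \<in> insert q {1..m}" "t \<in> insert q {1..m}"
    | "s = p" "t = q" | "s = q" "t = p"
  using assms Fsub ends(6) by blast

end

section \<open>The poset of the forked quiver\<close>

lemma adjacent_Cons: "adjacent zs a b \<Longrightarrow> adjacent (x # zs) a b"
  unfolding adjacent_def by (metis Suc_less_eq length_Cons nth_Cons_Suc)

lemma adjacent_first: "{a, b} = {x, y} \<Longrightarrow> adjacent (x # y # zs) a b"
  unfolding adjacent_def by (intro exI[of _ 0]) simp

lemma adjacent_rev_upt:
  assumes "l \<le> i" "i < u" "{a, b} = {i, Suc i}"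
  shows "adjacent (rev [l..<Suc u]) a b"
proof -
  have "rev [l..<Suc u] ! (u - Suc i) = Suc i" "rev [l..<Suc u] ! Suc (u - Suc i) = i"
    using assms by (simp_all add: rev_nth del: upt_Suc)
  moreover have "Suc (u - Suc i) < length (rev [l..<Suc u])" using assms by (simp del: upt_Suc)
  ultimately show ?thesis unfolding adjacent_def using assms(3)
    by (intro exI[of _ "u - Suc i"]) (simp add: insert_commute del: upt_Suc)
qed

lemma successively_rev_upt:
  assumes "l \<le> u" "\<And>i. l \<le> i \<Longrightarrow> i < u \<Longrightarrow> R (Suc i) i"
  shows "successively R (rev [l..<Suc u])"
  using assms
proof (induction u)
  case (Suc u)
  show ?case
  proof (cases "l = Suc u")
    case False
    then have "successively R (rev [l..<Suc u])" using Suc by auto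
    moreover have "R (Suc u) u" using Suc.prems False by auto
    moreover have "rev [l..<Suc (Suc u)] = Suc u # rev [l..<Suc u]" using Suc.prems by simp
    moreover have "rev [l..<Suc u] = u # rev [l..<u]" using Suc.prems False by simp
    ultimately show ?thesis by (metis successively.simps(3))
  qed simp
qed simp

lemma upt_split:
  assumes "i \<le> j" "j \<le> k"
  shows "[i..<k] = [i..<j] @ [j..<k]"
  using upt_add_eq_append[of i j "k - j"] assms by simp

lemma no_arrow_reach: "(x, y) \<in> E\<^sup>* \<Longrightarrow> (\<And>w. (x, w) \<notin> E) \<Longrightarrow> y = x"
  by (erule converse_rtranclE) auto

context forked_quiver
begin

text \<open>The lower bound is \<open>Suc 0\<close>, the form to which the simplifier rewrites it.\<close>

abbreviation X :: "nat set" where "X \<equiv> {Suc 0..Suc (Suc m)}"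

abbreviation P :: "nat rel" where "P \<equiv> quiver_poset X (E \<union> F)"

lemma X_eq: "X = {1..m} \<union> {p, q}"
  using ends(6) by simp

lemma P_iff: "(x, y) \<in> P \<longleftrightarrow> x \<in> X \<and> y \<in> X \<and> (x, y) \<in> (E \<union> F)\<^sup>*"
  by (simp add: quiver_poset_def)

lemma stays: "(x, y) \<in> (E \<union> F)\<^sup>* \<Longrightarrow> x \<in> X \<Longrightarrow> y \<in> X"
  by (induction rule: rtrancl_induct) (use E_vertices Fsub in auto)

lemma arrows_P: "E \<union> F \<subseteq> P"
proof
  fix z assume z: "z \<in> E \<union> F"
  obtain x y where xy: "z = (x, y)" by (cases z)
  then have "x \<in> X \<and> y \<in> X" using z E_vertices[of x y] Fsub by auto
  then show "z \<in> P" using z xy by (auto simp: quiver_poset_def)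
qed

lemma Field_P: "Field P = X"
  by (auto simp: Field_def quiver_poset_def)

lemma finite_poset_P: "finite_poset P"
proof -
  have "antisym P" using acycE by (auto simp: antisym_def quiver_poset_def)
  moreover have "trans P" unfolding quiver_poset_def by (auto intro!: transI)
  moreover have "refl_on (Field P) P" unfolding Field_P by (auto simp: refl_on_def quiver_poset_def)
  moreover have "P \<subseteq> X \<times> X" by (auto simp: quiver_poset_def)
  ultimately show ?thesis unfolding finite_poset_def order_on_defs Field_P by simp
qed

lemma confined_max:
  assumes "(t, e) \<in> E\<^sup>*" "t \<in> X" "confined E w e" "w \<in> max_elems P"
  shows "w = e"
proof -
  have "e \<in> X" using stays[OF E_sub[OF assms(1)] assms(2)] .
  moreover have "(w, e) \<in> (E \<union> F)\<^sup>*" using assms(3) E_sub by (auto simp: confined_def)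
  moreover have "w \<in> X" using assms(4) Field_P by (auto simp: max_elems_def)
  ultimately have "(w, e) \<in> P" by (simp add: P_iff)
  then show ?thesis using assms(4) by (auto simp: max_elems_def)
qed

text \<open>If everything above \<open>t\<close> in the poset is confined to \<open>e\<close>, then \<open>e\<close> is the only maximal element
  above \<open>t\<close>, and it serves as the vertex \<open>z\<close> in \<open>determines\<close>.\<close>

lemma determinesI:
  assumes E': "E' \<subseteq> E \<union> F" "E \<subseteq> E'\<^sup>*"
    and F: "\<And>s t. (s, t) \<in> F \<Longrightarrow> (s, t) \<in> E'\<^sup>* \<or>
      (\<exists>e. (s, e) \<in> E\<^sup>* \<and> (t, e) \<in> E\<^sup>* \<and> (\<forall>w. (t, w) \<in> (E \<union> F)\<^sup>* \<longrightarrow> confined E w e))"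
  shows "determines E' (E \<union> F) P"
proof -
  have EE: "E\<^sup>* \<subseteq> E'\<^sup>*" using rtrancl_mono[OF E'(2)] by simp
  have "(s, t) \<in> E'\<^sup>* \<or> (\<exists>z. (s, z) \<in> E'\<^sup>* \<and> (t, z) \<in> E'\<^sup>* \<and> (\<forall>w\<in>max_elems P. (t, w) \<in> P \<longrightarrow> (z, w) \<in> P))"
    if st: "(s, t) \<in> E \<union> F" for s t
  proof (cases "(s, t) \<in> E")
    case True
    then show ?thesis using E'(2) by blast
  next
    case False
    then have stF: "(s, t) \<in> F" using st by blast
    from F[OF this] show ?thesis
    proof
      assume "\<exists>e. (s, e) \<in> E\<^sup>* \<and> (t, e) \<in> E\<^sup>* \<and> (\<forall>w. (t, w) \<in> (E \<union> F)\<^sup>* \<longrightarrow> confined E w e)"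
      then obtain e where e: "(s, e) \<in> E\<^sup>*" "(t, e) \<in> E\<^sup>*" "\<And>w. (t, w) \<in> (E \<union> F)\<^sup>* \<Longrightarrow> confined E w e" by blast
      have tX: "t \<in> X" using stF Fsub by auto
      have "(e, w) \<in> P" if w: "w \<in> max_elems P" "(t, w) \<in> P" for w
      proof -
        have "w = e" using confined_max[OF e(2) tX e(3) w(1)] w(2) by (simp add: P_iff)
        then show ?thesis using w(2) by (simp add: P_iff)
      qed
      then show ?thesis using e EE by blast
    qed blast
  qed
  moreover have "E' \<subseteq> P" using E'(1) arrows_P by blast
  moreover have "(x, y) \<in> (E \<union> F)\<^sup>*" if "(x, y) \<in> P" for x y using that by (simp add: P_iff)
  ultimately show ?thesis using arrows_P unfolding determines_def by blast
qed

lemma tail_joined: "1 \<le> i \<Longrightarrow> i < m \<Longrightarrow> joined E (Suc i) i"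
  using tail_edge by (auto simp: joined_def)

section \<open>Good arrows only\<close>

lemma determines_good:
  assumes good: "\<And>s t. (s, t) \<in> F \<Longrightarrow> good_arrow E s t"
  shows "determines E (E \<union> F) P"
proof (rule determinesI)
  fix s t assume st: "(s, t) \<in> F"
  from good[OF st] show "(s, t) \<in> E\<^sup>* \<or>
      (\<exists>e. (s, e) \<in> E\<^sup>* \<and> (t, e) \<in> E\<^sup>* \<and> (\<forall>w. (t, w) \<in> (E \<union> F)\<^sup>* \<longrightarrow> confined E w e))"
    unfolding good_arrow_def
  proof
    assume "\<exists>e. confined E t e \<and> (s, e) \<in> E\<^sup>*"
    then obtain e where e: "confined E t e" "(s, e) \<in> E\<^sup>*" by blast
    have "confined E w e" if "(t, w) \<in> (E \<union> F)\<^sup>*" for w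
      by (rule confined_reach[OF e(1) that]) (rule good)
    then show ?thesis using e by (auto simp: confined_def)
  qed simp
qed auto

lemma arms_of_fork:
  "is_arm X E m (rev [1..<Suc m])" "is_arm X E m [m, p]"
  "set (rev [1..<Suc m]) \<union> set [m, p] \<union> set [m, q] = X"
  "set (rev [1..<Suc m]) \<inter> set [m, p] = {m}" "set (rev [1..<Suc m]) \<inter> set [m, q] = {m}"
  "set [m, p] \<inter> set [m, q] = {m}"
proof -
  have "successively (joined E) (rev [1..<Suc m])"
    by (rule successively_rev_upt) (use m tail_joined in auto)
  then show "is_arm X E m (rev [1..<Suc m])" using m by (auto simp: is_arm_def)
  show "is_arm X E m [m, p]" using ends end_edge m by (auto simp: is_arm_def joined_def)
  show "set (rev [1..<Suc m]) \<union> set [m, p] \<union> set [m, q] = X" unfolding X_eq using m by auto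
  show "set (rev [1..<Suc m]) \<inter> set [m, p] = {m}" "set (rev [1..<Suc m]) \<inter> set [m, q] = {m}"
    "set [m, p] \<inter> set [m, q] = {m}" using ends m by auto
qed

lemma arrows_of_fork:
  assumes "(a, b) \<in> E"
  shows "adjacent (rev [1..<Suc m]) a b \<or> adjacent [m, p] a b \<or> adjacent [m, q] a b"
proof -
  consider i where "1 \<le> i" "i < m" "{a, b} = {i, Suc i}" | "{a, b} = {m, p}" | "{a, b} = {m, q}"
    using edge[of a b] assms by blast
  then show ?thesis
  proof cases
    case (1 i) then show ?thesis using adjacent_rev_upt[of 1 i m a b] by blast
  next
    case 2 then show ?thesis using adjacent_first[of a b m p "[]"] by simp
  next
    case 3 then show ?thesis using adjacent_first[of a b m q "[]"] by simp
  qed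
qed

section \<open>An arrow between two ends that are sinks\<close>

text \<open>The arrow \<open>m \<rightarrow> q\<close> is the composite of \<open>m \<rightarrow> p\<close> and \<open>p \<rightarrow> q\<close>. Any other new arrow is good, and the
  vertices above its target are confined to a vertex different from \<open>p\<close>, so that \<open>p \<rightarrow> q\<close> does
  not lead out of them.\<close>

lemma determines_outgoing_ends:
  assumes pqF: "(p, q) \<in> F" and out: "(m, p) \<in> E" "(m, q) \<in> E"
  shows "determines (insert (p, q) (E - {(m, q)})) (E \<union> F) P"
proof (rule determinesI)
  interpret sw: forked_quiver m q p E F by (rule swapped)
  let ?E = "insert (p, q) (E - {(m, q)})"
  have mp: "(m, p) \<in> ?E" using out ends by auto
  have "(m, q) \<in> ?E\<^sup>*" using mp by (meson insertI1 r_into_rtrancl rtrancl_into_rtrancl)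
  then show "E \<subseteq> ?E\<^sup>*" by auto
  show "?E \<subseteq> E \<union> F" using pqF by auto
  have no_out_p: "(p, y) \<notin> E" for y using out_end[of y] out(1) not_both by blast
  have no_out_q: "(q, y) \<notin> E" for y using sw.out_end[of y] out(2) not_both by blast
  have other: "\<exists>e. confined E t e \<and> (s, e) \<in> E\<^sup>* \<and> t \<noteq> e" if st: "(s, t) \<in> F" "(s, t) \<noteq> (p, q)" for s t
    using st(1)
  proof (cases rule: arrow_cases)
    case 1
    from branch_arrow[OF st(1) 1] show ?thesis
      using no_out_p unfolding end_arrow_def by blast
  next
    case 2
    from sw.branch_arrow[OF st(1) 2] show ?thesis
      using no_out_q unfolding sw.end_arrow_def by blast
  next
    case 3 then show ?thesis using st(2) by simp
  next
    case 4
    then have "(q, p) \<in> (E \<union> F)\<^sup>*" using st(1) by auto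
    then show ?thesis using no_cycle[of p q] pqF by blast
  qed
  have good: "good_arrow E s t" if "(s, t) \<in> F" "(s, t) \<noteq> (p, q)" for s t
    using other[OF that] unfolding good_arrow_def by blast
  fix s t assume st: "(s, t) \<in> F"
  show "(s, t) \<in> ?E\<^sup>* \<or>
      (\<exists>e. (s, e) \<in> E\<^sup>* \<and> (t, e) \<in> E\<^sup>* \<and> (\<forall>w. (t, w) \<in> (E \<union> F)\<^sup>* \<longrightarrow> confined E w e))"
  proof (cases "(s, t) = (p, q)")
    case False
    then obtain e where e: "confined E t e" "(s, e) \<in> E\<^sup>*" "t \<noteq> e" using other[OF st] by blast
    have ep: "e \<noteq> p"
    proof
      assume "e = p"
      then have "(t, p) \<in> E\<^sup>*" "t \<noteq> p" using e by (auto simp: confined_def)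
      then obtain y where y: "(t, y) \<in> E\<^sup>*" "(y, p) \<in> E" by (meson rtranclE)
      then have "(t, q) \<in> E\<^sup>*" using in_end[OF y(2)] out(2) by auto
      then have "(q, p) \<in> E\<^sup>*" using e(1) \<open>e = p\<close> by (auto simp: confined_def)
      then show False using no_arrow_reach[OF _ no_out_q] ends(1) by blast
    qed
    have "confined E w e" if "(t, w) \<in> (E \<union> F)\<^sup>*" for w
    proof (rule confined_reach[OF e(1) that])
      fix x y assume x: "confined E x e" "(x, y) \<in> F"
      show "good_arrow E x y"
      proof (cases "(x, y) = (p, q)")
        case True
        then have "(p, e) \<in> E\<^sup>*" using x(1) by (simp add: confined_def)
        then show ?thesis using no_arrow_reach[OF _ no_out_p] ep by blast
      qed (use good x(2) in blast)
    qed
    then show ?thesis using e by (auto simp: confined_def)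
  qed auto
qed

text \<open>The arrows form the path \<open>1, \<dots>, m, p, q\<close>, which is viewed as a star with centre \<open>p\<close> whose third
  arm is trivial.\<close>

lemma arms_outgoing:
  assumes out: "(m, p) \<in> E" "(m, q) \<in> E"
  defines "E' \<equiv> insert (p, q) (E - {(m, q)})"
  shows "asym E'" "is_arm X E' p (p # rev [1..<Suc m])" "is_arm X E' p [p, q]" "is_arm X E' p [p]"
    "set (p # rev [1..<Suc m]) \<union> set [p, q] \<union> set [p] = X"
    "set (p # rev [1..<Suc m]) \<inter> set [p, q] = {p}"
    "set (p # rev [1..<Suc m]) \<inter> set [p] = {p}" "set [p, q] \<inter> set [p] = {p}"
    "\<And>a b. (a, b) \<in> E' \<Longrightarrow> adjacent (p # rev [1..<Suc m]) a b \<or> adjacent [p, q] a b \<or> adjacent [p] a b"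
proof -
  interpret sw: forked_quiver m q p E F by (rule swapped)
  have "(q, p) \<notin> E" using sw.out_end[of p] ends by auto
  then show "asym E'" using asymE ends(1) unfolding E'_def by (auto simp: asym_on_def)
  have pm: "p \<notin> set (rev [1..<Suc m])" using ends(2) by auto
  have pX: "set (p # rev [1..<Suc m]) \<subseteq> X" unfolding X_eq using m by auto
  have "joined E' (Suc i) i" if "1 \<le> i" "i < m" for i
    using tail_joined[OF that] that ends by (auto simp: joined_def E'_def)
  then have "successively (joined E') (rev [1..<Suc m])"
    by (intro successively_rev_upt) (use m in auto)
  moreover have "rev [1..<Suc m] = m # rev [1..<m]" using m by simp
  moreover have "joined E' p m" using out ends by (auto simp: joined_def E'_def)
  ultimately have "successively (joined E') (p # rev [1..<Suc m])" by (metis successively.simps(3))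
  moreover note pm pX
  ultimately show "is_arm X E' p (p # rev [1..<Suc m])" unfolding is_arm_def by (simp del: upt_Suc)
  show "is_arm X E' p [p, q]" using ends by (auto simp: is_arm_def joined_def E'_def)
  show "is_arm X E' p [p]" using ends by (auto simp: is_arm_def)
  show "set (p # rev [1..<Suc m]) \<union> set [p, q] \<union> set [p] = X" unfolding X_eq using m by auto
  show "set (p # rev [1..<Suc m]) \<inter> set [p, q] = {p}"
    "set (p # rev [1..<Suc m]) \<inter> set [p] = {p}" "set [p, q] \<inter> set [p] = {p}" using ends m by auto
  fix a b assume ab: "(a, b) \<in> E'"
  show "adjacent (p # rev [1..<Suc m]) a b \<or> adjacent [p, q] a b \<or> adjacent [p] a b"
  proof (cases "(a, b) = (p, q)")
    case True
    then show ?thesis using adjacent_first[of a b p q "[]"] by simp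
  next
    case False
    then have abE: "(a, b) \<in> E" "(a, b) \<noteq> (m, q)" using ab by (auto simp: E'_def)
    have "(q, m) \<notin> E" using out(2) not_both by blast
    then have "{a, b} \<noteq> {m, q}" using abE by (auto simp: doubleton_eq_iff)
    then consider i where "1 \<le> i" "i < m" "{a, b} = {i, Suc i}" | "{a, b} = {m, p}"
      using edge[of a b] abE(1) by blast
    then show ?thesis
    proof cases
      case (1 i)
      then show ?thesis using adjacent_Cons[OF adjacent_rev_upt[of 1 i m a b]] by blast
    next
      case 2
      then have "{a, b} = {p, m}" by auto
      then show ?thesis using adjacent_first[of a b p m "rev [1..<m]"] \<open>rev [1..<Suc m] = m # rev [1..<m]\<close> by simp
    qed
  qed
qed

section \<open>An arrow onto an end that lies below two sinks\<close>

lemma end_arrow_runs: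
  assumes sp: "end_arrow c z"
  shows "c \<le> y \<Longrightarrow> y \<le> z \<Longrightarrow> (c, y) \<in> E\<^sup>*" "z \<le> y \<Longrightarrow> y \<le> m \<Longrightarrow> (p, y) \<in> E\<^sup>*" "(z, w) \<notin> E"
proof -
  have up: "\<And>l. c \<le> l \<Longrightarrow> l < z \<Longrightarrow> (l, Suc l) \<in> E" and dn: "\<And>l. z \<le> l \<Longrightarrow> l < m \<Longrightarrow> (Suc l, l) \<in> E"
    and pm: "(p, m) \<in> E" and cz: "c < z" "z < m" using sp by (auto simp: end_arrow_def)
  show "(c, y) \<in> E\<^sup>*" if "c \<le> y" "y \<le> z"
    using that
  proof (induction y rule: dec_induct)
    case (step n)
    then show ?case using up[of n] by (auto intro: rtrancl_into_rtrancl)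
  qed simp
  show "(p, y) \<in> E\<^sup>*" if "z \<le> y" "y \<le> m"
    using that(2,1)
  proof (induction y rule: inc_induct)
    case base
    then show ?case using pm by auto
  next
    case (step n)
    then have "(p, Suc n) \<in> E\<^sup>*" "(Suc n, n) \<in> E" using dn[of n] by auto
    then show ?case by (rule rtrancl_into_rtrancl)
  qed
  show "(z, w) \<notin> E"
  proof
    assume zw: "(z, w) \<in> E"
    from out_tail[OF this cz(2)] show False
    proof
      assume "w = Suc z" then show False using dn[of z] cz zw not_both by blast
    next
      assume "z = Suc w" then show False using up[of w] cz zw not_both by (metis less_Suc_eq_le lessI)
    qed
  qed
qed

lemma end_arrow_confined:
  assumes sp: "end_arrow c z" and y: "c < y" "y < m"
  shows "confined E y z"
proof -
  have up: "\<And>l. c \<le> l \<Longrightarrow> l < z \<Longrightarrow> (l, Suc l) \<in> E" and dn: "\<And>l. z \<le> l \<Longrightarrow> l < m \<Longrightarrow> (Suc l, l) \<in> E"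
    and cz: "c < z" "z < m" using sp by (auto simp: end_arrow_def)
  show ?thesis
  proof (rule confinedI[where A = "{x. c < x \<and> x < m}"])
    show "y \<in> {x. c < x \<and> x < m}" using y by simp
    fix x assume x: "x \<in> {x. c < x \<and> x < m}"
    show "(x, z) \<in> E\<^sup>*"
    proof (cases "x \<le> z")
      case True
      then show ?thesis using x
      proof (induction x rule: inc_induct)
        case (step n)
        then have "(n, Suc n) \<in> E" "(Suc n, z) \<in> E\<^sup>*" using up[of n] cz by auto
        then show ?case by (rule converse_rtrancl_into_rtrancl)
      qed simp
    next
      case False
      then have "z \<le> x" by simp
      then show ?thesis using x
      proof (induction x rule: dec_induct)
        case (step n)
        then have "(Suc n, n) \<in> E" "(n, z) \<in> E\<^sup>*" using dn[of n] cz by auto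
        then show ?case by (rule converse_rtrancl_into_rtrancl)
      qed simp
    qed
    fix w assume xw: "(x, w) \<in> E"
    have "x = Suc w \<longrightarrow> w \<noteq> c" using xw up[of c] cz not_both by auto
    moreover have "w = Suc x \<longrightarrow> w \<noteq> m" using xw dn[of x] cz x not_both by auto
    ultimately show "w \<in> {x. c < x \<and> x < m}" using out_tail[OF xw] x by auto
  qed
qed

lemma end_arrow_not_above:
  assumes sp: "end_arrow c z" and y: "c < y" "y \<le> m"
  shows "(y, c) \<notin> (E \<union> F)\<^sup>*"
proof
  assume yc: "(y, c) \<in> (E \<union> F)\<^sup>*"
  show False
  proof (cases "y \<le> z")
    case True
    then have "(c, y) \<in> (E \<union> F)\<^sup>*" using end_arrow_runs(1)[OF sp] y E_sub by simp
    then show False using acycE[OF yc] y by simp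
  next
    case False
    then have "(p, y) \<in> (E \<union> F)\<^sup>*" using end_arrow_runs(2)[OF sp] y E_sub by simp
    then have "(p, c) \<in> (E \<union> F)\<^sup>*" using yc by (rule rtrancl_trans)
    moreover have "(c, p) \<in> E \<union> F" using sp by (simp add: end_arrow_def)
    ultimately show False using no_cycle by blast
  qed
qed

text \<open>The sink \<open>z\<close> is determined by the descent from \<open>m\<close>. Two sources on its other side are joined by
  a path, which \<open>alien_target_unique\<close> excludes.\<close>

lemma end_arrow_unique:
  assumes "end_arrow c z" "end_arrow c' z'"
  shows "c = c'"
proof -
  have *: "z \<le> z'" if "end_arrow c z" "end_arrow c' z'" for c z c' z'
  proof (rule ccontr)
    assume "\<not> z \<le> z'"
    then obtain k where k: "z = Suc k" "z' \<le> k" by (cases z) auto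
    then have "(k, Suc k) \<in> E" "(Suc k, k) \<in> E"
      using that unfolding end_arrow_def by auto
    then show False using not_both by blast
  qed
  have z: "z = z'" using *[OF assms] *[OF assms(2,1)] by simp
  have **: "c = c'" if s: "end_arrow c z" "end_arrow c' z" and cc: "c \<le> c'" for c c'
  proof -
    let ?S = "insert p {1..m}"
    have "(c, y) \<in> (Restr E ?S)\<^sup>*" if "c \<le> y" "y \<le> z" for y
      using that
    proof (induction y rule: dec_induct)
      case (step n)
      then have "(n, Suc n) \<in> Restr E ?S" using s(1) by (auto simp: end_arrow_def)
      then show ?case using step by (auto intro: rtrancl_into_rtrancl)
    qed simp
    then have "(c, c') \<in> (Restr E ?S)\<^sup>*" using cc s(2) by (auto simp: end_arrow_def)
    moreover have "(c, p) \<in> Restr F ?S" "(c', p) \<in> Restr F ?S" using s by (auto simp: end_arrow_def)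
    ultimately show ?thesis using alien_target_unique[OF alien_p] by blast
  qed
  show ?thesis using **[of c c'] **[of c' c] assms z by (metis nat_le_linear)
qed

text \<open>The new arrows other than \<open>c \<rightarrow> p\<close> are good, and if they belong to the valley of \<open>z\<close>, then \<open>c\<close> is
  not above their target: source or target lies on the slope between \<open>z\<close> and \<open>p\<close> and so is
  reached from \<open>p\<close>, which would give a cycle through \<open>c \<rightarrow> p\<close>.\<close>

lemma end_arrow_other:
  assumes sp: "end_arrow c z" and st: "(s, t) \<in> F" "(s, t) \<noteq> (c, p)"
  shows "(s, t) \<in> E\<^sup>* \<or> (\<exists>e. confined E t e \<and> (s, e) \<in> E\<^sup>* \<and> t \<noteq> e \<and> (e = z \<longrightarrow> (t, c) \<notin> (E \<union> F)\<^sup>*))"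
proof -
  interpret sw: forked_quiver m q p E F by (rule swapped)
  have cp: "(c, p) \<in> F" and pm: "(p, m) \<in> E" and mq: "(m, q) \<in> E" and zm: "z < m" using sp by (auto simp: end_arrow_def)
  have qm: "(q, m) \<notin> E" using mq not_both by blast
  have not_above: "(t, c) \<notin> (E \<union> F)\<^sup>*"
    if x: "x = p \<or> x = q" and s: "s = ([1..<Suc m] @ [x]) ! i" and t: "t = ([1..<Suc m] @ [x]) ! j"
      and v: "valley ([1..<Suc m] @ [x]) (Restr E (insert x {1..m})) i k j" and k: "Suc k = z" for x i k j
  proof
    assume tc: "(t, c) \<in> (E \<union> F)\<^sup>*"
    let ?vs = "[1..<Suc m] @ [x]" and ?E = "Restr E (insert x {1..m})"
    have nth: "\<And>l. l < m \<Longrightarrow> ?vs ! l = Suc l" "?vs ! m = x" "length ?vs = Suc m"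
      using x br_nth sw.br_nth by auto
    (* Every vertex on the right slope of the valley of z is reached from p. *)
    have right: "(p, ?vs ! a) \<in> E\<^sup>*" if a: "k < a" "a \<le> m" "down_run ?vs ?E k a" for a
    proof (cases "a = m")
      case False
      then have "?vs ! a = Suc a" using nth(1) a by simp
      then show ?thesis using end_arrow_runs(2)[OF sp, of "Suc a"] a False k by simp
    next
      case True
      have l: "k \<le> m - 1" "m - 1 < a" "Suc (m - 1) = m" "m - 1 < m" using a True m by linarith+
      then have "(?vs ! Suc (m - 1), ?vs ! (m - 1)) \<in> ?E" using a(3) unfolding down_run_def by blast
      then have "(x, m) \<in> E" using nth(1)[OF l(4)] nth(2) l(3) by simp
      then have "x = p" using x qm by blast
      then show ?thesis using True nth(2) by simp
    qed
    note v1 = v[unfolded valley_def, THEN conjunct1] and v2 = v[unfolded valley_def, THEN conjunct2, THEN conjunct1]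
      and v4 = v[unfolded valley_def, THEN conjunct2, THEN conjunct2, THEN conjunct2]
    have ij: "i \<le> m" "j \<le> m" using v1 v2 unfolding nth(3) by simp_all
    have "(k < j \<and> down_run ?vs ?E k j) \<or> (k < i \<and> down_run ?vs ?E k i)"
      using v4 by (elim disjE conjE) simp_all
    then have "(p, t) \<in> E\<^sup>* \<or> (p, s) \<in> E\<^sup>*" using right ij s t by blast
    then have "(p, t) \<in> (E \<union> F)\<^sup>*"
    proof
      assume "(p, s) \<in> E\<^sup>*"
      then have "(p, s) \<in> (E \<union> F)\<^sup>*" by (rule E_sub)
      moreover have "(s, t) \<in> E \<union> F" using st(1) by simp
      ultimately show ?thesis by (rule rtrancl_into_rtrancl)
    qed (rule E_sub)
    then have "(p, c) \<in> (E \<union> F)\<^sup>*" using tc by (rule rtrancl_trans)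
    then show False using no_cycle[of c p] cp by blast
  qed
  from st(1) show ?thesis
  proof (cases rule: arrow_cases)
    case 1
    obtain i k j where b: "s = ([1..<Suc m] @ [p]) ! i" "t = ([1..<Suc m] @ [p]) ! j"
      "valley ([1..<Suc m] @ [p]) (Restr E (insert p {1..m})) i k j"
      "(t = p \<and> end_arrow s (Suc k)) \<or> (confined E t (bottom k) \<and> (s, bottom k) \<in> E\<^sup>* \<and> t \<noteq> bottom k)"
      using branch_arrow[OF st(1) 1] by blast
    have "\<not> (t = p \<and> end_arrow s (Suc k))" using end_arrow_unique[OF sp] st(2) by blast
    moreover have "Suc k = z" if "bottom k = z" using that zm ends by (auto simp: bottom_def split: if_splits)
    ultimately show ?thesis using b(4) not_above[OF _ b(1-3)] by blast
  next
    case 2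
    obtain i k j where b: "s = ([1..<Suc m] @ [q]) ! i" "t = ([1..<Suc m] @ [q]) ! j"
      "valley ([1..<Suc m] @ [q]) (Restr E (insert q {1..m})) i k j"
      "(t = q \<and> sw.end_arrow s (Suc k)) \<or> (confined E t (sw.bottom k) \<and> (s, sw.bottom k) \<in> E\<^sup>* \<and> t \<noteq> sw.bottom k)"
      using sw.branch_arrow[OF st(1) 2] by blast
    have "\<not> sw.end_arrow s (Suc k)" using qm by (simp add: sw.end_arrow_def)
    moreover have "Suc k = z" if "sw.bottom k = z" using that zm ends by (auto simp: sw.bottom_def split: if_splits)
    ultimately show ?thesis using b(4) not_above[OF _ b(1-3)] by blast
  next
    case 3
    then have "(s, t) \<in> E\<^sup>*" using pm mq by (meson r_into_rtrancl rtrancl_into_rtrancl)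
    then show ?thesis by blast
  next
    case 4
    have "(p, q) \<in> E\<^sup>*" using pm mq by (meson r_into_rtrancl rtrancl_into_rtrancl)
    then show ?thesis using no_cycle[of q p] st(1) 4 E_sub by blast
  qed
qed

text \<open>A path above \<open>t\<close> that uses \<open>c \<rightarrow> p\<close> passes through \<open>c\<close>, and then \<open>c\<close> is confined to \<open>e\<close>, which
  forces \<open>e = z\<close>, the case in which \<open>t\<close> is required not to lie below \<open>c\<close>.\<close>

lemma end_arrow_reach:
  assumes sp: "end_arrow c z" and e: "confined E t e" "e = z \<longrightarrow> (t, c) \<notin> (E \<union> F)\<^sup>*"
    and w: "(t, w) \<in> (E \<union> F)\<^sup>*"
  shows "confined E w e"
proof (rule confined_reach[OF e(1) w])
  fix x y assume x: "confined E x e" "(t, x) \<in> (E \<union> F)\<^sup>*" "(x, y) \<in> F"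
  show "good_arrow E x y"
  proof (cases "(x, y) = (c, p)")
    case True
    have "(c, z) \<in> E\<^sup>*" using end_arrow_runs(1)[OF sp, of z] sp by (auto simp: end_arrow_def)
    then have "(z, e) \<in> E\<^sup>*" using x(1) True by (simp add: confined_def)
    then have "e = z" using no_arrow_reach[OF _ end_arrow_runs(3)[OF sp]] by blast
    then show ?thesis using e(2) x(2) True by simp
  next
    case False
    then show ?thesis using end_arrow_other[OF sp x(3)] unfolding good_arrow_def by blast
  qed
qed

lemma determines_end_arrow:
  assumes sp: "end_arrow c z"
  shows "determines (insert (c, p) E) (E \<union> F) P"
proof (rule determinesI)
  show "insert (c, p) E \<subseteq> E \<union> F" using sp by (auto simp: end_arrow_def)
  show "E \<subseteq> (insert (c, p) E)\<^sup>*" by auto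
  fix s t assume st: "(s, t) \<in> F"
  show "(s, t) \<in> (insert (c, p) E)\<^sup>* \<or>
      (\<exists>e. (s, e) \<in> E\<^sup>* \<and> (t, e) \<in> E\<^sup>* \<and> (\<forall>w. (t, w) \<in> (E \<union> F)\<^sup>* \<longrightarrow> confined E w e))"
  proof (cases "(s, t) = (c, p)")
    case False
    from end_arrow_other[OF sp st this] show ?thesis
    proof
      assume "(s, t) \<in> E\<^sup>*"
      then show ?thesis using rtrancl_mono[of E "insert (c, p) E"] by blast
    next
      assume "\<exists>e. confined E t e \<and> (s, e) \<in> E\<^sup>* \<and> t \<noteq> e \<and> (e = z \<longrightarrow> (t, c) \<notin> (E \<union> F)\<^sup>*)"
      then obtain e where e: "confined E t e" "(s, e) \<in> E\<^sup>*" "e = z \<longrightarrow> (t, c) \<notin> (E \<union> F)\<^sup>*" by blast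
      then show ?thesis using end_arrow_reach[OF sp e(1,3)] by (auto simp: confined_def)
    qed
  qed auto
qed

text \<open>Down the tail everything is confined to \<open>z\<close>. The target of a new arrow that starts at \<open>m\<close> or \<open>q\<close>
  is confined to a vertex that its source reaches in \<open>E\<close>; this can only be \<open>z\<close>, because a target
  that reaches \<open>m\<close> or \<open>q\<close> would close a cycle.\<close>

lemma end_arrow_top:
  assumes sp: "end_arrow c z" and w: "(m, w) \<in> (E \<union> F)\<^sup>*"
  shows "w = m \<or> w = q \<or> confined E w z"
  using w
proof (induction rule: rtrancl_induct)
  case (step x y)
  interpret sw: forked_quiver m q p E F by (rule swapped)
  have cp: "(c, p) \<in> F" and pm: "(p, m) \<in> E" and mq: "(m, q) \<in> E" and cz: "c < z" "z < m" using sp by (auto simp: end_arrow_def)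
  have no_out_q: "(q, y) \<notin> E" for y using sw.out_end[of y] mq not_both by blast
  have below: "confined E (m - 1) z" by (rule end_arrow_confined[OF sp]) (use cz in auto)
  have zE: "e = z" if "(z, e) \<in> E\<^sup>*" for e using no_arrow_reach[OF that end_arrow_runs(3)[OF sp]] .
  have qE: "e = q" if "(q, e) \<in> E\<^sup>*" for e using no_arrow_reach[OF that no_out_q] .
  have xc: "x \<noteq> c" using end_arrow_not_above[OF sp, of m] step.hyps(1) cz by auto
  show ?case
  proof (cases "(x, y) \<in> E")
    case xyE: True
    from step.IH show ?thesis
    proof (elim disjE)
      assume "x = m"
      then show ?thesis using out_centre[of y] xyE below pm not_both by (metis diff_Suc_1)
    next
      assume "x = q" then show ?thesis using no_out_q xyE by blast
    next
      assume "confined E x z" then show ?thesis using confined_trans xyE by (metis r_into_rtrancl)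
    qed
  next
    case False
    then have xyF: "(x, y) \<in> F" using step.hyps by blast
    have o: "(x, y) \<in> E\<^sup>* \<or> (\<exists>e. confined E y e \<and> (x, e) \<in> E\<^sup>* \<and> y \<noteq> e \<and> (e = z \<longrightarrow> (y, c) \<notin> (E \<union> F)\<^sup>*))"
      using end_arrow_other[OF sp xyF] xc by blast
    have xy_nE: "y \<noteq> x" using no_cycle[of x y] xyF by auto
    show ?thesis
    proof (cases "confined E x z")
      case True
      have "good_arrow E x y" using o unfolding good_arrow_def by blast
      then show ?thesis using confined_good_step[OF True] by blast
    next
      case nconf: False
      have from_m: "y = m \<or> y = q \<or> confined E y z" if "(m, y) \<in> E\<^sup>*" for y
        using that
      proof (cases rule: converse_rtranclE)
        case (step u)
        from out_centre[OF step(1)] show ?thesis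
        proof (elim disjE)
          assume "Suc u = m" then have "confined E u z" using below by auto
          then show ?thesis using confined_trans step(2) by metis
        next
          assume "u = p" then show ?thesis using step(1) pm not_both by blast
        next
          assume "u = q" then show ?thesis using qE step(2) by blast
        qed
      qed simp
      have "x = m \<or> x = q" using step.IH nconf by blast
      then show ?thesis
      proof
        assume x: "x = m"
        from o show ?thesis
        proof
          assume "(x, y) \<in> E\<^sup>*" then show ?thesis using from_m x by blast
        next
          assume "\<exists>e. confined E y e \<and> (x, e) \<in> E\<^sup>* \<and> y \<noteq> e \<and> (e = z \<longrightarrow> (y, c) \<notin> (E \<union> F)\<^sup>*)"
          then obtain e where e: "confined E y e" "(m, e) \<in> E\<^sup>*" "y \<noteq> e" using x by blast
          from from_m[OF e(2)] show ?thesis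
          proof (elim disjE)
            assume "e = m"
            then have "(y, m) \<in> (E \<union> F)\<^sup>*" using e(1) E_sub by (auto simp: confined_def)
            then show ?thesis using no_cycle[of m y] xyF x by blast
          next
            assume "e = q"
            then have "(y, q) \<in> E\<^sup>*" "y \<noteq> q" using e by (auto simp: confined_def)
            then obtain u where u: "(y, u) \<in> E\<^sup>*" "(u, q) \<in> E" by (meson rtranclE)
            then have "(y, m) \<in> (E \<union> F)\<^sup>*" using sw.in_end[OF u(2)] E_sub by blast
            then show ?thesis using no_cycle[of m y] xyF x by blast
          next
            assume ez: "confined E e z"
            have "(e, e) \<in> E\<^sup>*" by simp
            have "(y, z) \<in> E\<^sup>*" using e(1) ez unfolding confined_def by (meson rtrancl_trans)
            then have "(z, e) \<in> E\<^sup>*" using e(1) by (simp add: confined_def)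
            then have "e = z" by (rule zE)
            then show ?thesis using e(1) by blast
          qed
        qed
      next
        assume x: "x = q"
        from o have "(y, q) \<in> E\<^sup>*"
        proof
          assume "(x, y) \<in> E\<^sup>*" then show ?thesis using qE x xy_nE by blast
        next
          assume "\<exists>e. confined E y e \<and> (x, e) \<in> E\<^sup>* \<and> y \<noteq> e \<and> (e = z \<longrightarrow> (y, c) \<notin> (E \<union> F)\<^sup>*)"
          then obtain e where "confined E y e" "(q, e) \<in> E\<^sup>*" using x by blast
          then show ?thesis using qE by (auto simp: confined_def)
        qed
        then show ?thesis using no_cycle[of q y] xyF x E_sub by blast
      qed
    qed
  qed
qed simp

text \<open>Without the arrow \<open>c \<rightarrow> Suc c\<close> the quiver is a star with centre \<open>m\<close>: one arm passes through \<open>p\<close>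
  and, by the new arrow, through \<open>c\<close> to the vertex 1, one follows the tail from \<open>m\<close> to \<open>Suc c\<close>,
  and the last one is the arrow \<open>m \<rightarrow> q\<close>.\<close>

lemma arms_end_arrow:
  assumes sp: "end_arrow c z"
  shows "asym (insert (c, p) E)"
    "is_arm X (insert (c, p) E - {(c, Suc c)}) m (m # p # rev [1..<Suc c])"
    "is_arm X (insert (c, p) E - {(c, Suc c)}) m (rev [Suc c..<Suc m])"
    "is_arm X (insert (c, p) E - {(c, Suc c)}) m [m, q]"
    "set (m # p # rev [1..<Suc c]) \<union> set (rev [Suc c..<Suc m]) \<union> set [m, q] = X"
    "set (m # p # rev [1..<Suc c]) \<inter> set (rev [Suc c..<Suc m]) = {m}"
    "set (m # p # rev [1..<Suc c]) \<inter> set [m, q] = {m}"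
    "set (rev [Suc c..<Suc m]) \<inter> set [m, q] = {m}"
    "\<And>a b. (a, b) \<in> insert (c, p) E \<Longrightarrow> (a, b) \<noteq> (c, Suc c) \<Longrightarrow>
      adjacent (m # p # rev [1..<Suc c]) a b \<or> adjacent (rev [Suc c..<Suc m]) a b \<or> adjacent [m, q] a b"
proof -
  let ?E = "insert (c, p) E"
  have pm: "(p, m) \<in> E" and mq: "(m, q) \<in> E" and cz: "1 \<le> c" "c < z" "z < m"
    and up: "(c, Suc c) \<in> E" using sp by (auto simp: end_arrow_def)
  have cm: "c < m" using cz by simp
  have "(p, c) \<notin> E" using out_end[of c] cm by auto
  then show "asym ?E" using asymE ends(2) cm by (auto simp: asym_on_def)
  have tail: "joined (?E - {(c, Suc c)}) (Suc i) i" if "1 \<le> i" "i < m" "i \<noteq> c" for i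
    using tail_joined[OF that(1,2)] that(3) by (auto simp: joined_def)
  have split: "rev [1..<Suc c] = c # rev [1..<c]" using cz by simp
  have "successively (joined (?E - {(c, Suc c)})) (rev [1..<Suc c])"
    by (rule successively_rev_upt) (use cz tail in auto)
  moreover have "joined (?E - {(c, Suc c)}) p c" using cm ends(2) by (auto simp: joined_def)
  ultimately have "successively (joined (?E - {(c, Suc c)})) (p # rev [1..<Suc c])"
    unfolding split by (metis successively.simps(3))
  moreover have "joined (?E - {(c, Suc c)}) m p" using pm cm ends(2) by (auto simp: joined_def)
  ultimately have "successively (joined (?E - {(c, Suc c)})) (m # p # rev [1..<Suc c])" by simp
  moreover have "distinct (m # p # rev [1..<Suc c])" using cm ends(2) by auto
  moreover have "set (m # p # rev [1..<Suc c]) \<subseteq> X" unfolding X_eq using cm by auto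
  ultimately show "is_arm X (?E - {(c, Suc c)}) m (m # p # rev [1..<Suc c])"
    unfolding is_arm_def by (simp del: upt_Suc)
  have "successively (joined (?E - {(c, Suc c)})) (rev [Suc c..<Suc m])"
    by (rule successively_rev_upt) (use cm tail in auto)
  moreover have "set (rev [Suc c..<Suc m]) \<subseteq> X" by auto
  ultimately show "is_arm X (?E - {(c, Suc c)}) m (rev [Suc c..<Suc m])"
    using cm by (simp add: is_arm_def)
  have "set [m, q] \<subseteq> X" unfolding X_eq using cm by auto
  moreover have "joined (?E - {(c, Suc c)}) m q" using mq cm by (auto simp: joined_def)
  ultimately show "is_arm X (?E - {(c, Suc c)}) m [m, q]" using ends(3) by (simp add: is_arm_def)
  show "set (m # p # rev [1..<Suc c]) \<union> set (rev [Suc c..<Suc m]) \<union> set [m, q] = X"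
    unfolding X_eq using cm cz by auto
  show "set (m # p # rev [1..<Suc c]) \<inter> set (rev [Suc c..<Suc m]) = {m}" using cm ends(2) by auto
  show "set (m # p # rev [1..<Suc c]) \<inter> set [m, q] = {m}" using cm ends(1-3) by auto
  show "set (rev [Suc c..<Suc m]) \<inter> set [m, q] = {m}" using cm ends(3) by auto
  fix a b assume ab: "(a, b) \<in> ?E" "(a, b) \<noteq> (c, Suc c)"
  show "adjacent (m # p # rev [1..<Suc c]) a b \<or> adjacent (rev [Suc c..<Suc m]) a b \<or> adjacent [m, q] a b"
  proof (cases "(a, b) = (c, p)")
    case True
    then have "{a, b} = {p, c}" by auto
    from adjacent_Cons[OF adjacent_first[OF this]] show ?thesis unfolding split by blast
  next
    case False
    then have abE: "(a, b) \<in> E" using ab by blast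
    then consider i where "1 \<le> i" "i < m" "{a, b} = {i, Suc i}" | "{a, b} = {m, p}" | "{a, b} = {m, q}"
      using edge[of a b] by blast
    then show ?thesis
    proof cases
      case (1 i)
      consider "i < c" | "i = c" | "Suc c \<le> i" by linarith
      then show ?thesis
      proof cases
        case 1
        then show ?thesis
          using adjacent_Cons[OF adjacent_Cons[OF adjacent_rev_upt[OF \<open>1 \<le> i\<close> _ \<open>{a, b} = {i, Suc i}\<close>]]] by blast
      next
        case 2
        then have "(a, b) = (Suc c, c)" using 1(3) ab(2) by (auto simp: doubleton_eq_iff)
        then show ?thesis using abE up not_both by blast
      next
        case 3
        then show ?thesis using adjacent_rev_upt[OF 3 1(2,3)] by blast
      qed
    next
      case 2 then show ?thesis using adjacent_first[of a b m p] by blast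
    next
      case 3 then show ?thesis using adjacent_first[of a b m q "[]"] by simp
    qed
  qed
qed

text \<open>These are the hypotheses of \<open>joint_kernel_inj\<close>; they make the maps from the tail into the space
  at \<open>z\<close> injective.\<close>

lemma end_arrow_tail_max:
  assumes sp: "end_arrow c z" and y: "c < y" "y < m"
  shows "(y, z) \<in> P" "\<forall>w\<in>max_elems P. (y, w) \<in> P \<longrightarrow> (z, w) \<in> P"
proof -
  have conf: "confined E y z" by (rule end_arrow_confined[OF sp y])
  have yX: "y \<in> X" using y by auto
  have yz: "(y, z) \<in> E\<^sup>*" using conf by (simp add: confined_def)
  have zX: "z \<in> X" using stays[OF E_sub[OF yz] yX] .
  show "(y, z) \<in> P" unfolding P_iff using yX zX E_sub[OF yz] by blast
  show "\<forall>w\<in>max_elems P. (y, w) \<in> P \<longrightarrow> (z, w) \<in> P"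
  proof (intro ballI impI)
    fix w assume w: "w \<in> max_elems P" "(y, w) \<in> P"
    have "(y, c) \<notin> (E \<union> F)\<^sup>*" using end_arrow_not_above[OF sp] y by simp
    then have "confined E w z" using end_arrow_reach[OF sp conf] w(2) unfolding P_iff by blast
    then have "w = z" using confined_max[OF yz yX _ w(1)] by blast
    then show "(z, w) \<in> P" unfolding P_iff using zX by blast
  qed
qed

text \<open>Hence a vector at \<open>m\<close> that dies at \<open>q\<close> and at \<open>z\<close> is zero in a socle-projective module.\<close>

lemma end_arrow_top_max:
  assumes sp: "end_arrow c z" and w: "w \<in> max_elems P" "(m, w) \<in> P"
  shows "w = q \<or> w = z"
proof -
  have mq: "(m, q) \<in> E" and cz: "c < z" "z < m" using sp by (auto simp: end_arrow_def)
  have "w \<noteq> m"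
  proof
    assume "w = m"
    moreover have "(m, q) \<in> P" using arrows_P mq by blast
    ultimately have "q = m" using w(1) by (auto simp: max_elems_def)
    then show False using ends(3) by simp
  qed
  moreover have "(z, z) \<in> E\<^sup>*" by simp
  moreover have "z \<in> X" using cz by auto
  ultimately show ?thesis using end_arrow_top[OF sp, of w] confined_max[of z z w] w unfolding P_iff by blast
qed

section \<open>The three cases\<close>

lemma arrows_good:
  assumes no_end_arrow: "\<And>c z. \<not> end_arrow c z" "\<And>c z. \<not> forked_quiver.end_arrow m q p E F c z"
    and no_out: "(p, q) \<in> F \<or> (q, p) \<in> F \<Longrightarrow> \<not> ((m, p) \<in> E \<and> (m, q) \<in> E)"
    and st: "(s, t) \<in> F"
  shows "good_arrow E s t"
proof -
  interpret sw: forked_quiver m q p E F by (rule swapped)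
  from st show ?thesis
  proof (cases rule: arrow_cases)
    case 1
    then show ?thesis using branch_arrow[OF st] no_end_arrow(1) unfolding good_arrow_def by blast
  next
    case 2
    then show ?thesis using sw.branch_arrow[OF st] no_end_arrow(2) unfolding good_arrow_def by blast
  next
    case 3 then show ?thesis using free_arrow st no_out by blast
  next
    case 4 then show ?thesis using sw.free_arrow st no_out by blast
  qed
qed

end

context ambient_space
begin

lemma finitely_coded_end_arrow:
  assumes "forked_quiver m p q E F" and sp: "forked_quiver.end_arrow m p q E F c z"
  shows "finitely_coded (quiver_poset {Suc 0..Suc (Suc m)} (E \<union> F))"
proof -
  interpret forked_quiver m p q E F by (rule assms(1))
  let ?E = "insert (c, p) E"
  have cz: "1 \<le> c" "c < z" "z < m" and pm: "(p, m) \<in> E" and mq: "(m, q) \<in> E" and cp: "(c, p) \<in> F"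
    and up: "\<And>l. c \<le> l \<Longrightarrow> l < z \<Longrightarrow> (l, Suc l) \<in> E" and dn: "\<And>l. z \<le> l \<Longrightarrow> l < m \<Longrightarrow> (Suc l, l) \<in> E"
    using sp by (auto simp: end_arrow_def)
  define us where "us = rev [Suc z..<Suc m]"
  define ws where "ws = rev [Suc c..<z]"
  define ys where "ys = rev [1..<c]"
  have ys: "rev [1..<Suc c] = c # ys" using cz by (simp add: ys_def)
  have zws: "z # ws = rev [Suc c..<Suc z]" using cz by (simp add: ws_def)
  have usz: "us @ [z] = rev [z..<Suc m]" unfolding us_def by (subst upt_conv_Cons) (use cz in auto)
  have arm2: "us @ z # ws = rev [Suc c..<Suc m]"
    unfolding zws unfolding us_def rev_append[symmetric]
    by (subst upt_split[of "Suc c" "Suc z" "Suc m"]) (use cz in auto)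
  note arms = arms_end_arrow[OF sp, unfolded ys arm2[symmetric]]
  note P_poset = finite_poset_P[unfolded finite_poset_def order_on_defs]
  show ?thesis
  proof (rule finitely_coded_of_blocks[OF finite_poset_P determines_end_arrow[OF sp]])
    fix M h assume M: "sp_indec P M" and h: "extends_maps P M h" and rep: "is_rep (Field P) ?E (sp M) h"
    have mod: "is_module scale P M" "joint_kernel_zero P M" using M by (auto simp: sp_indec_def)
    have hM: "h a b u = mp M a b u" if "(a, b) \<in> P" "u \<in> sp M a" for a b u
      using extends_mapsD(2)[OF h that] .
    show "\<exists>e \<beta>. blocks (Field P) ?E (sp M) h e \<beta>"
      unfolding Field_P
    proof (rule blocks_of_cycle[where r = P and c' = "Suc c" and z = z,
          OF rep[unfolded Field_P] arms(1) _ _ _ _ extends_mapsD(1)[OF h] _ _ arms(2-8) _ _ _ _ _ _ _ _ _ _ arms(9)])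
      show "h b d (h a b u) = h a d u" if ab: "(a, b) \<in> P" "(b, d) \<in> P" and u: "u \<in> sp M a" for a b d u
      proof -
        have "(a, d) \<in> P" using ab P_poset by (blast dest: transD)
        then show ?thesis using hM ab u is_moduleD(4)[OF mod(1) ab(1) u] is_moduleD(9)[OF mod(1) ab u] by simp
      qed
      show "trans P" using P_poset by blast
      show "(x, x) \<in> P" if "x \<in> X" for x using that unfolding P_iff by blast
      show "?E \<subseteq> P" using arrows_P cp by blast
      show "h a b ` sp M a \<subseteq> sp M b" if "(a, b) \<in> P" for a b
        using hM[OF that] is_moduleD(4)[OF mod(1) that] by auto
      show "h x x u = u" if "x \<in> X" "u \<in> sp M x" for x u
      proof -
        have "(x, x) \<in> P" using that(1) unfolding P_iff by blast
        then show ?thesis using hM that is_moduleD(8)[OF mod(1), of x u] Field_P by auto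
      qed
      show "(c, p) \<in> ?E" by simp
      show "(p, m) \<in> ?E" "(m, q) \<in> ?E" using pm mq by auto
      show "(c, Suc c) \<in> ?E" using up[of c] cz by auto
      show "us \<noteq> []" using cz by (simp add: us_def)
      show "Suc c = last (z # ws)" unfolding zws using cz by (simp add: last_rev)
      show "successively (\<lambda>x y. (y, x) \<in> ?E) (z # ws)"
        unfolding zws by (rule successively_rev_upt) (use cz up in auto)
      show "successively (\<lambda>x y. (x, y) \<in> ?E) (us @ [z])"
        unfolding usz by (rule successively_rev_upt) (use cz dn in auto)
      show "u = 0" if y: "y \<in> set (tl (us @ z # ws))" and u: "u \<in> sp M y" "h y z u = 0" for y u
      proof -
        have "rev [Suc c..<Suc m] = m # rev [Suc c..<m]" using cz by simp
        then have y: "c < y" "y < m" using y unfolding arm2 by auto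
        have yz: "(y, z) \<in> P" and max: "\<forall>w\<in>max_elems P. (y, w) \<in> P \<longrightarrow> (z, w) \<in> P"
          using end_arrow_tail_max[OF sp y] by blast+
        show ?thesis by (rule joint_kernel_inj[OF mod yz max u(1)]) (use hM[OF yz u(1)] u(2) in simp)
      qed
      show "u = 0" if u: "u \<in> sp M m" "h m q u = 0" "h m z u = 0" for u
      proof -
        have "mp M m w u = 0" if w: "w \<in> max_elems P" "(m, w) \<in> P" for w
          using end_arrow_top_max[OF sp w] hM[OF w(2) u(1)] u by auto
        moreover have "m \<in> Field P" unfolding Field_P using cz by auto
        ultimately show ?thesis using mod(2) u(1) unfolding joint_kernel_zero_def by blast
      qed
    qed
  qed
qed

lemma finitely_coded_outgoing_ends:
  assumes "forked_quiver m p q E F" and "(p, q) \<in> F" "(m, p) \<in> E" "(m, q) \<in> E"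
  shows "finitely_coded (quiver_poset {Suc 0..Suc (Suc m)} (E \<union> F))"
proof -
  interpret forked_quiver m p q E F by (rule assms(1))
  note arms = arms_outgoing[OF assms(3,4)]
  show ?thesis
  proof (rule finitely_coded_of_blocks[OF finite_poset_P determines_outgoing_ends[OF assms(2-4)]])
    fix M h assume rep: "is_rep (Field P) (insert (p, q) (E - {(m, q)})) (sp M) h"
    show "\<exists>e \<beta>. blocks (Field P) (insert (p, q) (E - {(m, q)})) (sp M) h e \<beta>"
      unfolding Field_P
      by (rule blocks_of_short_arms[OF rep[unfolded Field_P] arms(1-8) _ _ arms(9)]) simp_all
  qed
qed

lemma finitely_coded_of_good_arrows:
  assumes "forked_quiver m p q E F" and good: "\<And>s t. (s, t) \<in> F \<Longrightarrow> good_arrow E s t"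
  shows "finitely_coded (quiver_poset {Suc 0..Suc (Suc m)} (E \<union> F))"
proof -
  interpret forked_quiver m p q E F by (rule assms(1))
  interpret sw: forked_quiver m q p E F by (rule swapped)
  show ?thesis
  proof (rule finitely_coded_of_blocks[OF finite_poset_P determines_good[OF good]])
    fix M h assume rep: "is_rep (Field P) E (sp M) h"
    show "\<exists>e \<beta>. blocks (Field P) E (sp M) h e \<beta>"
      unfolding Field_P
      by (rule blocks_of_short_arms[OF rep[unfolded Field_P] asymE arms_of_fork(1,2) sw.arms_of_fork(2) arms_of_fork(3-6) _ _ arrows_of_fork])
        simp_all
  qed
qed

lemma finitely_coded_forked:
  assumes fq: "forked_quiver m p q E F"
  shows "finitely_coded (quiver_poset {Suc 0..Suc (Suc m)} (E \<union> F))"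
proof -
  interpret forked_quiver m p q E F by (rule fq)
  consider c z where "end_arrow c z" | c z where "forked_quiver.end_arrow m q p E F c z"
    | "(p, q) \<in> F" "(m, p) \<in> E" "(m, q) \<in> E" | "(q, p) \<in> F" "(m, q) \<in> E" "(m, p) \<in> E"
    | "\<And>c z. \<not> end_arrow c z" "\<And>c z. \<not> forked_quiver.end_arrow m q p E F c z"
      "(p, q) \<in> F \<or> (q, p) \<in> F \<Longrightarrow> \<not> ((m, p) \<in> E \<and> (m, q) \<in> E)" by blast
  then show ?thesis
  proof cases
    case 1 then show ?thesis by (rule finitely_coded_end_arrow[OF fq])
  next
    case 2 then show ?thesis by (rule finitely_coded_end_arrow[OF swapped])
  next
    case 3 then show ?thesis by (rule finitely_coded_outgoing_ends[OF fq])
  next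
    case 4 then show ?thesis by (rule finitely_coded_outgoing_ends[OF swapped])
  next
    case 5
    show ?thesis by (rule finitely_coded_of_good_arrows[OF fq arrows_good[OF 5]])
  qed
qed

end

lemma forked_quiver_of_dynkin_D:
  assumes D: "dynkin_D (Suc (Suc m)) E"
    and F: "F \<subseteq> {1..Suc (Suc m)} \<times> {1..Suc (Suc m)}" "acyclic (E \<union> F)"
    and alien: "\<forall>vs\<in>{branch1 (Suc (Suc m)), branch2 (Suc (Suc m))}.
      alien_set vs (Restr E (set vs)) (Restr F (set vs))"
  shows "forked_quiver m (Suc m) (Suc (Suc m)) E F"
proof
  have m: "2 \<le> m" using D by (simp add: dynkin_D_def)
  then show "2 \<le> m" .
  have br: "branch1 (Suc (Suc m)) = [1..<Suc m] @ [Suc m]" "branch2 (Suc (Suc m)) = [1..<Suc m] @ [Suc (Suc m)]"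
    by simp_all
  have sets: "set ([1..<Suc m] @ [x]) = insert x {1..m}" for x by auto
  show "alien_set ([1..<Suc m] @ [Suc m]) (Restr E (insert (Suc m) {1..m})) (Restr F (insert (Suc m) {1..m}))"
    using bspec[OF alien insertI1] unfolding br sets .
  show "alien_set ([1..<Suc m] @ [Suc (Suc m)]) (Restr E (insert (Suc (Suc m)) {1..m}))
      (Restr F (insert (Suc (Suc m)) {1..m}))"
    using bspec[OF alien insertI2[OF singletonI]] unfolding br sets .
  have E: "asym E" "(\<lambda>(x, y). {x, y}) ` E = {{i, i + 1} | i. i \<in> {1..m - 1}} \<union> {{m, Suc m}, {m, Suc (Suc m)}}"
    using D by (simp_all add: dynkin_D_def orientation_of_def numeral_eq_Suc)
  then show "asym E" by blast
  fix x y
  have "(x, y) \<in> E \<or> (y, x) \<in> E \<longleftrightarrow> {x, y} \<in> (\<lambda>(x, y). {x, y}) ` E"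
    by (force simp: doubleton_eq_iff)
  also have "\<dots> \<longleftrightarrow> (\<exists>i. 1 \<le> i \<and> i < m \<and> {x, y} = {i, Suc i}) \<or> {x, y} = {m, Suc m} \<or> {x, y} = {m, Suc (Suc m)}"
  proof -
    have "i \<in> {1..m - 1} \<longleftrightarrow> 1 \<le> i \<and> i < m" for i using m by auto
    then show ?thesis unfolding E(2) by auto
  qed
  finally show "(x, y) \<in> E \<or> (y, x) \<in> E \<longleftrightarrow>
    (\<exists>i. 1 \<le> i \<and> i < m \<and> {x, y} = {i, Suc i}) \<or> {x, y} = {m, Suc m} \<or> {x, y} = {m, Suc (Suc m)}" .
qed (use F in auto)

theorem proposition3p11:
  fixes r :: "'a rel"
    and scale :: "'k::alg_closed_field \<Rightarrow> 'b::ab_group_add \<Rightarrow> 'b"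
  assumes "vector_space scale"
    and "type_D r"
  shows "finite_sp_type scale r"
proof -
  interpret ambient_space scale unfolding ambient_space_def by (rule assms(1))
  obtain n E F where n: "admissible_D n E" "F \<subseteq> {1..n} \<times> {1..n}"
      "\<forall>vs\<in>{branch1 n, branch2 n}. alien_set vs (Restr E (set vs)) (Restr F (set vs))"
      "acyclic (E \<union> F)" "poset_isomorphic r (quiver_poset {1..n} (E \<union> F))" and r: "finite_poset r"
    using assms(2) unfolding type_D_def by (elim exE conjE) (rule that)
  have D: "dynkin_D n E" using n(1) by (simp add: admissible_D_def)
  then have "4 \<le> n" by (simp add: dynkin_D_def)
  define m where "m = n - 2"
  have nm: "n = Suc (Suc m)" using \<open>4 \<le> n\<close> by (simp add: m_def)
  have "finitely_coded (quiver_poset {1..n} (E \<union> F))"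
    using finitely_coded_forked[OF forked_quiver_of_dynkin_D[OF D[unfolded nm] n(2)[unfolded nm] n(4) n(3)[unfolded nm]]]
    by (simp add: nm)
  then show ?thesis by (rule finite_sp_type_transfer[OF r n(5)])
qed

end
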